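(* Let $m\ge 1$, $n\ge 1$, and let $H$ be a homogeneous elliptic operator of order $2m$ with real constant coefficients on $\mathbb{R}^n$. Let $\nu\in S^{n-1}$ and $\mathbf{H}^n_\nu=\{x\in\mathbb{R}^n:\nu\cdot x>0\}$. Then for all $u\in C^\infty_c(\mathbf{H}^n_\nu)$ (real-valued), $$\int_{\mathbf{H}^n_\nu} u(x)\,Hu(x)\,dx\ \ge\ A(m)\int_{\mathbf{H}^n_\nu}\frac{u^2(x)}{d_H^{2m}(x)}\,dx,$$ where $d_H$ is the Finsler distance to $\partial\mathbf{H}^n_\nu$. Moreover, if $F_H$ is a convex function on $\mathbb{R}^n$, then the constant $A(m)$ is optimal: for every $\nu\in S^{n-1}$, no constant larger than $A(m)$ makes this inequality valid for all $u\in C^\infty_c(\mathbf{H}^n_\nu)$.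
   Context: $H=(-1)^m\sum_{|\alpha|=2m}a_\alpha D^\alpha$ with real constants $a_\alpha$, where $D^\alpha=\partial_{x_1}^{\alpha_1}\cdots\partial_{x_n}^{\alpha_n}$; its symbol is $H(\xi)=\sum_{|\alpha|=2m}a_\alpha\xi^\alpha$, and ellipticity means $H(\xi)>0$ for all $\xi\neq0$. Set $F_H(\xi)=H(\xi)^{1/(2m)}$ and define the Finsler norm $F_H^*(\omega)=\sup_{\xi\neq0}\frac{\omega\cdot\xi}{F_H(\xi)}$. For an open set $\Omega\subset\mathbb{R}^n$ with nonempty boundary, the Finsler distance to the boundary is $d_H(x)=\min\{F_H^*(x-y):y\in\partial\Omega\}$, $x\in\Omega$. The constant is $A(m)=\frac{(2m-1)^2(2m-3)^2\cdots 3^2\cdot1^2}{4^m}$. *)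

theory Defs
  imports "HOL-Analysis.Analysis"
begin

definition multi_indices :: "nat \<Rightarrow> ('n::finite \<Rightarrow> nat) set" where
  "multi_indices k = {\<alpha>. (\<Sum>i\<in>UNIV. \<alpha> i) = k}"

definition pderiv_coord :: "'n::finite \<Rightarrow> (real^'n \<Rightarrow> real) \<Rightarrow> real^'n \<Rightarrow> real" where
  "pderiv_coord i f x = deriv (\<lambda>t. f (x + t *\<^sub>R axis i 1)) 0"

fun iter_pderiv :: "'n::finite list \<Rightarrow> (real^'n \<Rightarrow> real) \<Rightarrow> real^'n \<Rightarrow> real" where
  "iter_pderiv [] f = f"
| "iter_pderiv (i # is) f = pderiv_coord i (iter_pderiv is f)"

text \<open>D^alpha: differentiate alpha i times in direction i (for smooth functions the
  order is irrelevant).\<close>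
definition Dalpha :: "('n::finite \<Rightarrow> nat) \<Rightarrow> (real^'n \<Rightarrow> real) \<Rightarrow> real^'n \<Rightarrow> real" where
  "Dalpha \<alpha> f = iter_pderiv (SOME L. \<forall>i. count_list L i = \<alpha> i) f"

definition smooth_fun :: "(real^'n::finite \<Rightarrow> real) \<Rightarrow> bool" where
  "smooth_fun f \<longleftrightarrow> (\<forall>L x. iter_pderiv L f differentiable (at x))"

definition tsupport :: "(real^'n::finite \<Rightarrow> real) \<Rightarrow> (real^'n) set" where
  "tsupport f = closure {x. f x \<noteq> 0}"

definition Cc_inf :: "(real^'n::finite) set \<Rightarrow> (real^'n \<Rightarrow> real) set" where
  "Cc_inf \<Omega> = {f. smooth_fun f \<and> compact (tsupport f) \<and> tsupport f \<subseteq> \<Omega>}"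

definition hom_op :: "nat \<Rightarrow> (('n::finite \<Rightarrow> nat) \<Rightarrow> real) \<Rightarrow> (real^'n \<Rightarrow> real) \<Rightarrow> real^'n \<Rightarrow> real" where
  "hom_op m a u x = (-1)^m * (\<Sum>\<alpha>\<in>multi_indices (2*m). a \<alpha> * Dalpha \<alpha> u x)"

definition hom_symbol :: "nat \<Rightarrow> (('n::finite \<Rightarrow> nat) \<Rightarrow> real) \<Rightarrow> real^'n \<Rightarrow> real" where
  "hom_symbol m a \<xi> = (\<Sum>\<alpha>\<in>multi_indices (2*m). a \<alpha> * (\<Prod>i\<in>UNIV. (\<xi> $ i) ^ \<alpha> i))"

definition elliptic :: "nat \<Rightarrow> (('n::finite \<Rightarrow> nat) \<Rightarrow> real) \<Rightarrow> bool" where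
  "elliptic m a \<longleftrightarrow> (\<forall>\<xi>::real^'n. \<xi> \<noteq> 0 \<longrightarrow> hom_symbol m a \<xi> > 0)"

definition F_H :: "nat \<Rightarrow> (('n::finite \<Rightarrow> nat) \<Rightarrow> real) \<Rightarrow> real^'n \<Rightarrow> real" where
  "F_H m a \<xi> = hom_symbol m a \<xi> powr (1 / (2 * real m))"

definition F_H_dual :: "nat \<Rightarrow> (('n::finite \<Rightarrow> nat) \<Rightarrow> real) \<Rightarrow> real^'n \<Rightarrow> real" where
  "F_H_dual m a \<omega> = (SUP \<xi>\<in>{\<xi>. \<xi> \<noteq> 0}. (\<omega> \<bullet> \<xi>) / F_H m a \<xi>)"

text \<open>Finsler distance to the boundary (the minimum is written as an infimum).\<close>
definition d_H :: "nat \<Rightarrow> (('n::finite \<Rightarrow> nat) \<Rightarrow> real) \<Rightarrow> (real^'n) set \<Rightarrow> real^'n \<Rightarrow> real" where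
  "d_H m a \<Omega> x = (INF y\<in>frontier \<Omega>. F_H_dual m a (x - y))"

definition A_const :: "nat \<Rightarrow> real" where
  "A_const m = (\<Prod>k=1..m. (2 * real k - 1)^2) / 4 ^ m"

definition halfspace :: "real^'n::finite \<Rightarrow> (real^'n) set" where
  "halfspace \<nu> = {x. \<nu> \<bullet> x > 0}"

end

theory Submission
  imports Defs "HOL-Probability.Probability" "HOL-Computational_Algebra.Fundamental_Theorem_Algebra"
begin

text \<open>
  The Finsler distance satisfies \<open>d\<^sub>H(x) \<ge> (\<nu> \<bullet> x) / F\<^sub>H(\<nu>)\<close>, with equality for convex \<open>F\<^sub>H\<close> (take a
  subgradient of \<open>F\<^sub>H\<close> at \<open>\<nu>\<close>), so the question is about the weight \<open>H(\<nu>) / (\<nu> \<bullet> x)\<^sup>2\<^sup>m\<close>.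

  For the inequality, let \<open>V(\<xi>, s) = \<integral> u(x) \<phi>(s - \<nu> \<bullet> x) e\<^sup>-\<^sup>i\<^sup>\<xi>\<^sup>\<bullet>\<^sup>x dx\<close> with a bump function \<open>\<phi>\<close> supported
  in \<open>[-\<delta>, 0]\<close>. Replacing \<open>u\<close> by \<open>Hu\<close> turns \<open>V\<close> into \<open>P(D\<^sub>s)V\<close>, where \<open>P(t) = H(\<xi> + t\<nu>)\<close> is a nonnegative
  polynomial with leading coefficient \<open>H(\<nu>)\<close>. Factoring \<open>P = H(\<nu>) |\<Prod>(t - z\<^sub>j)|\<^sup>2\<close> with \<open>Im z\<^sub>j \<ge> 0\<close> and
  applying a weighted Hardy inequality to each first-order factor gives the one-dimensional estimate for
  every \<open>\<xi>\<close>. Averaging over \<open>\<xi>\<close> with wide Gaussians recovers the integrals over \<open>x\<close>; since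
  \<open>\<phi>\<close> looks backwards only, the weight \<open>s\<^sup>-\<^sup>2\<^sup>m\<close> dominates \<open>(\<nu> \<bullet> x)\<^sup>-\<^sup>2\<^sup>m\<close> on its support.

  For optimality, use \<open>u(x) = \<psi>(\<nu> \<bullet> x / \<epsilon>) \<Psi>(x)\<close> with \<open>\<Psi>\<close> constant along \<open>\<nu>\<close>: as \<open>\<epsilon> \<rightarrow> 0\<close> the quotient
  tends to the one-dimensional one for \<open>\<psi>\<close>, which is close to \<open>A(m)\<close> for \<open>\<psi>(s) = s\<^sup>m\<^sup>-\<^sup>1\<^sup>/\<^sup>2 G(\<delta> ln s)\<close>.
\<close>

text \<open>The direction \<nu> is arbitrary, and the normal variable is separated without rotating
  it to an axis: s enters only through the window, and the full frequency \<xi> stays in the phase.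
  Integration by parts then turns the i-th partial derivative into \<i>(\<xi>_i + \<nu>_i D) with D
  = -\<i> d/ds, which is where H(\<xi> + t\<nu>) comes from. In place of a Plancherel formula, the
  one-dimensional inequality is read as nonnegativity of the integral of a kernel h(x, y) cos(\<xi>
  \<bullet> (x - y)) for every \<xi>; the Gaussian average concentrates it on y = x. The roots are
  halved because P(D) is then H(\<nu>) times q(D) followed by its adjoint, so the quadratic form is
  a squared norm. The condition Im z \<ge> 0 fixes the sign of the zeroth-order term left over when
  completing the square. The factor acting on the weight s^(-2k) costs (k + 1/2)^2, and the product
  over k < m is A(m). The exponent m - 1/2 is the one for which both \<psi> times its 2m-th
  derivative and \<psi>^2 s^(-2m) scale like 1/s; differentiating s^(m - 1/2) 2m times produces
  exactly (-1)^m A(m), so a cutoff that varies slowly in ln s comes close to equality.\<close>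

unbundle no fps_syntax

subsection \<open>Smooth functions\<close>

text \<open>Smoothness quantifies over all iterated partial derivatives, for which products have no
  convenient closed form. By induction on the list it is enough to name a set of differentiable
  functions that is stable under each partial derivative.\<close>

lemma smooth_fun_coinduct:
  assumes "f \<in> C" "\<And>g x. g \<in> C \<Longrightarrow> g differentiable (at x)"
    "\<And>g i. g \<in> C \<Longrightarrow> pderiv_coord i g \<in> C"
  shows "smooth_fun f"
proof -
  have "iter_pderiv L f \<in> C" for L
    by (induction L) (use assms in auto)
  then show ?thesis using assms(2) by (auto simp: smooth_fun_def)
qed

lemma iter_pderiv_append: "iter_pderiv (K @ L) f = iter_pderiv K (iter_pderiv L f)"
  by (induction K) auto

lemma smooth_fun_pderiv: "smooth_fun f \<Longrightarrow> smooth_fun (pderiv_coord i f)"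
  unfolding smooth_fun_def using iter_pderiv_append[of _ "[i]" f] by (metis iter_pderiv.simps)

lemma smooth_fun_iter_pderiv: "smooth_fun f \<Longrightarrow> smooth_fun (iter_pderiv L f)"
  by (induction L) (auto intro: smooth_fun_pderiv)

lemma smooth_fun_differentiable: "smooth_fun f \<Longrightarrow> f differentiable (at x)"
  unfolding smooth_fun_def by (metis iter_pderiv.simps(1))

lemma smooth_fun_continuous: "smooth_fun f \<Longrightarrow> continuous_on S f"
  by (meson smooth_fun_differentiable continuous_at_imp_continuous_on differentiable_imp_continuous_within)

lemma has_derivative_line:
  assumes "(f has_derivative D) (at x)"
  shows "((\<lambda>t::real. f (x + t *\<^sub>R v)) has_vector_derivative D v) (at 0)"
proof -
  have "((\<lambda>t::real. x + t *\<^sub>R v) has_derivative (\<lambda>t. t *\<^sub>R v)) (at 0)"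
    by (auto intro!: derivative_eq_intros)
  moreover have "(f has_derivative D) (at (x + 0 *\<^sub>R v))" using assms by simp
  ultimately have "(f \<circ> (\<lambda>t. x + t *\<^sub>R v) has_derivative D \<circ> (\<lambda>t. t *\<^sub>R v)) (at 0)"
    by (rule diff_chain_at)
  then show ?thesis
    using linear_scale[OF has_derivative_linear[OF assms]]
    by (simp add: has_vector_derivative_def o_def)
qed

lemma pderiv_coord_eq:
  assumes "(f has_derivative D) (at x)"
  shows "pderiv_coord i f x = D (axis i 1)"
  unfolding pderiv_coord_def
  using has_derivative_line[OF assms, of "axis i 1"]
  by (intro DERIV_imp_deriv) (simp add: has_real_derivative_iff_has_vector_derivative)

lemma smooth_fun_has_derivative:
  fixes f :: "real^'n::finite \<Rightarrow> real"
  assumes "smooth_fun f"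
  shows "(f has_derivative (\<lambda>h. \<Sum>i\<in>UNIV. h $ i * pderiv_coord i f x)) (at x)"
proof -
  obtain D where D: "(f has_derivative D) (at x)"
    using smooth_fun_differentiable[OF assms] by (auto simp: differentiable_def)
  interpret linear D using D by (rule has_derivative_linear)
  have "D h = (\<Sum>i\<in>UNIV. h $ i * pderiv_coord i f x)" for h
  proof -
    have "D h = D (\<Sum>i\<in>UNIV. h $ i *\<^sub>R axis i 1)"
      using basis_expansion[of h] by (simp add: scalar_mult_eq_scaleR)
    then show ?thesis by (simp add: sum scale pderiv_coord_eq[OF D])
  qed
  then show ?thesis using D by presburger
qed

lemma smooth_fun_line_derivative:
  assumes "smooth_fun f"
  shows "((\<lambda>t::real. f (x + t *\<^sub>R axis i 1)) has_real_derivative pderiv_coord i f x) (at 0)"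
proof -
  have "(\<Sum>j\<in>UNIV. axis i 1 $ j * pderiv_coord j f x) = (\<Sum>j\<in>UNIV. if j = i then pderiv_coord j f x else 0)"
    by (intro sum.cong) (auto simp: axis_def)
  then show ?thesis
    using has_derivative_line[OF smooth_fun_has_derivative[OF assms, of x], of "axis i 1"]
    by (simp add: has_real_derivative_iff_has_vector_derivative)
qed

lemma zero_outside_tsupport: "x \<notin> tsupport f \<Longrightarrow> f x = 0"
  using closure_subset[of "{x. f x \<noteq> 0}"] by (auto simp: tsupport_def)

lemma pderiv_coord_outside:
  assumes "closed S" "\<And>y. y \<notin> S \<Longrightarrow> f y = 0" "x \<notin> S"
  shows "pderiv_coord i f x = 0"
proof -
  have "open (- S)" using assms(1) by (rule open_Compl)
  have "(f has_derivative (\<lambda>h. 0)) (at x)"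
  proof (rule has_derivative_transform_within_open[OF has_derivative_const \<open>open (- S)\<close>])
    show "x \<in> - S" using assms(3) by simp
    show "0 = f y" if "y \<in> - S" for y using assms(2)[of y] that by simp
  qed
  then show ?thesis by (rule pderiv_coord_eq)
qed

lemma iter_pderiv_outside:
  assumes "closed S" "\<And>y. y \<notin> S \<Longrightarrow> f y = 0" "x \<notin> S"
  shows "iter_pderiv L f x = 0"
  using assms(3)
proof (induction L arbitrary: x)
  case Nil
  then show ?case by (simp add: assms(2))
next
  case (Cons i L)
  then show ?case by (simp add: pderiv_coord_outside[OF assms(1)])
qed

section \<open>Smooth functions of one real variable\<close>

definition smooth1 :: "(real \<Rightarrow> real) \<Rightarrow> bool" where
  "smooth1 f \<longleftrightarrow> (\<forall>k x. (deriv ^^ k) f field_differentiable (at x))"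

lemma smooth1_coinduct:
  assumes "f \<in> C" "\<And>g x. g \<in> C \<Longrightarrow> g field_differentiable (at x)"
    "\<And>g. g \<in> C \<Longrightarrow> deriv g \<in> C"
  shows "smooth1 f"
proof -
  have "(deriv ^^ k) f \<in> C" for k
    by (induction k) (use assms in auto)
  then show ?thesis using assms(2) by (auto simp: smooth1_def)
qed

lemma smooth1_deriv: "smooth1 f \<Longrightarrow> smooth1 (deriv f)"
proof -
  assume f: "smooth1 f"
  have "(deriv ^^ k) (deriv f) = (deriv ^^ Suc k) f" for k by (simp add: funpow_swap1)
  with f show ?thesis unfolding smooth1_def by (metis (no_types))
qed

lemma smooth1_higher_deriv: "smooth1 f \<Longrightarrow> smooth1 ((deriv ^^ k) f)"
  by (induction k) (auto intro: smooth1_deriv)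

lemma smooth1_DERIV: "smooth1 f \<Longrightarrow> (f has_real_derivative deriv f x) (at x)"
proof -
  assume "smooth1 f"
  then have "(deriv ^^ 0) f field_differentiable (at x)" unfolding smooth1_def by blast
  then show ?thesis by (simp add: field_differentiable_derivI)
qed

lemma smooth1_DERIV': "smooth1 f \<Longrightarrow> ((deriv ^^ k) f has_real_derivative (deriv ^^ Suc k) f x) (at x)"
  using smooth1_DERIV[OF smooth1_higher_deriv] by auto

lemma smooth1_continuous: "smooth1 f \<Longrightarrow> continuous_on S f"
  by (intro continuous_at_imp_continuous_on ballI DERIV_isCont[OF smooth1_DERIV])

lemma smooth1_family:
  assumes "F \<in> C" and "\<And>g. g \<in> C \<Longrightarrow> \<exists>g'\<in>C. \<forall>x. (g has_real_derivative g' x) (at x)"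
  shows "smooth1 F"
proof (rule smooth1_coinduct[OF assms(1)])
  fix g assume "g \<in> C"
  then obtain g' where g': "g' \<in> C" "\<And>x. (g has_real_derivative g' x) (at x)" using assms(2) by blast
  then show "g field_differentiable (at x)" for x by (auto simp: field_differentiable_def)
  have "deriv g = g'" by (intro ext DERIV_imp_deriv g'(2))
  with g'(1) show "deriv g \<in> C" by simp
qed

text \<open>Products alone are not stable under differentiation; by the Leibniz rule their finite
  sums are, and this stability is what \<open>smooth1_family\<close> asks for.\<close>

inductive_set prod1_span :: "(real \<Rightarrow> real) set" where
  prod1_base: "smooth1 f \<Longrightarrow> smooth1 g \<Longrightarrow> (\<lambda>x. f x * g x) \<in> prod1_span"
| prod1_add: "f \<in> prod1_span \<Longrightarrow> g \<in> prod1_span \<Longrightarrow> (\<lambda>x. f x + g x) \<in> prod1_span"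

lemma smooth1_prod1_span: "h \<in> prod1_span \<Longrightarrow> smooth1 h"
proof (rule smooth1_family[where C = prod1_span])
  fix g assume "g \<in> prod1_span"
  then show "\<exists>g'\<in>prod1_span. \<forall>x. (g has_real_derivative g' x) (at x)"
  proof induction
    case (prod1_base f g)
    show ?case
    proof (intro bexI allI)
      show "((\<lambda>x. f x * g x) has_real_derivative deriv f x * g x + f x * deriv g x) (at x)" for x
        using DERIV_mult[OF smooth1_DERIV smooth1_DERIV] prod1_base by (simp add: mult.commute)
      show "(\<lambda>x. deriv f x * g x + f x * deriv g x) \<in> prod1_span"
        using prod1_base by (intro prod1_span.prod1_add prod1_span.prod1_base smooth1_deriv)
    qed
  next
    case (prod1_add f g)
    then obtain f' g' where "f' \<in> prod1_span" "g' \<in> prod1_span"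
      "\<And>x. (f has_real_derivative f' x) (at x)" "\<And>x. (g has_real_derivative g' x) (at x)" by blast
    then show ?case
      by (intro bexI[of _ "\<lambda>x. f' x + g' x"] allI DERIV_add prod1_span.prod1_add)
  qed
qed

lemma smooth1_mult: "smooth1 f \<Longrightarrow> smooth1 g \<Longrightarrow> smooth1 (\<lambda>x. f x * g x)"
  by (rule smooth1_prod1_span[OF prod1_base])

lemma smooth1_const: "smooth1 (\<lambda>_. c)"
  by (rule smooth1_family[where C = "range (\<lambda>c _. c)"]) (auto intro!: exI[of _ 0])

lemma smooth1_add:
  assumes "smooth1 f" "smooth1 g" shows "smooth1 (\<lambda>x. f x + g x)"
proof -
  have "(\<lambda>x. f x * 1 + g x * 1) \<in> prod1_span"
    by (intro prod1_add prod1_base assms smooth1_const)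
  then show ?thesis by (simp add: smooth1_prod1_span)
qed

lemma smooth1_affine:
  assumes "smooth1 f" shows "smooth1 (\<lambda>x. f (c * x + t))"
proof (rule smooth1_family[where C = "{\<lambda>x. k * g (c * x + t) | k g. smooth1 g}"])
  show "(\<lambda>x. f (c * x + t)) \<in> {\<lambda>x. k * g (c * x + t) | k g. smooth1 g}"
    using assms by (intro CollectI exI[of _ 1] exI[of _ f]) auto
  fix h assume "h \<in> {\<lambda>x. k * g (c * x + t) | k g. smooth1 g}"
  then obtain k g where h: "h = (\<lambda>x. k * g (c * x + t))" "smooth1 g" by blast
  have "(h has_real_derivative (k * c) * deriv g (c * x + t)) (at x)" for x
  proof -
    have "((\<lambda>x. c * x + t) has_real_derivative c) (at x)"
      by (auto intro!: derivative_eq_intros)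
    from DERIV_cmult[OF DERIV_chain2[OF smooth1_DERIV[OF h(2)] this], of k]
    show ?thesis unfolding h(1) by (simp add: mult_ac)
  qed
  moreover have "(\<lambda>x. (k * c) * deriv g (c * x + t)) \<in> {\<lambda>x. k * g (c * x + t) | k g. smooth1 g}"
    using smooth1_deriv[OF h(2)] by blast
  ultimately show "\<exists>h'\<in>{\<lambda>x. k * g (c * x + t) | k g. smooth1 g}. \<forall>x. (h has_real_derivative h' x) (at x)"
    by (intro bexI[of _ "\<lambda>x. (k * c) * deriv g (c * x + t)"]) auto
qed

lemma higher_deriv_outside:
  fixes f :: "real \<Rightarrow> real"
  assumes "\<And>x. x \<notin> {a..b} \<Longrightarrow> f x = 0" "x \<notin> {a..b}"
  shows "(deriv ^^ k) f x = 0"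
  using assms(2)
proof (induction k arbitrary: x)
  case (Suc k)
  have "((deriv ^^ k) f has_real_derivative 0) (at x)"
    by (rule has_field_derivative_transform_within_open[of "\<lambda>_. 0" _ _ "- {a..b}"]) (use Suc in auto)
  then show ?case by (simp add: DERIV_imp_deriv)
qed (use assms in auto)

section \<open>Bump functions built from e^(-1/x)\<close>

definition flat :: "real poly \<Rightarrow> real \<Rightarrow> real" where
  "flat p x = (if x > 0 then poly p (1 / x) * exp (- (1 / x)) else 0)"

lemma tendsto_poly_exp: "((\<lambda>y. poly p y * exp (- y)) \<longlongrightarrow> (0::real)) at_top"
proof -
  have "((\<lambda>y. \<Sum>i\<le>degree p. coeff p i * (y ^ i / exp y)) \<longlongrightarrow> (\<Sum>i\<le>degree p. coeff p i * 0)) at_top"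
    by (intro tendsto_sum tendsto_mult tendsto_const tendsto_power_div_exp_0)
  then show ?thesis
    by (simp add: poly_altdef exp_minus divide_inverse sum_distrib_right mult.assoc)
qed

lemma flat_tendsto_0: "((\<lambda>x. flat p x / x) \<longlongrightarrow> 0) (at 0)"
proof -
  have "((\<lambda>x. poly (pCons 0 p) (inverse x) * exp (- inverse x)) \<longlongrightarrow> 0) (at_right (0::real))"
    by (rule filterlim_compose[OF tendsto_poly_exp filterlim_inverse_at_top_right])
  then have "((\<lambda>x. flat p x / x) \<longlongrightarrow> 0) (at_right 0)"
    by (rule Lim_transform_eventually)
       (auto simp: eventually_at_filter flat_def divide_inverse)
  moreover have "((\<lambda>x. flat p x / x) \<longlongrightarrow> 0) (at_left 0)"
    by (rule Lim_transform_eventually[OF tendsto_const])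
       (auto simp: eventually_at_filter flat_def)
  ultimately show ?thesis by (simp add: filterlim_split_at)
qed

text \<open>With y = 1/x one has dy/dx = -y^2, so p(y) e^(-y) has derivative y^2 (p - p')(y) e^(-y),
  which is again of the form \<open>flat\<close>. At 0 the difference quotient tends to 0 because
  the exponential beats every polynomial in 1/x.\<close>

lemma flat_DERIV: "(flat p has_real_derivative flat ([:0, 0, 1:] * (p - pderiv p)) x) (at x)"
proof -
  consider "x > 0" | "x < 0" | "x = 0" by linarith
  then show ?thesis
  proof cases
    case 1
    have "((\<lambda>x. poly p (1 / x) * exp (- (1 / x))) has_real_derivative
       flat ([:0, 0, 1:] * (p - pderiv p)) x) (at x)"
    proof -
      have inv: "((\<lambda>x. 1 / x) has_real_derivative - (1 / x\<^sup>2)) (at x)"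
        using 1 by (auto intro!: derivative_eq_intros simp: power2_eq_square)
      have "((\<lambda>x. exp (- (1 / x))) has_real_derivative exp (- (1 / x)) * (1 / x\<^sup>2)) (at x)"
        using DERIV_chain2[OF DERIV_exp DERIV_minus[OF inv]] by simp
      from DERIV_mult[OF DERIV_chain2[OF poly_DERIV[of p] inv] this]
      show ?thesis by (rule DERIV_cong) (use 1 in \<open>simp add: flat_def power2_eq_square algebra_simps\<close>)
    qed
    then show ?thesis
      by (rule has_field_derivative_transform_within_open[of _ _ _ "{0<..}"]) (use 1 in \<open>auto simp: flat_def\<close>)
  next
    case 2
    show ?thesis
      by (rule has_field_derivative_transform_within_open[of "\<lambda>_. 0" _ _ "{..<0}"]) (use 2 in \<open>auto simp: flat_def\<close>)
  next
    case 3
    then show ?thesis using flat_tendsto_0[of p]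
      by (simp add: has_field_derivative_iff flat_def)
  qed
qed

lemma smooth1_flat: "smooth1 (flat p)"
  by (rule smooth1_family[where C = "range flat"]) (use flat_DERIV in blast)+

text \<open>One copy of e^(-1/x) starts at a, a reflected one ends at b; the product is positive
  exactly where both are.\<close>

lemma ex_bump:
  assumes "a < b"
  shows "\<exists>f. smooth1 f \<and> (\<forall>x. f x \<ge> 0) \<and> (\<forall>x\<in>{a<..<b}. f x > 0) \<and> (\<forall>x. x \<notin> {a<..<b} \<longrightarrow> f x = 0)"
proof (intro exI conjI)
  let ?f = "\<lambda>x. flat 1 (1 * x + (- a)) * flat 1 ((- 1) * x + b)"
  show "smooth1 ?f" by (intro smooth1_mult smooth1_affine smooth1_flat)
qed (auto simp: flat_def)

subsection \<open>Constant-coefficient operators on the half-line\<close>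

abbreviation cpoly :: "real poly \<Rightarrow> complex poly" where
  "cpoly \<equiv> map_poly complex_of_real"

text \<open>Evaluates p at the shift operator on sequences and reads the result at position k. On a
  sequence of successive derivatives this is a constant-coefficient differential operator, and
  multiplication of polynomials becomes composition.\<close>

definition pact :: "complex poly \<Rightarrow> (nat \<Rightarrow> complex) \<Rightarrow> nat \<Rightarrow> complex" where
  "pact p x k = (\<Sum>j\<le>degree p. coeff p j * x (k + j))"

lemma pact_cutoff:
  assumes "degree p \<le> N"
  shows "pact p x k = (\<Sum>j\<le>N. coeff p j * x (k + j))"
  unfolding pact_def using assms
  by (intro sum.mono_neutral_left) (auto simp: coeff_eq_0)

lemma pact_0 [simp]: "pact 0 x k = 0"
  by (simp add: pact_def)

lemma pact_pCons: "pact (pCons c p) x k = c * x k + pact p x (Suc k)"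
proof -
  have "pact (pCons c p) x k = (\<Sum>j\<le>Suc (degree p). coeff (pCons c p) j * x (k + j))"
    by (rule pact_cutoff) (simp add: degree_pCons_eq_if)
  also have "\<dots> = c * x k + (\<Sum>j\<le>degree p. coeff p j * x (k + Suc j))"
    by (subst sum.atMost_Suc_shift) simp
  finally show ?thesis by (simp add: pact_def)
qed

lemma pact_1 [simp]: "pact 1 x k = x k"
  by (simp add: one_pCons pact_pCons)

lemma pact_add: "pact (p + q) x k = pact p x k + pact q x k"
proof -
  let ?N = "max (degree p) (degree q)"
  have "pact (p + q) x k = (\<Sum>j\<le>?N. coeff (p + q) j * x (k + j))"
    by (rule pact_cutoff) (rule degree_add_le_max)
  then show ?thesis
    by (simp add: pact_cutoff[of p ?N] pact_cutoff[of q ?N] ring_distribs sum.distrib)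
qed

lemma pact_smult: "pact (smult c p) x k = c * pact p x k"
  by (simp add: pact_cutoff[of "smult c p" "degree p"] pact_def sum_distrib_left mult.assoc degree_smult_le)

lemma pact_sum: "pact (\<Sum>i\<in>I. p i) x k = (\<Sum>i\<in>I. pact (p i) x k)"
  by (induction I rule: infinite_finite_induct) (auto simp: pact_add)

lemma pact_scale: "pact p (\<lambda>k. c * x k) k = c * pact p x k"
  by (simp add: pact_def sum_distrib_left mult_ac)

lemma pact_mult: "pact (p * q) x k = pact p (pact q x) k"
proof (induction p arbitrary: k)
  case (pCons a p)
  then show ?case
    by (simp add: pact_add pact_smult pact_pCons)
qed simp

text \<open>With \<open>D = -\<i> d/ds\<close>, the sequence is \<open>e k = D\<^sup>k (e 0)\<close>, so that \<open>pact p\<close> acts on it as \<open>p(D)\<close>.\<close>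
definition dseq :: "real \<Rightarrow> real \<Rightarrow> (nat \<Rightarrow> real \<Rightarrow> complex) \<Rightarrow> bool" where
  "dseq a b e \<longleftrightarrow> (\<forall>k s. (e k has_vector_derivative \<i> * e (Suc k) s) (at s)) \<and>
     (\<forall>k s. s \<notin> {a<..<b} \<longrightarrow> e k s = 0)"

lemma dseq_pact:
  assumes "dseq a b e"
  shows "dseq a b (\<lambda>k s. pact p (\<lambda>j. e j s) k)"
  unfolding dseq_def
proof (intro conjI allI impI)
  fix k s
  have D: "\<And>k s. (e k has_vector_derivative \<i> * e (Suc k) s) (at s)"
    using assms by (auto simp: dseq_def)
  have "((\<lambda>s. \<Sum>j\<le>degree p. coeff p j * e (k + j) s) has_vector_derivative
      (\<Sum>j\<le>degree p. coeff p j * (\<i> * e (Suc (k + j)) s))) (at s)"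
    by (intro has_vector_derivative_sum has_vector_derivative_mult_right D)
  then show "((\<lambda>s. pact p (\<lambda>j. e j s) k) has_vector_derivative
      \<i> * pact p (\<lambda>j. e j s) (Suc k)) (at s)"
    by (simp add: pact_def sum_distrib_left mult_ac)
next
  fix k s assume "s \<notin> {a<..<b}"
  then show "pact p (\<lambda>j. e j s) k = 0"
    using assms by (simp add: pact_def dseq_def)
qed

lemma dseq_continuous:
  assumes "dseq a b e"
  shows "continuous_on S (e k)"
  using assms unfolding dseq_def
  by (meson continuous_on_eq_continuous_within continuous_at_imp_continuous_at_within
      has_vector_derivative_continuous)

lemma integral_derivative_vanishing:
  fixes F :: "real \<Rightarrow> 'a::banach"
  assumes "a \<le> b" and D: "\<And>s. s \<in> {a..b} \<Longrightarrow> (F has_vector_derivative F' s) (at s)"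
    and "F a = 0" "F b = 0"
  shows "(F' has_integral 0) {a..b}"
  using fundamental_theorem_of_calculus[of a b F F'] assms
  by (auto intro: has_vector_derivative_at_within)

text \<open>Integration by parts: D is symmetric on functions that vanish at both ends, so D - z and
  D - cnj z are adjoint to each other. The antiderivative used is -\<i> g cnj h.\<close>

lemma dseq_adjoint:
  assumes "dseq a b g" "dseq a b h" "a \<le> b"
  shows "integral {a..b} (\<lambda>s. pact [:- cnj z, 1:] (\<lambda>j. g j s) 0 * cnj (h 0 s)) =
         integral {a..b} (\<lambda>s. g 0 s * cnj (pact [:- z, 1:] (\<lambda>j. h j s) 0))"
proof -
  note [continuous_intros] = dseq_continuous[OF assms(1)] dseq_continuous[OF assms(2)]
  have Dg: "\<And>k s. (g k has_vector_derivative \<i> * g (Suc k) s) (at s)"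
    and Dh: "\<And>k s. (h k has_vector_derivative \<i> * h (Suc k) s) (at s)"
    using assms by (auto simp: dseq_def)
  have z: "g 0 a = 0" "g 0 b = 0" using assms by (auto simp: dseq_def)
  have cD: "((\<lambda>s. cnj (h 0 s)) has_vector_derivative - \<i> * cnj (h 1 s)) (at s)" for s
    using has_vector_derivative_cnj[OF Dh[of 0 s]] by simp
  have P: "((\<lambda>s. -\<i> * (g 0 s * cnj (h 0 s))) has_vector_derivative
      (g 1 s * cnj (h 0 s) - g 0 s * cnj (h 1 s))) (at s)" for s
    by (rule has_vector_derivative_eq_rhs[OF has_vector_derivative_mult_right[OF
          has_vector_derivative_mult[OF Dg[of 0 s] cD[of s]]]])
       (simp add: algebra_simps)
  have "((\<lambda>s. g 1 s * cnj (h 0 s) - g 0 s * cnj (h 1 s)) has_integral 0) {a..b}"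
    by (rule integral_derivative_vanishing[OF \<open>a \<le> b\<close> P]) (auto simp: z)
  moreover have "(\<lambda>s. pact [:- cnj z, 1:] (\<lambda>j. g j s) 0 * cnj (h 0 s)
        - g 0 s * cnj (pact [:- z, 1:] (\<lambda>j. h j s) 0)) =
      (\<lambda>s. g 1 s * cnj (h 0 s) - g 0 s * cnj (h 1 s))"
    by (auto simp: pact_pCons algebra_simps fun_eq_iff)
  ultimately have "integral {a..b} (\<lambda>s. pact [:- cnj z, 1:] (\<lambda>j. g j s) 0 * cnj (h 0 s)
        - g 0 s * cnj (pact [:- z, 1:] (\<lambda>j. h j s) 0)) = 0"
    by (simp add: integral_unique)
  then show ?thesis
    by (subst (asm) integral_diff)
       (auto simp: pact_pCons intro!: integrable_continuous_real continuous_intros)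
qed

definition rpoly :: "complex list \<Rightarrow> complex poly" where
  "rpoly zs = prod_list (map (\<lambda>z. [:- z, 1:]) zs)"

lemma rpoly_simps [simp]: "rpoly [] = 1" "rpoly (z # zs) = [:- z, 1:] * rpoly zs"
  by (auto simp: rpoly_def)

text \<open>One factor at a time is moved across the pairing; by \<open>dseq_pact\<close> the
  function it lands on still vanishes at the ends together with its derivatives.\<close>

lemma dseq_adjoint_rpoly:
  assumes "dseq a b g" "dseq a b h" "a \<le> b"
  shows "integral {a..b} (\<lambda>s. pact (rpoly (map cnj zs)) (\<lambda>j. g j s) 0 * cnj (h 0 s)) =
         integral {a..b} (\<lambda>s. g 0 s * cnj (pact (rpoly zs) (\<lambda>j. h j s) 0))"
  using assms(2)
proof (induction zs arbitrary: h)
  case (Cons z zs)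
  have "integral {a..b} (\<lambda>s. pact (rpoly (map cnj (z # zs))) (\<lambda>j. g j s) 0 * cnj (h 0 s)) =
     integral {a..b} (\<lambda>s. pact [:- cnj z, 1:] (\<lambda>k. pact (rpoly (map cnj zs)) (\<lambda>j. g j s) k) 0 * cnj (h 0 s))"
    by (simp only: list.map rpoly_simps pact_mult)
  also have "\<dots> = integral {a..b} (\<lambda>s. pact (rpoly (map cnj zs)) (\<lambda>j. g j s) 0
       * cnj (pact [:- z, 1:] (\<lambda>j. h j s) 0))"
    by (rule dseq_adjoint[OF dseq_pact[OF assms(1)] Cons.prems assms(3)])
  also have "\<dots> = integral {a..b} (\<lambda>s. g 0 s *
        cnj (pact (rpoly zs) (\<lambda>j. pact [:- z, 1:] (\<lambda>j. h j s) j) 0))"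
    by (rule Cons.IH[OF dseq_pact[OF Cons.prems]])
  also have "\<dots> = integral {a..b} (\<lambda>s. g 0 s * cnj (pact (rpoly (z # zs)) (\<lambda>j. h j s) 0))"
    by (simp only: pact_mult[symmetric] rpoly_simps mult.commute)
  finally show ?case .
qed simp

text \<open>Expanding \<open>\<bar>w' - \<i> z w - (\<kappa>/s) w\<bar>\<^sup>2 \<ge> 0\<close> shows that the integrand on the left exceeds that on
  the right by at least the derivative of \<open>\<kappa> s\<^sup>-\<^sup>2\<^sup>k\<^sup>-\<^sup>1 \<bar>w\<bar>\<^sup>2\<close>, where \<open>\<kappa> = (2k+1)/2\<close>; the condition on
  the sign of \<open>Im z\<close> makes the remaining term nonnegative.\<close>
lemma weighted_hardy:
  assumes "dseq a b w" "0 < a" "a \<le> b" "Im z \<ge> 0"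
  shows "integral {a..b} (\<lambda>s. (cmod (pact [:- z, 1:] (\<lambda>j. w j s) 0))\<^sup>2 / s ^ (2 * k)) \<ge>
    ((2 * real k + 1) / 2)\<^sup>2 * integral {a..b} (\<lambda>s. (cmod (w 0 s))\<^sup>2 / s ^ (2 * Suc k))"
proof -
  note [continuous_intros] = dseq_continuous[OF assms(1)]
  define \<kappa> where "\<kappa> = (2 * real k + 1) / 2"
  define x y where "x = (\<lambda>s. Re (w 0 s))" and "y = (\<lambda>s. Im (w 0 s))"
  \<comment> \<open>From w' = \<i> w_1: the real part of \<i> w_1 is -Im w_1, the imaginary part is
    Re w_1.\<close>
  define x' y' where "x' = (\<lambda>s. - Im (w 1 s))" and "y' = (\<lambda>s. Re (w 1 s))"
  have "(w 0 has_vector_derivative \<i> * w 1 s) (at s)" for s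
    using assms(1) by (auto simp: dseq_def)
  then have D[derivative_intros]: "(x has_real_derivative x' s) (at s)" "(y has_real_derivative y' s) (at s)" for s
    using bounded_linear.has_vector_derivative[OF bounded_linear_Re, of "w 0" "\<i> * w 1 s" "at s" for s]
      bounded_linear.has_vector_derivative[OF bounded_linear_Im, of "w 0" "\<i> * w 1 s" "at s" for s]
    by (auto simp: x_def y_def x'_def y'_def has_real_derivative_iff_has_vector_derivative)
  have z: "x a = 0" "x b = 0" "y a = 0" "y b = 0" using assms by (auto simp: dseq_def x_def y_def)
  define F where "F = (\<lambda>s. \<kappa> * ((x s)\<^sup>2 + (y s)\<^sup>2) / s ^ (2 * k + 1))"
  define F' where "F' = (\<lambda>s. 2 * \<kappa> * (x s * x' s + y s * y' s) / s ^ (2 * k + 1)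
      - 2 * \<kappa>\<^sup>2 * ((x s)\<^sup>2 + (y s)\<^sup>2) / s ^ (2 * k + 2))"
  have "(F has_real_derivative F' s) (at s)" if "s > 0" for s
  proof -
    define q A B where "q = s ^ (2 * k)" and "A = x s * x' s + y s * y' s" and "B = (x s)\<^sup>2 + (y s)\<^sup>2"
    have q: "q \<noteq> 0" and pw: "s ^ (2 * k + 1) = s * q" "s ^ (2 * k + 2) = s * s * q"
      using that by (auto simp: q_def)
    have \<kappa>: "2 * real k + 1 = 2 * \<kappa>" by (simp add: \<kappa>_def)
    have 1: "((\<lambda>s. \<kappa> * ((x s)\<^sup>2 + (y s)\<^sup>2)) has_real_derivative 2 * \<kappa> * A) (at s)"
      by (rule derivative_eq_intros refl)+ (simp add: A_def algebra_simps)
    have 2: "((\<lambda>s. s ^ (2 * k + 1)) has_real_derivative 2 * \<kappa> * q) (at s)"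
      using DERIV_pow[of "2 * k + 1" s UNIV] \<kappa> by (simp add: q_def add.commute del: power_Suc)
    have "(F has_real_derivative
        (2 * \<kappa> * A * s ^ (2 * k + 1) - \<kappa> * B * (2 * \<kappa> * q)) / (s ^ (2 * k + 1) * s ^ (2 * k + 1))) (at s)"
      unfolding F_def B_def using that by (intro DERIV_divide 1 2) simp
    also have "(2 * \<kappa> * A * s ^ (2 * k + 1) - \<kappa> * B * (2 * \<kappa> * q)) / (s ^ (2 * k + 1) * s ^ (2 * k + 1)) = F' s"
      unfolding F'_def A_def[symmetric] B_def[symmetric] pw using q that
      by (simp add: field_simps power2_eq_square)
    finally show ?thesis .
  qed
  then have F: "(F' has_integral 0) {a..b}"
    by (intro integral_derivative_vanishing[where F = F])
       (use assms in \<open>auto simp: F_def z has_real_derivative_iff_has_vector_derivative\<close>)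
  have 1: "(\<lambda>s. (cmod (pact [:- z, 1:] (\<lambda>j. w j s) 0))\<^sup>2 / s ^ (2 * k)) integrable_on {a..b}"
    using assms by (auto simp: pact_pCons intro!: integrable_continuous_real continuous_intros)
  have 2: "(\<lambda>s. (cmod (w 0 s))\<^sup>2 / s ^ (2 * Suc k)) integrable_on {a..b}"
    using assms by (auto intro!: integrable_continuous_real continuous_intros)
  have "\<kappa>\<^sup>2 * integral {a..b} (\<lambda>s. (cmod (w 0 s))\<^sup>2 / s ^ (2 * Suc k))
      = integral {a..b} (\<lambda>s. \<kappa>\<^sup>2 * ((cmod (w 0 s))\<^sup>2 / s ^ (2 * Suc k)) + F' s)"
    using integral_unique[OF F] integral_add[OF integrable_on_cmult_left[OF 2] has_integral_integrable[OF F], of "\<kappa>\<^sup>2"]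
    by (simp only: integral_mult_right add_0_right id_apply of_real_eq_id)
  also have "\<dots> \<le> integral {a..b} (\<lambda>s. (cmod (pact [:- z, 1:] (\<lambda>j. w j s) 0))\<^sup>2 / s ^ (2 * k))"
  proof (rule integral_le[OF _ 1])
    show "(\<lambda>s. \<kappa>\<^sup>2 * ((cmod (w 0 s))\<^sup>2 / s ^ (2 * Suc k)) + F' s) integrable_on {a..b}"
      using integrable_add[OF integrable_on_cmult_left[OF 2] has_integral_integrable[OF F], of "\<kappa>\<^sup>2"]
      by (simp only: id_apply of_real_eq_id)
    fix s assume "s \<in> {a..b}"
    then have s: "s > 0" using assms by auto
    define p q where "p = Re z" and "q = Im z"
    define c where "c = \<kappa> / s"
    have q: "q \<ge> 0" "c \<ge> 0" using assms s by (auto simp: q_def \<kappa>_def c_def)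
    let ?A = "x' s + q * x s + p * y s" and ?B = "y' s + q * y s - p * x s"
    have "(cmod (pact [:- z, 1:] (\<lambda>j. w j s) 0))\<^sup>2 = ?A\<^sup>2 + ?B\<^sup>2"
    proof -
      have "Re (pact [:- z, 1:] (\<lambda>j. w j s) 0) = ?B" "Im (pact [:- z, 1:] (\<lambda>j. w j s) 0) = - (?A)"
        by (auto simp: pact_pCons x_def y_def x'_def y'_def p_def q_def)
      then show ?thesis unfolding cmod_power2 by (simp only: power2_minus add.commute)
    qed
    moreover have "?A\<^sup>2 + ?B\<^sup>2 \<ge> 2 * c * (x s * x' s + y s * y' s) - c\<^sup>2 * ((x s)\<^sup>2 + (y s)\<^sup>2)"
    proof -
      \<comment> \<open>The contributions of p cancel in \<open>?A * x s + ?B * y s\<close>, and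
        those of q cancel against the last summand.\<close>
      have "(?A - c * x s)\<^sup>2 + (?B - c * y s)\<^sup>2 + 2 * c * q * ((x s)\<^sup>2 + (y s)\<^sup>2) \<ge> 0"
        using q by simp
      then show ?thesis by (simp add: power2_eq_square algebra_simps)
    qed
    ultimately have *: "(2 * c * (x s * x' s + y s * y' s) - c\<^sup>2 * ((x s)\<^sup>2 + (y s)\<^sup>2)) / s ^ (2 * k) \<le>
       (cmod (pact [:- z, 1:] (\<lambda>j. w j s) 0))\<^sup>2 / s ^ (2 * k)"
      using s by (intro divide_right_mono) auto
    have "\<kappa>\<^sup>2 * ((cmod (w 0 s))\<^sup>2 / s ^ (2 * Suc k)) + F' s =
       (2 * c * (x s * x' s + y s * y' s) - c\<^sup>2 * ((x s)\<^sup>2 + (y s)\<^sup>2)) / s ^ (2 * k)"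
    proof -
      define Q A B where "Q = s ^ (2 * k)" and "A = x s * x' s + y s * y' s" and "B = (x s)\<^sup>2 + (y s)\<^sup>2"
      have Q: "Q \<noteq> 0" and pw: "s ^ (2 * k + 1) = s * Q" "s ^ (2 * k + 2) = s * s * Q" "s ^ (2 * Suc k) = s * s * Q"
        using s by (auto simp: Q_def)
      have cB: "(cmod (w 0 s))\<^sup>2 = B" by (simp add: cmod_power2 x_def y_def B_def)
      show ?thesis
        unfolding F'_def c_def cB pw A_def[symmetric] B_def[symmetric] Q_def[symmetric] using s Q
        by (simp add: field_simps power2_eq_square)
    qed
    with * show "\<kappa>\<^sup>2 * ((cmod (w 0 s))\<^sup>2 / s ^ (2 * Suc k)) + F' s \<le>
       (cmod (pact [:- z, 1:] (\<lambda>j. w j s) 0))\<^sup>2 / s ^ (2 * k)" by simp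
  qed
  finally show ?thesis by (simp add: \<kappa>_def)
qed

text \<open>\<open>weighted_hardy\<close> is applied to the outermost factor. It trades the weight
  s^(-2k) for s^(-2(k+1)) and leaves a shorter list, so the induction has to run over all k although
  k = 0 is the case of interest.\<close>

lemma hardy_rellich_chain:
  assumes "dseq a b e" "0 < a" "a \<le> b" "\<forall>z\<in>set zs. Im z \<ge> 0"
  shows "integral {a..b} (\<lambda>s. (cmod (pact (rpoly zs) (\<lambda>j. e j s) 0))\<^sup>2 / s ^ (2 * k)) \<ge>
    (\<Prod>j<length zs. ((2 * real (k + j) + 1) / 2)\<^sup>2) *
      integral {a..b} (\<lambda>s. (cmod (e 0 s))\<^sup>2 / s ^ (2 * (k + length zs)))"
  using assms(4)
proof (induction zs arbitrary: k)
  case (Cons z zs)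
  have "(\<Prod>j<length (z # zs). ((2 * real (k + j) + 1) / 2)\<^sup>2) *
      integral {a..b} (\<lambda>s. (cmod (e 0 s))\<^sup>2 / s ^ (2 * (k + length (z # zs)))) =
     ((2 * real k + 1) / 2)\<^sup>2 * ((\<Prod>j<length zs. ((2 * real (Suc k + j) + 1) / 2)\<^sup>2) *
      integral {a..b} (\<lambda>s. (cmod (e 0 s))\<^sup>2 / s ^ (2 * (Suc k + length zs))))"
    by (simp del: power_Suc prod.lessThan_Suc add: prod.lessThan_Suc_shift)
  also have "\<dots> \<le> ((2 * real k + 1) / 2)\<^sup>2 *
     integral {a..b} (\<lambda>s. (cmod (pact (rpoly zs) (\<lambda>j. e j s) 0))\<^sup>2 / s ^ (2 * Suc k))"
    using Cons by (intro mult_left_mono Cons.IH) auto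
  also have "\<dots> \<le> integral {a..b}
     (\<lambda>s. (cmod (pact [:- z, 1:] (\<lambda>k. pact (rpoly zs) (\<lambda>j. e j s) k) 0))\<^sup>2 / s ^ (2 * k))"
    by (rule weighted_hardy[OF dseq_pact[OF assms(1)] assms(2,3)]) (use Cons.prems in auto)
  finally show ?case by (simp only: rpoly_simps pact_mult)
qed simp

lemma A_const_eq: "A_const m = (\<Prod>j<m. ((2 * real j + 1) / 2)\<^sup>2)"
  by (induction m) (auto simp: A_const_def power2_eq_square field_simps)

section \<open>Nonnegative real polynomials as squared moduli\<close>

lemma cpoly_add: "cpoly (p + q) = cpoly p + cpoly q"
  by (intro poly_eqI) (simp add: coeff_map_poly)

lemma cpoly_mult: "cpoly (p * q) = cpoly p * cpoly q"
  by (intro poly_eqI) (simp add: coeff_map_poly coeff_mult)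

lemma poly_cpoly: "poly (cpoly p) (of_real t) = of_real (poly p t)"
  by (induction p) (auto simp: map_poly_pCons)

lemma poly_rpoly_cnj: "poly (rpoly (map cnj zs)) (of_real t) = cnj (poly (rpoly zs) (of_real t))"
  by (induction zs) auto

lemma cmod_mult_self: "cmod z * cmod z = Re z * Re z + Im z * Im z"
  using cmod_power2[of z] by (simp add: power2_eq_square)

text \<open>Non-real roots occur in conjugate pairs, and real roots have even multiplicity because P
  does not change sign. Each induction step divides out t^2 - 2 (Re z) t + |z|^2 and keeps the root
  of the pair with Im z \<ge> 0.\<close>

lemma nonneg_real_poly_factor:
  fixes P :: "real poly"
  assumes "degree P = 2 * m" "\<And>t. poly P t \<ge> 0" "P \<noteq> 0"
  shows "\<exists>zs. length zs = m \<and> (\<forall>z\<in>set zs. Im z \<ge> 0) \<and>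
     map_poly of_real P = smult (of_real (lead_coeff P)) (rpoly zs * rpoly (map cnj zs))"
  using assms
proof (induction m arbitrary: P)
  case 0
  then obtain c where "P = [:c:]" by (metis degree_eq_zeroE mult_0_right)
  then show ?case by (intro exI[of _ "[]"]) (simp add: map_poly_pCons)
next
  case (Suc m)
  have "\<exists>z Q. Im z \<ge> 0 \<and> P = [:(cmod z)\<^sup>2, - 2 * Re z, 1:] * Q"
  proof -
    have "degree (cpoly P) = degree P"
      by (simp add: degree_map_poly)
    then have "\<not> constant (poly (cpoly P))"
      using Suc.prems by (simp add: constant_degree)
    then obtain z0 where z0: "poly (cpoly P) z0 = 0"
      using fundamental_theorem_of_algebra by blast
    \<comment> \<open>The coefficients are real, so the conjugate of a root is a root and one in the
      closed upper half-plane can be chosen.\<close>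
    define z where "z = (if Im z0 \<ge> 0 then z0 else cnj z0)"
    have "poly (cpoly P) (cnj z0) = cnj (poly (cpoly P) z0)"
      by (induction P) (auto simp: map_poly_pCons)
    with z0 have z: "poly (cpoly P) z = 0" and Im: "Im z \<ge> 0"
      by (auto simp: z_def)
    show ?thesis
    proof (cases "Im z = 0")
      case True
      then have zr: "z = of_real (Re z)" by (simp add: complex_eq_iff)
      have "poly P (Re z) = 0" using z by (subst (asm) zr) (simp only: poly_cpoly of_real_eq_0_iff)
      then obtain Q where Q: "P = [:- Re z, 1:] * Q" by (auto simp: poly_eq_0_iff_dvd)
      \<comment> \<open>A real root is at least double: (t - Re z) Q(t) \<ge> 0 makes Q nonnegative
        to the right of it and nonpositive to the left, and continuity forces Q(Re z) = 0.\<close>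
      have "poly Q (Re z) = 0"
      proof -
        have pos: "(t - Re z) * poly Q t \<ge> 0" for t
          using Suc.prems(2)[of t] unfolding Q poly_mult by simp
        have ev1: "eventually (\<lambda>t. poly Q t \<ge> 0) (at_right (Re z))"
          unfolding eventually_at_filter
          using pos by (intro always_eventually) (smt (verit) mult_pos_neg mult_neg_pos greaterThan_iff lessThan_iff)
        have ev2: "eventually (\<lambda>t. poly Q t \<le> 0) (at_left (Re z))"
          unfolding eventually_at_filter
          using pos by (intro always_eventually) (smt (verit) mult_pos_neg mult_neg_pos greaterThan_iff lessThan_iff)
        have "isCont (poly Q) (Re z)" by simp
        then have l: "(poly Q \<longlongrightarrow> poly Q (Re z)) (at (Re z))" by (simp add: isCont_def)
        have "poly Q (Re z) \<ge> 0"
          using tendsto_lowerbound[OF filterlim_mono[OF l order_refl] ev1] by (simp add: at_within_le_at)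
        moreover have "poly Q (Re z) \<le> 0"
          using tendsto_upperbound[OF filterlim_mono[OF l order_refl] ev2] by (simp add: at_within_le_at)
        ultimately show ?thesis by simp
      qed
      then obtain R where R: "Q = [:- Re z, 1:] * R" by (auto simp: poly_eq_0_iff_dvd)
      have "(cmod z)\<^sup>2 = Re z * Re z" using True unfolding cmod_power2 by (simp add: power2_eq_square)
      then have "P = [:(cmod z)\<^sup>2, - 2 * Re z, 1:] * R" unfolding Q R
        by (simp add: mult.assoc[symmetric] del: mult_pCons_left)
      then show ?thesis using Im by blast
    next
      case False
      define D where "D = [:(cmod z)\<^sup>2, - 2 * Re z, 1:]"
      \<comment> \<open>The remainder modulo the real quadratic D has real coefficients, degree at
        most one and the non-real root z; hence it is zero.\<close>
      define R where "R = P mod D"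
      have D0: "D \<noteq> 0" "degree D = 2" by (auto simp: D_def)
      have "R = 0 \<or> degree R < 2" using degree_mod_less[of D P] D0 by (auto simp: R_def)
      then have "degree R < 2" by auto
      then have R: "R = [:coeff R 0, coeff R 1:]"
        by (intro poly_eqI) (auto simp: coeff_pCons coeff_eq_0 split: nat.splits)
      have PD: "P = D * (P div D) + R" by (simp add: R_def)
      have "poly (cpoly D) z = 0"
        by (simp add: D_def map_poly_pCons complex_eq_iff cmod_mult_self power2_eq_square algebra_simps)
      moreover have "cpoly P = cpoly D * map_poly of_real (P div D)
          + map_poly of_real R"
        by (subst PD) (simp only: cpoly_add cpoly_mult)
      ultimately have "poly (cpoly R) z = 0" using z by simp
      then have "complex_of_real (coeff R 0) + z * of_real (coeff R 1) = 0"
        by (subst (asm) R) (simp add: map_poly_pCons)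
      then have "coeff R 1 = 0 \<and> coeff R 0 = 0" using False by (auto simp: complex_eq_iff)
      then have "R = 0" using R by simp
      then have "P = D * (P div D)" using PD by simp
      then show ?thesis using Im unfolding D_def by blast
    qed
  qed
  then obtain z Q where z: "Im z \<ge> 0" and PQ: "P = [:(cmod z)\<^sup>2, - 2 * Re z, 1:] * Q" by blast
  have Q0: "Q \<noteq> 0" using Suc.prems PQ by auto
  have lc: "lead_coeff P = lead_coeff Q" unfolding PQ by (subst lead_coeff_mult) simp
  have "degree Q = 2 * m" using Suc.prems(1) Q0 unfolding PQ
    by (subst (asm) degree_mult_eq) auto
  moreover have "poly Q t \<ge> 0" for t
  proof -
    \<comment> \<open>Where the quadratic is positive, Q has the sign of P; at Re z, where it may
      vanish, nonnegativity is recovered by continuity.\<close>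
    have ev: "\<forall>t. t \<noteq> Re z \<longrightarrow> poly Q t \<ge> 0"
    proof (intro allI impI)
      fix t assume "t \<noteq> Re z"
      have "poly P t = ((t - Re z)\<^sup>2 + (Im z)\<^sup>2) * poly Q t"
        unfolding PQ by (simp add: cmod_mult_self power2_eq_square algebra_simps)
      moreover have "(t - Re z)\<^sup>2 + (Im z)\<^sup>2 > 0" using \<open>t \<noteq> Re z\<close> by (simp add: sum_power2_gt_zero_iff)
      ultimately show "poly Q t \<ge> 0" using Suc.prems(2)[of t] by (simp add: zero_le_mult_iff)
    qed
    have "isCont (poly Q) (Re z)" by simp
    then have l: "(poly Q \<longlongrightarrow> poly Q (Re z)) (at (Re z))" by (simp add: isCont_def)
    have "poly Q (Re z) \<ge> 0"
      by (rule tendsto_lowerbound[OF l]) (use ev in \<open>auto simp: eventually_at_filter\<close>)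
    with ev show ?thesis by (cases "t = Re z") auto
  qed
  ultimately obtain zs where zs: "length zs = m" "\<forall>z\<in>set zs. Im z \<ge> 0"
     "map_poly of_real Q = smult (of_real (lead_coeff Q)) (rpoly zs * rpoly (map cnj zs))"
    using Suc.IH Q0 by blast
  have "cpoly P = [:of_real ((cmod z)\<^sup>2), of_real (- 2 * Re z), 1:] * map_poly of_real Q"
    unfolding PQ by (simp only: cpoly_mult) (simp add: map_poly_pCons)
  also have "[:of_real ((cmod z)\<^sup>2), of_real (- 2 * Re z), 1:] = [:- z, 1:] * [:- cnj z, 1:]"
    by (simp add: complex_eq_iff cmod_mult_self power2_eq_square)
  finally have "cpoly P =
     smult (of_real (lead_coeff P)) (rpoly (z # zs) * rpoly (map cnj (z # zs)))"
    unfolding zs lc by (simp only: rpoly_simps list.map mult_smult_right mult_ac)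
  then show ?case using zs(1,2) z by (intro exI[of _ "z # zs"]) auto
qed

text \<open>With q = \<open>rpoly zs\<close>, P(D) is the leading coefficient times q(D) followed by
  its adjoint. The quadratic form is therefore that coefficient times the squared norm of q(D)e,
  which \<open>hardy_rellich_chain\<close> bounds from below.\<close>

lemma hardy_rellich_operator:
  fixes P :: "real poly"
  assumes "dseq a b e" "0 < a" "a \<le> b" "degree P = 2 * m" "\<And>t. poly P t \<ge> 0" "P \<noteq> 0"
  shows "Re (integral {a..b} (\<lambda>s. pact (map_poly of_real P) (\<lambda>j. e j s) 0 * cnj (e 0 s))) \<ge>
    lead_coeff P * A_const m * integral {a..b} (\<lambda>s. (cmod (e 0 s))\<^sup>2 / s ^ (2 * m))"
proof -
  obtain zs where zs: "length zs = m" "\<forall>z\<in>set zs. Im z \<ge> 0"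
     "map_poly of_real P = smult (of_real (lead_coeff P)) (rpoly zs * rpoly (map cnj zs))"
    using nonneg_real_poly_factor[OF assms(4-6)] by blast
  \<comment> \<open>On the real axis P equals its leading coefficient times |q|^2; a negative
    coefficient together with P \<ge> 0 would make P vanish identically.\<close>
  have lc: "lead_coeff P \<ge> 0"
  proof (rule ccontr)
    assume *: "\<not> lead_coeff P \<ge> 0"
    have "poly P t = 0" for t
    proof -
      have "complex_of_real (poly P t) = of_real (lead_coeff P * (cmod (poly (rpoly zs) (of_real t)))\<^sup>2)"
        by (simp add: poly_cpoly[symmetric] zs(3) poly_rpoly_cnj complex_norm_square[symmetric])
      then have "poly P t = lead_coeff P * (cmod (poly (rpoly zs) (of_real t)))\<^sup>2"
        by (simp only: of_real_eq_iff)
      moreover have "\<dots> \<le> 0" using * by (simp add: mult_nonpos_nonneg)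
      ultimately show ?thesis using assms(5)[of t] by simp
    qed
    then show False using assms(6) by (simp add: poly_all_0_iff_0[symmetric])
  qed
  let ?w = "\<lambda>k s. pact (rpoly zs) (\<lambda>j. e j s) k"
  have "integral {a..b} (\<lambda>s. pact (map_poly of_real P) (\<lambda>j. e j s) 0 * cnj (e 0 s)) =
     of_real (lead_coeff P) * integral {a..b} (\<lambda>s. pact (rpoly (map cnj zs)) (\<lambda>j. ?w j s) 0 * cnj (e 0 s))"
    unfolding zs(3) mult.commute[of "rpoly zs"]
    by (simp only: pact_smult pact_mult mult.assoc integral_mult_right)
  also have "\<dots> = of_real (lead_coeff P) * integral {a..b} (\<lambda>s. ?w 0 s * cnj (?w 0 s))"
    by (subst dseq_adjoint_rpoly[OF dseq_pact[OF assms(1)] assms(1,3)]) simp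
  also have "\<dots> = of_real (lead_coeff P) * integral {a..b} (\<lambda>s. of_real ((cmod (?w 0 s))\<^sup>2))"
    by (simp only: complex_norm_square)
  also have "\<dots> = of_real (lead_coeff P * integral {a..b} (\<lambda>s. (cmod (?w 0 s))\<^sup>2))"
  proof -
    have "(\<lambda>s. (cmod (?w 0 s))\<^sup>2) integrable_on {a..b}"
      by (intro integrable_continuous_real continuous_intros dseq_continuous[OF dseq_pact[OF assms(1)]])
    from integral_linear[OF this bounded_linear_of_real[where 'a = complex]] show ?thesis by (simp add: o_def)
  qed
  finally have "Re (integral {a..b} (\<lambda>s. pact (map_poly of_real P) (\<lambda>j. e j s) 0 * cnj (e 0 s))) =
      lead_coeff P * integral {a..b} (\<lambda>s. (cmod (?w 0 s))\<^sup>2)"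
    by simp
  moreover have "A_const m * integral {a..b} (\<lambda>s. (cmod (e 0 s))\<^sup>2 / s ^ (2 * m)) \<le>
       integral {a..b} (\<lambda>s. (cmod (?w 0 s))\<^sup>2)"
    using hardy_rellich_chain[OF assms(1-3) zs(2), of 0] by (simp add: zs(1) A_const_eq)
  ultimately show ?thesis using lc by (simp add: mult_left_mono mult.assoc)
qed

subsection \<open>Gaussian averages\<close>

lemma integrable_gauss_1: "integrable lborel (\<lambda>x::real. exp (- x\<^sup>2 / 2))"
proof -
  have "integrable lborel (\<lambda>x. sqrt (2 * pi) * std_normal_density x)"
    by (intro integrable_mult_right integrable_normal_density) simp
  then show ?thesis by (simp add: std_normal_density_def)
qed

text \<open>The characteristic function of the standard normal law, freed from the normalising
  constant of its density.\<close>

lemma gauss_fourier_1: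
  "(LBINT x. complex_of_real (exp (- x\<^sup>2 / 2)) * iexp (t * x)) = of_real (sqrt (2 * pi) * exp (- t\<^sup>2 / 2))"
proof -
  have "char std_normal_distribution t = (LBINT x. std_normal_density x *\<^sub>R iexp (t * x))"
    unfolding char_def by (subst integral_density) auto
  also have "\<dots> = (LBINT x. of_real (1 / sqrt (2 * pi)) * (complex_of_real (exp (- x\<^sup>2 / 2)) * iexp (t * x)))"
    by (intro Bochner_Integration.integral_cong) (auto simp: std_normal_density_def scaleR_conv_of_real)
  also have "\<dots> = of_real (1 / sqrt (2 * pi)) * (LBINT x. complex_of_real (exp (- x\<^sup>2 / 2)) * iexp (t * x))"
    by (rule integral_mult_right_zero)
  finally show ?thesis
    unfolding char_std_normal_distribution by (simp add: field_simps)
qed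

definition gauss :: "'a::euclidean_space \<Rightarrow> real" where
  "gauss x = exp (- (norm x)\<^sup>2 / 2)"

lemma gauss_prod: "gauss (x::'a::euclidean_space) = (\<Prod>b\<in>Basis. exp (- (x \<bullet> b)\<^sup>2 / 2))"
proof -
  have "(norm x)\<^sup>2 = (\<Sum>b\<in>Basis. (x \<bullet> b)\<^sup>2)"
    unfolding power2_norm_eq_inner by (subst euclidean_inner) (simp add: power2_eq_square)
  then show ?thesis
    by (simp add: gauss_def exp_sum[symmetric] sum_divide_distrib[symmetric] sum_negf)
qed

lemma continuous_gauss [continuous_intros]:
  "continuous_on S f \<Longrightarrow> continuous_on S (\<lambda>x. gauss (f x))"
  unfolding gauss_def by (intro continuous_intros) auto

lemma borel_measurable_gauss [measurable]: "gauss \<in> borel_measurable borel"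
  by (intro borel_measurable_continuous_onI continuous_intros)

text \<open>Lebesgue measure on a Euclidean space is the image of the product of one-dimensional
  Lebesgue measures, so a product of functions of the coordinates integrates factor by factor. This
  lifts the Gaussian formulas from the line.\<close>

lemma
  fixes f :: "'a::euclidean_space \<Rightarrow> real \<Rightarrow> complex"
  assumes "\<And>b. b \<in> Basis \<Longrightarrow> integrable lborel (f b)"
  shows integrable_lborel_prod: "integrable lborel (\<lambda>x::'a. \<Prod>b\<in>Basis. f b (x \<bullet> b))"
    and integral_lborel_prod: "(LBINT x::'a. \<Prod>b\<in>Basis. f b (x \<bullet> b)) = (\<Prod>b\<in>Basis. LBINT t. f b t)"
proof -
  interpret product_sigma_finite "\<lambda>_::'a. lborel :: real measure" ..
  have [measurable]: "\<And>b. b \<in> Basis \<Longrightarrow> f b \<in> borel_measurable borel"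
    using assms by (auto dest: borel_measurable_integrable)
  have *: "(\<Sum>c\<in>Basis. x c *\<^sub>R c) \<bullet> b = x b" if "b \<in> Basis" for x :: "'a \<Rightarrow> real" and b
    using that by (simp add: inner_sum_left inner_Basis sum.If_cases if_distrib[of "\<lambda>u. x _ * u"] cong: if_cong)
  have "integrable (\<Pi>\<^sub>M b\<in>Basis. lborel) (\<lambda>x. \<Prod>b\<in>Basis. f b (x b))"
    by (rule product_integrable_prod) (use assms in auto)
  then have "integrable (\<Pi>\<^sub>M b\<in>Basis. lborel) (\<lambda>x. \<Prod>b\<in>Basis. f b ((\<Sum>c\<in>Basis. x c *\<^sub>R c) \<bullet> b))"
    by (simp add: *)
  then show "integrable lborel (\<lambda>x::'a. \<Prod>b\<in>Basis. f b (x \<bullet> b))"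
    by (subst lborel_eq) (simp add: integrable_distr_eq)
  show "(LBINT x::'a. \<Prod>b\<in>Basis. f b (x \<bullet> b)) = (\<Prod>b\<in>Basis. LBINT t. f b t)"
    by (subst lborel_eq) (simp add: integral_distr * product_integral_prod assms)
qed

lemma
  fixes z :: "'a::euclidean_space"
  shows integrable_gauss: "integrable lborel (gauss :: 'a \<Rightarrow> real)"
    and gauss_fourier: "(LBINT x::'a. gauss x * cos (x \<bullet> z)) = sqrt (2 * pi) ^ DIM('a) * gauss z"
proof -
  let ?f = "\<lambda>b x. complex_of_real (exp (- x\<^sup>2 / 2)) * iexp ((z \<bullet> b) * x)"
  have int1: "integrable lborel (?f b)" for b
    by (rule Bochner_Integration.integrable_bound[OF integrable_gauss_1]) (auto simp: norm_mult)
  have prod: "(\<Prod>b\<in>Basis. ?f b (x \<bullet> b)) = of_real (gauss x) * iexp (x \<bullet> z)" for x :: 'a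
  proof -
    have "x \<bullet> z = (\<Sum>b\<in>Basis. (z \<bullet> b) * (x \<bullet> b))"
      by (subst euclidean_inner) (simp add: mult.commute)
    then show ?thesis
      by (simp add: prod.distrib gauss_prod exp_sum[symmetric] sum_distrib_left flip: of_real_prod)
  qed
  have int: "integrable lborel (\<lambda>x::'a. of_real (gauss x) * iexp (x \<bullet> z))"
    using integrable_lborel_prod[of ?f, OF int1] by (simp only: prod)
  have "(LBINT x::'a. of_real (gauss x) * iexp (x \<bullet> z)) =
      (\<Prod>b\<in>(Basis::'a set). of_real (sqrt (2 * pi) * exp (- (z \<bullet> b)\<^sup>2 / 2)))"
    using integral_lborel_prod[of ?f, OF int1] by (simp only: prod gauss_fourier_1)
  also have "\<dots> = of_real (sqrt (2 * pi) ^ DIM('a) * gauss z)"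
    by (simp add: gauss_prod prod.distrib)
  finally have "Re (LBINT x::'a. of_real (gauss x) * iexp (x \<bullet> z)) = sqrt (2 * pi) ^ DIM('a) * gauss z"
    by simp
  moreover have "Re (LBINT x::'a. of_real (gauss x) * iexp (x \<bullet> z)) =
      (LBINT x. Re (of_real (gauss x) * iexp (x \<bullet> z)))"
    by (rule integral_Re[OF int, symmetric])
  moreover have "Re (of_real (gauss x) * iexp (x \<bullet> z)) = gauss x * cos (x \<bullet> z)" for x
    by (simp add: Re_exp)
  ultimately show "(LBINT x::'a. gauss x * cos (x \<bullet> z)) = sqrt (2 * pi) ^ DIM('a) * gauss z" by (simp only:)
  have "integrable lborel (\<lambda>x::'a. norm (of_real (gauss x) * iexp (x \<bullet> z)))"
    using int by (rule integrable_norm)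
  moreover have "norm (of_real (gauss x) * iexp (x \<bullet> z)) = gauss x" for x
    by (simp add: norm_mult gauss_def)
  ultimately show "integrable lborel (gauss :: 'a \<Rightarrow> real)" by simp
qed

lemma gauss_le_1: "gauss x \<le> 1" and gauss_pos: "gauss x > 0"
  by (auto simp: gauss_def)

lemma continuous_compact_support_integrable:
  fixes h :: "'a::euclidean_space \<Rightarrow> 'b::{banach, second_countable_topology}"
  assumes "continuous_on UNIV h" "\<And>z. z \<notin> cbox c d \<Longrightarrow> h z = 0"
  shows "integrable lborel h"
proof -
  have "integrable lborel (\<lambda>x. indicator (cbox c d) x *\<^sub>R h x)"
    by (rule borel_integrable_compact) (use assms in \<open>auto intro: continuous_on_subset\<close>)
  moreover have "(\<lambda>x. indicator (cbox c d) x *\<^sub>R h x) = h"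
    using assms(2) by (auto simp: indicator_def)
  ultimately show ?thesis by simp
qed

lemma integrable_product_lborel:
  fixes f :: "'a::euclidean_space \<Rightarrow> real" and g :: "'b::euclidean_space \<Rightarrow> real"
  assumes "integrable lborel f" "integrable lborel g"
  shows "integrable (lborel \<Otimes>\<^sub>M lborel) (\<lambda>(x, y). f x * g y)"
proof -
  have [measurable]: "f \<in> borel_measurable borel" "g \<in> borel_measurable borel"
    using assms by (auto dest: borel_measurable_integrable)
  show ?thesis
  proof (rule lborel_pair.Fubini_integrable)
    show "integrable lborel (\<lambda>x. LBINT y. norm (case (x, y) of (x, y) \<Rightarrow> f x * g y))"
      using assms by (simp add: abs_mult)
  qed (use assms in auto)
qed

lemma nonneg_if_mult_pos: "0 \<le> c * x \<Longrightarrow> 0 < c \<Longrightarrow> 0 \<le> (x::real)"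
  by (simp add: zero_le_mult_iff)

lemma borel_measurable_fst_minus_snd [measurable]:
  "(\<lambda>z::'a::euclidean_space \<times> 'a. fst z - snd z) \<in> borel_measurable borel"
  by (intro borel_measurable_continuous_onI continuous_intros)

text \<open>Averaging the hypothesis over \<xi> with a Gaussian weight keeps the sign, and after
  Fubini the average of the cosine is again a Gaussian. The frequency is scaled by N, so large N
  concentrates the resulting kernel near the diagonal.\<close>

lemma gauss_average_nonneg:
  fixes h :: "'a::euclidean_space \<times> 'a \<Rightarrow> real"
  assumes h: "integrable lborel h"
    and pos: "\<And>\<xi>. 0 \<le> (LBINT z. h z * cos (\<xi> \<bullet> (fst z - snd z)))"
  shows "0 \<le> (LBINT z. h z * gauss (N *\<^sub>R (fst z - snd z)))"
proof -
  have [measurable]: "h \<in> borel_measurable borel" using h by (auto dest: borel_measurable_integrable)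
  let ?F = "\<lambda>\<xi> z. gauss \<xi> * (h z * cos ((N *\<^sub>R \<xi>) \<bullet> (fst z - snd z)))"
  have "integrable (lborel \<Otimes>\<^sub>M lborel) (\<lambda>(\<xi>::'a, z). gauss \<xi> * h z)"
    by (rule integrable_product_lborel[OF integrable_gauss h])
  then have int: "integrable (lborel \<Otimes>\<^sub>M lborel) (\<lambda>(\<xi>, z). ?F \<xi> z)"
    by (rule Bochner_Integration.integrable_bound)
       (auto simp: abs_mult mult_left_le intro!: AE_I2 mult_left_mono)
  have "0 \<le> (LBINT \<xi>. LBINT z. ?F \<xi> z)"
    using pos[of "N *\<^sub>R \<xi>" for \<xi>]
    by (intro Bochner_Integration.integral_nonneg[of _ "\<lambda>\<xi>. LBINT z. ?F \<xi> z"])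
       (simp del: inner_scaleR_left add: gauss_pos less_imp_le integral_mult_right_zero)
  also have "\<dots> = (LBINT z. LBINT \<xi>. ?F \<xi> z)"
    by (rule lborel_pair.Fubini_integral[OF int, symmetric])
  also have "\<dots> = (LBINT z. sqrt (2 * pi) ^ DIM('a) * (h z * gauss (N *\<^sub>R (fst z - snd z))))"
  proof (rule Bochner_Integration.integral_cong[OF refl])
    fix z :: "'a \<times> 'a"
    have F: "?F \<xi> z = h z * (gauss \<xi> * cos (\<xi> \<bullet> (N *\<^sub>R (fst z - snd z))))" for \<xi>
      by (simp add: mult_ac)
    then show "(LBINT \<xi>. ?F \<xi> z) = sqrt (2 * pi) ^ DIM('a) * (h z * gauss (N *\<^sub>R (fst z - snd z)))"
      unfolding F integral_mult_right_zero gauss_fourier by (simp only: mult_ac)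
  qed
  also have "\<dots> = sqrt (2 * pi) ^ DIM('a) * (LBINT z. h z * gauss (N *\<^sub>R (fst z - snd z)))"
    by simp
  finally show ?thesis by (rule nonneg_if_mult_pos) simp
qed

lemma integral_lborel_affine:
  fixes f :: "'a::euclidean_space \<Rightarrow> 'b::{banach, second_countable_topology}"
  assumes [measurable]: "f \<in> borel_measurable borel" and "c \<noteq> 0"
  shows "(LBINT x. f x) = \<bar>c\<bar> ^ DIM('a) *\<^sub>R (LBINT x. f (t + c *\<^sub>R x))"
  by (subst lborel_affine[OF \<open>c \<noteq> 0\<close>, of t])
     (simp add: integral_density integral_distr)

text \<open>The substitute for Fourier inversion. The Gaussian averages are positive multiples of
  integrals of h(x, x + w/N) against \<open>gauss w\<close>; as N grows these tend to the integral
  over the diagonal times the Gaussian mass. Continuity gives the pointwise limit, compact support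
  the dominating function.\<close>

lemma diagonal_nonneg:
  fixes h :: "'a::euclidean_space \<times> 'a \<Rightarrow> real"
  assumes cont: "continuous_on UNIV h"
    and supp: "\<And>z. z \<notin> cbox (c, c) (d, d) \<Longrightarrow> h z = 0"
    and pos: "\<And>\<xi>. 0 \<le> (LBINT z. h z * cos (\<xi> \<bullet> (fst z - snd z)))"
  shows "0 \<le> (LBINT x. h (x, x))"
proof -
  have h: "integrable lborel h"
    by (rule continuous_compact_support_integrable[OF cont supp])
  have hm[measurable]: "h \<in> borel_measurable borel" using h by (auto dest: borel_measurable_integrable)
  have [measurable]: "h \<in> borel_measurable (borel \<Otimes>\<^sub>M borel)" using hm by (simp add: borel_prod)
  have "bounded (h ` cbox (c, c) (d, d))"
    by (intro compact_imp_bounded compact_continuous_image continuous_on_subset[OF cont]) auto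
  then obtain M where "\<And>z. z \<in> cbox (c, c) (d, d) \<Longrightarrow> \<bar>h z\<bar> \<le> M"
    by (auto simp: bounded_iff)
  then have M: "\<bar>h z\<bar> \<le> max M 0" for z using supp[of z] by (cases "z \<in> cbox (c, c) (d, d)") fastforce+
  have M': "\<bar>h (x, y)\<bar> \<le> max M 0 * indicator (cbox c d) x" for x y
    using M[of "(x, y)"] supp[of "(x, y)"] by (auto simp: indicator_def cbox_Pair_eq)
  \<comment> \<open>The Gaussian average after the substitution y = x + w/N with N = n + 1, stripped
    of its positive Jacobian, since only the sign is at stake.\<close>
  define I where "I = (\<lambda>n::nat. \<integral>(x, w). h (x, x + (1 / real (Suc n)) *\<^sub>R w) * gauss w \<partial>(lborel \<Otimes>\<^sub>M lborel))"
  let ?bd = "\<lambda>(x::'a, w::'a). (max M 0 * indicator (cbox c d) x) * gauss w"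
  have bd: "integrable (lborel \<Otimes>\<^sub>M lborel) ?bd"
    by (rule integrable_product_lborel[OF integrable_mult_right[OF integrable_real_indicator] integrable_gauss])
       (use emeasure_lborel_cbox_finite[of c d] in auto)
  have dom: "\<bar>h (x, x + r *\<^sub>R w) * gauss w\<bar> \<le> ?bd (x, w)" for x w r
    using M'[of x] by (auto simp: abs_mult gauss_pos less_imp_le intro!: mult_right_mono)
  have int: "integrable (lborel \<Otimes>\<^sub>M lborel) (\<lambda>(x, w). h (x, x + r *\<^sub>R w) * gauss w)" for r
    by (rule Bochner_Integration.integrable_bound[OF bd])
       (use dom in \<open>auto simp: case_prod_beta intro!: AE_I2 order_trans[OF _ abs_ge_self]\<close>)
  have "0 \<le> I n" for n
  proof -
    let ?N = "real (Suc n)"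
    have intN: "integrable (lborel \<Otimes>\<^sub>M lborel) (\<lambda>z. h z * gauss (?N *\<^sub>R (fst z - snd z)))"
      unfolding lborel_prod
      by (rule Bochner_Integration.integrable_bound[OF h])
         (auto simp: abs_mult mult_left_le gauss_le_1 gauss_pos less_imp_le)
    have "0 \<le> (LBINT z. h z * gauss (?N *\<^sub>R (fst z - snd z)))"
      by (rule gauss_average_nonneg[OF h pos])
    also have "\<dots> = (LBINT x. LBINT y. h (x, y) * gauss (?N *\<^sub>R (x - y)))"
      unfolding lborel_prod[symmetric] by (subst lborel_pair.integral_fst'[OF intN, symmetric]) simp
    also have "\<dots> = (LBINT x. (1 / ?N) ^ DIM('a) *\<^sub>R (LBINT w. h (x, x + (1 / ?N) *\<^sub>R w) * gauss w))"
    proof (rule Bochner_Integration.integral_cong[OF refl])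
      fix x :: 'a
      have "gauss (?N *\<^sub>R (x - (x + (1 / ?N) *\<^sub>R w))) = gauss w" for w
        by (simp add: gauss_def)
      then show "(LBINT y. h (x, y) * gauss (?N *\<^sub>R (x - y))) =
          (1 / ?N) ^ DIM('a) *\<^sub>R (LBINT w. h (x, x + (1 / ?N) *\<^sub>R w) * gauss w)"
        by (subst integral_lborel_affine[where c = "1 / ?N" and t = x]) auto
    qed
    also have "\<dots> = (1 / ?N) ^ DIM('a) * I n"
      unfolding I_def using lborel_pair.integral_fst'[OF int, of "1 / ?N"] by simp
    finally show ?thesis by (rule nonneg_if_mult_pos) simp
  qed
  moreover have "I \<longlonglongrightarrow> (\<integral>(x, w::'a). h (x, x) * gauss w \<partial>(lborel \<Otimes>\<^sub>M lborel))"
    unfolding I_def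
  proof (rule integral_dominated_convergence[where w = ?bd])
    show "(\<lambda>(x, w). h (x, x) * gauss w) \<in> borel_measurable (lborel \<Otimes>\<^sub>M lborel)"
      using borel_measurable_integrable[OF int[of 0]] by simp
    show "(\<lambda>(x, w). h (x, x + (1 / real (Suc n)) *\<^sub>R w) * gauss w) \<in> borel_measurable (lborel \<Otimes>\<^sub>M lborel)" for n
      by (rule borel_measurable_integrable[OF int])
    show "integrable (lborel \<Otimes>\<^sub>M lborel) ?bd" by (rule bd)
    show "AE z in lborel \<Otimes>\<^sub>M lborel. (\<lambda>n. case z of (x, w) \<Rightarrow> h (x, x + (1 / real (Suc n)) *\<^sub>R w) * gauss w)
        \<longlonglongrightarrow> (case z of (x, w) \<Rightarrow> h (x, x) * gauss w)"
    proof (intro AE_I2, clarify)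
      fix x w :: 'a
      have "(\<lambda>n. x + (1 / real (Suc n)) *\<^sub>R w) \<longlonglongrightarrow> x + 0 *\<^sub>R w"
        using LIMSEQ_inverse_real_of_nat
        by (intro tendsto_add tendsto_const tendsto_scaleR) (simp add: inverse_eq_divide)
      then have "(\<lambda>n. (x, x + (1 / real (Suc n)) *\<^sub>R w)) \<longlonglongrightarrow> (x, x)"
        by (intro tendsto_Pair tendsto_const) simp
      moreover have "isCont h (x, x)" using cont by (simp add: continuous_on_eq_continuous_at)
      ultimately have "(\<lambda>n. h (x, x + (1 / real (Suc n)) *\<^sub>R w)) \<longlonglongrightarrow> h (x, x)"
        by (rule isCont_tendsto_compose[rotated])
      then show "(\<lambda>n. h (x, x + (1 / real (Suc n)) *\<^sub>R w) * gauss w) \<longlonglongrightarrow> h (x, x) * gauss w"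
        by (rule tendsto_mult_right)
    qed
    show "AE z in lborel \<Otimes>\<^sub>M lborel. norm (case z of (x, w) \<Rightarrow> h (x, x + (1 / real (Suc n)) *\<^sub>R w) * gauss w) \<le> ?bd z" for n
      using dom by (intro AE_I2) (simp only: case_prod_beta real_norm_def fst_conv snd_conv split_paired_all)
  qed
  ultimately have "0 \<le> (\<integral>(x, w::'a). h (x, x) * gauss w \<partial>(lborel \<Otimes>\<^sub>M lborel))"
    by (intro LIMSEQ_le_const) auto
  also have "\<dots> = (LBINT x. LBINT w::'a. h (x, x) * gauss w)"
    using lborel_pair.integral_fst'[OF int, of 0] by simp
  also have "\<dots> = (LBINT w::'a. gauss w) * (LBINT x. h (x, x))"
    by (simp only: integral_mult_right_zero integral_mult_left_zero mult.commute)
  also have "(LBINT w::'a. gauss w) = sqrt (2 * pi) ^ DIM('a)"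
    using gauss_fourier[of "0::'a"] by (simp add: gauss_def)
  finally show ?thesis by (rule nonneg_if_mult_pos) simp
qed

subsection \<open>Windowed Fourier transform along the normal\<close>

lemma integral_eq_UNIV:
  fixes f :: "'a::euclidean_space \<Rightarrow> 'b::banach"
  assumes "\<And>x. x \<notin> S \<Longrightarrow> f x = 0"
  shows "integral S f = integral UNIV f"
proof -
  have "(\<lambda>x. if x \<in> S then f x else 0) = f" using assms by auto
  then show ?thesis using integral_restrict_UNIV[of S f] by simp
qed

text \<open>By translation invariance the integral of x -> g(x + tv) does not depend on t;
  differentiating under the integral at t = 0 gives the integral of g'.\<close>

lemma integral_directional_derivative_zero:
  fixes g :: "'a::euclidean_space \<Rightarrow> 'b::euclidean_space"
  assumes D: "\<And>x. ((\<lambda>t::real. g (x + t *\<^sub>R v)) has_vector_derivative g' x) (at 0)"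
    and g: "continuous_on UNIV g" "\<And>x. x \<notin> cbox c d \<Longrightarrow> g x = 0"
    and g': "continuous_on UNIV g'" "\<And>x. x \<notin> cbox c d \<Longrightarrow> g' x = 0"
  shows "integral (cbox c d) g' = 0"
proof -
  define U where "U = {- 1..1::real}"
  have "bounded ((\<lambda>(x, t). x - t *\<^sub>R v) ` (cbox c d \<times> U))"
    unfolding U_def case_prod_beta
    by (intro compact_imp_bounded compact_continuous_image compact_Times continuous_intros) auto
  \<comment> \<open>A box containing the supports of all translates with t in \<open>U\<close>, so
    that the parameter integral runs over one fixed compact set.\<close>
  then obtain c' d' where cd': "(\<lambda>(x, t). x - t *\<^sub>R v) ` (cbox c d \<times> U) \<subseteq> cbox c' d'"
    by (meson bounded_subset_cbox_symmetric)
  have in': "y \<in> cbox c' d'" if "y + t *\<^sub>R v \<in> cbox c d" "t \<in> U" for y t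
  proof -
    have "(\<lambda>(x, t). x - t *\<^sub>R v) (y + t *\<^sub>R v, t) \<in> cbox c' d'" using cd' that by blast
    then show ?thesis by simp
  qed
  have gt: "continuous_on UNIV (\<lambda>x. g (t *\<^sub>R v + x))" for t
    by (rule continuous_on_compose2[OF g(1)]) (auto intro!: continuous_intros)
  have const: "integral (cbox c' d') (\<lambda>x. g (x + t *\<^sub>R v)) = (LBINT x. g x)" if t: "t \<in> U" for t
  proof -
    have out: "g (x + t *\<^sub>R v) = 0" if "x \<notin> cbox c' d'" for x using in'[OF _ t] that g(2) by blast
    have "integral (cbox c' d') (\<lambda>x. g (x + t *\<^sub>R v)) = integral UNIV (\<lambda>x. g (t *\<^sub>R v + x))"
      using integral_eq_UNIV[of "cbox c' d'", OF out] by (simp add: add.commute)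
    also have "\<dots> = (LBINT x. g (t *\<^sub>R v + x))"
      by (intro integral_lborel continuous_compact_support_integrable[OF gt, of c' d'])
         (auto simp: out add.commute)
    also have "\<dots> = (LBINT x. g x)"
      using integral_lborel_affine[of g 1 "t *\<^sub>R v"] g(1) by (simp add: borel_measurable_continuous_onI)
    finally show ?thesis .
  qed
  have "((\<lambda>t. integral (cbox c' d') (\<lambda>x. g (x + t *\<^sub>R v))) has_vector_derivative
      integral (cbox c' d') (\<lambda>x. g' (x + 0 *\<^sub>R v))) (at 0 within U)"
  proof (rule leibniz_rule_vector_derivative[where f = "\<lambda>t x. g (x + t *\<^sub>R v)" and fx = "\<lambda>t x. g' (x + t *\<^sub>R v)"])
    fix t x
    have "((\<lambda>s. g ((x + t *\<^sub>R v) + (s - t) *\<^sub>R v)) has_vector_derivative 1 *\<^sub>R g' (x + t *\<^sub>R v)) (at t)"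
    proof -
      have "((\<lambda>s. s - t) has_vector_derivative 1) (at t)"
        by (auto intro!: derivative_eq_intros simp: has_vector_derivative_def)
      moreover have "((\<lambda>s. g ((x + t *\<^sub>R v) + s *\<^sub>R v)) has_vector_derivative g' (x + t *\<^sub>R v)) (at (t - t))"
        using D by simp
      ultimately have "((\<lambda>s. g ((x + t *\<^sub>R v) + s *\<^sub>R v)) \<circ> (\<lambda>s. s - t) has_vector_derivative 1 *\<^sub>R g' (x + t *\<^sub>R v)) (at t)"
        by (rule vector_diff_chain_at)
      then show ?thesis by (simp add: o_def)
    qed
    moreover have "(x + t *\<^sub>R v) + (s - t) *\<^sub>R v = x + s *\<^sub>R v" for s by (simp add: algebra_simps)
    ultimately show "((\<lambda>t. g (x + t *\<^sub>R v)) has_vector_derivative g' (x + t *\<^sub>R v)) (at t within U)"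
      by (auto intro: has_vector_derivative_at_within)
  next
    show "(\<lambda>x. g (x + t *\<^sub>R v)) integrable_on cbox c' d'" for t
      by (intro integrable_continuous continuous_on_compose2[OF g(1)]) (auto intro!: continuous_intros)
    show "continuous_on (U \<times> cbox c' d') (\<lambda>(t, x). g' (x + t *\<^sub>R v))"
      unfolding case_prod_beta
      by (intro continuous_on_compose2[OF g'(1)]) (auto intro!: continuous_intros)
  qed (auto simp: U_def)
  then have "((\<lambda>t. LBINT x. g x) has_vector_derivative integral (cbox c' d') g') (at 0 within U)"
    using const by (auto simp: U_def intro: has_vector_derivative_transform[rotated 2])
  moreover have "((\<lambda>t::real. LBINT x. g x) has_vector_derivative 0) (at 0 within U)"
    by (rule has_vector_derivative_const)
  ultimately have 0: "integral (cbox c' d') g' = 0"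
    by (rule vector_derivative_unique_within[rotated])
       (auto simp: U_def trivial_limit_within intro: islimpt_Icc)
  have sub: "cbox c d \<subseteq> cbox c' d'" using in'[of _ 0] by (auto simp: U_def)
  have "integral (cbox c d) g' = integral UNIV g'"
    by (rule integral_eq_UNIV[OF g'(2)])
  also have "\<dots> = integral (cbox c' d') g'"
    by (rule integral_eq_UNIV[symmetric]) (rule g'(2), use sub in blast)
  finally have "integral (cbox c d) g' = integral (cbox c' d') g'" .
  with 0 show ?thesis by simp
qed

text \<open>The window restricts f to a strip parallel to the boundary. When f vanishes outside
  \<open>cbox c d\<close> this is an integral over the whole space; writing it over a compact box
  makes differentiation under the integral directly applicable.\<close>

definition strip_transform ::
  "(real \<Rightarrow> real) \<Rightarrow> real^'n::finite \<Rightarrow> real^'n \<Rightarrow> real^'n \<Rightarrow> real^'n \<Rightarrow> (real^'n \<Rightarrow> real) \<Rightarrow> real \<Rightarrow> complex"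
  where "strip_transform \<phi> \<nu> \<xi> c d f s =
    integral (cbox c d) (\<lambda>x. of_real (f x * \<phi> (s - \<nu> \<bullet> x)) * cis (- (\<xi> \<bullet> x)))"

lemma continuous_on_cis [continuous_intros]:
  "continuous_on S f \<Longrightarrow> continuous_on S (\<lambda>x. cis (f x))"
  unfolding cis_conv_exp by (intro continuous_intros) auto

lemma strip_transform_derivative:
  assumes "continuous_on UNIV f" "smooth1 \<phi>"
  shows "(strip_transform \<phi> \<nu> \<xi> c d f has_vector_derivative strip_transform (deriv \<phi>) \<nu> \<xi> c d f s) (at s)"
proof -
  note cont = continuous_on_compose2[OF assms(1) _ subset_UNIV]
    continuous_on_compose2[OF smooth1_continuous[OF assms(2), of UNIV] _ subset_UNIV]
    continuous_on_compose2[OF smooth1_continuous[OF smooth1_deriv[OF assms(2)], of UNIV] _ subset_UNIV]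
  have "((\<lambda>s. integral (cbox c d) (\<lambda>x. of_real (f x * \<phi> (s - \<nu> \<bullet> x)) * cis (- (\<xi> \<bullet> x)))) has_vector_derivative
     integral (cbox c d) (\<lambda>x. of_real (f x * deriv \<phi> (s - \<nu> \<bullet> x)) * cis (- (\<xi> \<bullet> x)))) (at s within UNIV)"
  proof (rule leibniz_rule_vector_derivative[where f = "\<lambda>s x. of_real (f x * \<phi> (s - \<nu> \<bullet> x)) * cis (- (\<xi> \<bullet> x))"
       and fx = "\<lambda>s x. of_real (f x * deriv \<phi> (s - \<nu> \<bullet> x)) * cis (- (\<xi> \<bullet> x))"])
    fix s x
    have "((\<lambda>s. s - \<nu> \<bullet> x) has_real_derivative 1) (at s)"
      by (auto intro!: derivative_eq_intros)
    from DERIV_cmult[OF DERIV_chain2[OF smooth1_DERIV[OF assms(2)] this], of "f x"]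
    have "((\<lambda>s. f x * \<phi> (s - \<nu> \<bullet> x)) has_real_derivative f x * deriv \<phi> (s - \<nu> \<bullet> x)) (at s)"
      by simp
    then show "((\<lambda>s. of_real (f x * \<phi> (s - \<nu> \<bullet> x)) * cis (- (\<xi> \<bullet> x))) has_vector_derivative
        of_real (f x * deriv \<phi> (s - \<nu> \<bullet> x)) * cis (- (\<xi> \<bullet> x))) (at s within UNIV)"
      by (intro has_vector_derivative_mult_left has_vector_derivative_of_real)
  next
    show "(\<lambda>x. of_real (f x * \<phi> (s - \<nu> \<bullet> x)) * cis (- (\<xi> \<bullet> x))) integrable_on cbox c d" for s
      by (intro integrable_continuous continuous_intros cont)
    show "continuous_on (UNIV \<times> cbox c d) (\<lambda>(s, x). of_real (f x * deriv \<phi> (s - \<nu> \<bullet> x)) * cis (- (\<xi> \<bullet> x)))"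
      unfolding case_prod_beta by (intro continuous_intros cont)
  qed auto
  then show ?thesis by (simp add: strip_transform_def[abs_def])
qed

text \<open>The i-th partial derivative of the integrand \<open>?g\<close> integrates to zero.
  Falling on the window it gives -\<nu>_i \<phi>', which is an s-derivative of the window up to the
  factor -\<nu>_i; falling on the phase it gives -\<i>\<xi>_i.\<close>

lemma strip_transform_pderiv:
  fixes f :: "real^'n::finite \<Rightarrow> real"
  assumes f: "smooth_fun f" "\<And>x. x \<notin> cbox c d \<Longrightarrow> f x = 0" and "smooth1 \<phi>"
  shows "strip_transform \<phi> \<nu> \<xi> c d (pderiv_coord i f) s =
    of_real (\<nu> $ i) * strip_transform (deriv \<phi>) \<nu> \<xi> c d f s + \<i> * of_real (\<xi> $ i) * strip_transform \<phi> \<nu> \<xi> c d f s"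
proof -
  note cont = continuous_on_compose2[OF smooth_fun_continuous[OF f(1), of UNIV] _ subset_UNIV]
    continuous_on_compose2[OF smooth_fun_continuous[OF smooth_fun_pderiv[OF f(1)], of UNIV] _ subset_UNIV]
    continuous_on_compose2[OF smooth1_continuous[OF assms(3), of UNIV] _ subset_UNIV]
    continuous_on_compose2[OF smooth1_continuous[OF smooth1_deriv[OF assms(3)], of UNIV] _ subset_UNIV]
  have out: "pderiv_coord i f x = 0" if "x \<notin> cbox c d" for x
    by (rule pderiv_coord_outside[OF closed_cbox f(2) that])
  let ?g1 = "\<lambda>x. complex_of_real (pderiv_coord i f x * \<phi> (s - \<nu> \<bullet> x)) * cis (- (\<xi> \<bullet> x))"
  let ?g2 = "\<lambda>x. complex_of_real (f x * deriv \<phi> (s - \<nu> \<bullet> x)) * cis (- (\<xi> \<bullet> x))"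
  let ?g = "\<lambda>x. complex_of_real (f x * \<phi> (s - \<nu> \<bullet> x)) * cis (- (\<xi> \<bullet> x))"
  let ?g' = "\<lambda>x. ?g1 x - of_real (\<nu> $ i) * ?g2 x - \<i> * of_real (\<xi> $ i) * ?g x"
  have "integral (cbox c d) ?g' = 0"
  proof (rule integral_directional_derivative_zero[where g = ?g and v = "axis i 1"])
    fix x
    have ax: "w \<bullet> (x + t *\<^sub>R axis i 1) = w \<bullet> x + t * w $ i" for w :: "real^'n" and t
      by (simp add: inner_add_right inner_axis)
    have d1: "((\<lambda>t. f (x + t *\<^sub>R axis i 1)) has_real_derivative pderiv_coord i f x) (at 0)"
      by (rule smooth_fun_line_derivative[OF f(1)])
    have "((\<lambda>t. s - \<nu> \<bullet> (x + t *\<^sub>R axis i 1)) has_real_derivative - (\<nu> $ i)) (at 0)"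
      unfolding ax by (auto intro!: derivative_eq_intros)
    from DERIV_chain2[OF smooth1_DERIV[OF assms(3)] this]
    have d2: "((\<lambda>t. \<phi> (s - \<nu> \<bullet> (x + t *\<^sub>R axis i 1))) has_real_derivative deriv \<phi> (s - \<nu> \<bullet> x) * - (\<nu> $ i)) (at 0)"
      by simp
    from DERIV_mult[OF d1 d2]
    have d3: "((\<lambda>t. f (x + t *\<^sub>R axis i 1) * \<phi> (s - \<nu> \<bullet> (x + t *\<^sub>R axis i 1))) has_real_derivative
       pderiv_coord i f x * \<phi> (s - \<nu> \<bullet> x) - \<nu> $ i * (f x * deriv \<phi> (s - \<nu> \<bullet> x))) (at 0)"
      by (simp add: algebra_simps)
    have d4: "((\<lambda>t. cis (- (\<xi> \<bullet> (x + t *\<^sub>R axis i 1)))) has_vector_derivative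
       - \<i> * of_real (\<xi> $ i) * cis (- (\<xi> \<bullet> x))) (at 0)"
    proof -
      have "((\<lambda>t. - (\<xi> \<bullet> (x + t *\<^sub>R axis i 1))) has_real_derivative - (\<xi> $ i)) (at 0)"
        unfolding ax by (auto intro!: derivative_eq_intros)
      then have "((\<lambda>t. \<i> * of_real (- (\<xi> \<bullet> (x + t *\<^sub>R axis i 1)))) has_vector_derivative
           \<i> * of_real (- (\<xi> $ i))) (at 0)"
        by (intro has_vector_derivative_mult_right has_vector_derivative_of_real)
      moreover have "(exp has_field_derivative exp (\<i> * of_real (- (\<xi> \<bullet> (x + 0 *\<^sub>R axis i 1)))))
           (at (\<i> * of_real (- (\<xi> \<bullet> (x + 0 *\<^sub>R axis i 1)))))"
        by (rule DERIV_exp)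
      ultimately have "(exp \<circ> (\<lambda>t. \<i> * of_real (- (\<xi> \<bullet> (x + t *\<^sub>R axis i 1)))) has_vector_derivative
           \<i> * of_real (- (\<xi> $ i)) * exp (\<i> * of_real (- (\<xi> \<bullet> (x + 0 *\<^sub>R axis i 1))))) (at 0)"
        by (rule field_vector_diff_chain_at)
      then show ?thesis by (simp add: o_def cis_conv_exp)
    qed
    show "((\<lambda>t. ?g (x + t *\<^sub>R axis i 1)) has_vector_derivative ?g' x) (at 0)"
      using has_vector_derivative_mult[OF has_vector_derivative_of_real[OF d3] d4]
      by (elim has_vector_derivative_eq_rhs) (simp add: algebra_simps)
  next
    show "continuous_on UNIV ?g" "continuous_on UNIV ?g'" by (intro continuous_intros cont)+
  qed (use f(2) out in auto)
  moreover have int: "?g1 integrable_on cbox c d" "?g2 integrable_on cbox c d" "?g integrable_on cbox c d"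
    by (intro integrable_continuous continuous_intros cont)+
  have "integral (cbox c d) ?g' = integral (cbox c d) ?g1
      - of_real (\<nu> $ i) * integral (cbox c d) ?g2 - \<i> * of_real (\<xi> $ i) * integral (cbox c d) ?g"
    by (simp only: integral_diff integrable_diff integrable_on_mult_right int integral_mult_right)
  ultimately show ?thesis by (simp add: strip_transform_def algebra_simps)
qed

lemma strip_transform_outside:
  assumes "\<And>x. x \<in> cbox c d \<Longrightarrow> f x * \<phi> (s - \<nu> \<bullet> x) = 0"
  shows "strip_transform \<phi> \<nu> \<xi> c d f s = 0"
proof -
  have "integral (cbox c d) (\<lambda>x. of_real (f x * \<phi> (s - \<nu> \<bullet> x)) * cis (- (\<xi> \<bullet> x))) = integral (cbox c d) (\<lambda>_. 0)"
    by (rule integral_cong) (simp only: assms of_real_0 mult_zero_left)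
  then show ?thesis by (simp add: strip_transform_def)
qed

text \<open>Putting \<open>(deriv ^^ k) \<phi>\<close> and the factor (-\<i>)^k encodes D^k of the
  transform, so each partial derivative contributes \<i>(\<xi>_i + \<nu>_i D). The induction is
  stated for all k because the new linear factor reads the positions k and k + 1.\<close>

lemma strip_transform_iter_pderiv:
  assumes f: "smooth_fun f" "\<And>x. x \<notin> cbox c d \<Longrightarrow> f x = 0" and "smooth1 \<phi>"
  shows "(- \<i>) ^ k * strip_transform ((deriv ^^ k) \<phi>) \<nu> \<xi> c d (iter_pderiv L f) s =
    \<i> ^ length L * pact (\<Prod>i\<leftarrow>L. [:of_real (\<xi> $ i), of_real (\<nu> $ i):])
      (\<lambda>k. (- \<i>) ^ k * strip_transform ((deriv ^^ k) \<phi>) \<nu> \<xi> c d f s) k"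
proof (induction L arbitrary: k)
  case (Cons i L)
  let ?e = "\<lambda>k. (- \<i>) ^ k * strip_transform ((deriv ^^ k) \<phi>) \<nu> \<xi> c d f s"
  let ?g = "\<lambda>k. (- \<i>) ^ k * strip_transform ((deriv ^^ k) \<phi>) \<nu> \<xi> c d (iter_pderiv L f) s"
  have out: "iter_pderiv L f x = 0" if "x \<notin> cbox c d" for x
    by (rule iter_pderiv_outside[OF closed_cbox f(2) that])
  have "(- \<i>) ^ k * strip_transform ((deriv ^^ k) \<phi>) \<nu> \<xi> c d (iter_pderiv (i # L) f) s =
     \<i> * (of_real (\<nu> $ i) * ?g (Suc k) + of_real (\<xi> $ i) * ?g k)"
    using strip_transform_pderiv[OF smooth_fun_iter_pderiv[OF f(1), of L] out smooth1_higher_deriv[OF assms(3)], where \<nu> = \<nu> and \<xi> = \<xi> and s = s and i = i]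
    by (simp add: algebra_simps)
  also have "\<dots> = \<i> * pact [:of_real (\<xi> $ i), of_real (\<nu> $ i):] ?g k"
    by (simp add: pact_pCons add.commute)
  also have "?g = (\<lambda>k. \<i> ^ length L * pact (\<Prod>i\<leftarrow>L. [:of_real (\<xi> $ i), of_real (\<nu> $ i):]) ?e k)"
    using Cons.IH by (rule ext)
  also have "\<i> * pact [:of_real (\<xi> $ i), of_real (\<nu> $ i):] \<dots> k =
     \<i> ^ length (i # L) * pact (\<Prod>i\<leftarrow>i # L. [:of_real (\<xi> $ i), of_real (\<nu> $ i):]) ?e k"
    by (simp only: pact_scale list.map prod_list.Cons pact_mult length_Cons power_Suc mult.assoc)
  finally show ?case .
qed simp

subsection \<open>Symbols and the lower bound\<close>

text \<open>Names the list chosen inside \<open>Dalpha\<close>. Only its counts are known, which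
  suffices: the symbol depends on the counts, and the transform turns derivatives into commuting
  polynomial factors.\<close>

definition index_list :: "('n::finite \<Rightarrow> nat) \<Rightarrow> 'n list" where
  "index_list \<alpha> = (SOME L. \<forall>i. count_list L i = \<alpha> i)"

lemma Dalpha_index_list: "Dalpha \<alpha> f = iter_pderiv (index_list \<alpha>) f"
  by (simp add: Dalpha_def index_list_def)

text \<open>The index type is finite, so a multiset with the multiplicities \<alpha> exists, and any
  enumeration of it shows that the choice is not vacuous.\<close>

lemma count_index_list: "count_list (index_list \<alpha>) i = \<alpha> i"
proof -
  have "count (Abs_multiset \<alpha>) = \<alpha>" by (rule count_Abs_multiset) simp
  moreover obtain L where "mset L = Abs_multiset \<alpha>" using ex_mset by blast
  ultimately have "\<forall>i. count_list L i = \<alpha> i" by (metis count_mset)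
  then show ?thesis
    unfolding index_list_def by (rule someI2[where Q = "\<lambda>L. count_list L i = \<alpha> i"]) blast
qed

lemma prod_list_count:
  fixes f :: "'n::finite \<Rightarrow> 'a::comm_monoid_mult"
  shows "(\<Prod>i\<leftarrow>L. f i) = (\<Prod>i\<in>UNIV. f i ^ count_list L i)"
proof (induction L)
  case (Cons j L)
  have "(\<Prod>i\<in>UNIV. f i ^ count_list (j # L) i) = (\<Prod>i\<in>UNIV. (if i = j then f j else 1) * f i ^ count_list L i)"
    by (intro prod.cong) auto
  then show ?case using Cons by (simp add: prod.distrib)
qed simp

lemma length_count: "length L = (\<Sum>i\<in>UNIV. count_list L (i::'n::finite))"
proof (induction L)
  case (Cons j L)
  have "(\<Sum>i\<in>UNIV. count_list (j # L) i) = (\<Sum>i\<in>UNIV. (if i = j then 1 else 0) + count_list L i)"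
    by (intro sum.cong) auto
  then show ?case using Cons by (simp add: sum.distrib)
qed simp

lemma length_index_list: "\<alpha> \<in> multi_indices k \<Longrightarrow> length (index_list \<alpha>) = k"
  by (simp add: length_count count_index_list multi_indices_def)

lemma finite_multi_indices: "finite (multi_indices k :: ('n::finite \<Rightarrow> nat) set)"
proof (rule finite_subset)
  show "multi_indices k \<subseteq> (\<Pi>\<^sub>E i\<in>UNIV. {..k})"
    by (auto simp: multi_indices_def PiE_def intro: member_le_sum)
qed (simp add: finite_PiE)

lemma hom_symbol_index_list:
  "hom_symbol m a \<xi> = (\<Sum>\<alpha>\<in>multi_indices (2 * m). a \<alpha> * (\<Prod>i\<leftarrow>index_list \<alpha>. \<xi> $ i))"
  by (simp add: hom_symbol_def prod_list_count count_index_list)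

lemma prod_list_scaleR:
  fixes \<xi> :: "real^'n::finite"
  shows "(\<Prod>i\<leftarrow>L. (t *\<^sub>R \<xi>) $ i) = t ^ length L * (\<Prod>i\<leftarrow>L. \<xi> $ i)"
  by (induction L) auto

lemma hom_symbol_scaleR: "hom_symbol m a (t *\<^sub>R \<xi>) = t ^ (2 * m) * hom_symbol m a \<xi>"
  unfolding hom_symbol_index_list prod_list_scaleR sum_distrib_left
  by (intro sum.cong refl) (simp add: length_index_list)

lemma hom_symbol_nonneg:
  fixes a :: "('n::finite \<Rightarrow> nat) \<Rightarrow> real"
  assumes "elliptic m a" "m \<ge> 1"
  shows "hom_symbol m a \<xi> \<ge> 0"
  using hom_symbol_scaleR[of m a 0 \<xi>] assms
  by (cases "\<xi> = 0") (auto simp: elliptic_def less_imp_le power_0_left)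

text \<open>The symbol along the line \<xi> + t\<nu>, kept as a sum of products of linear factors
  because \<open>strip_transform_iter_pderiv\<close> delivers it in this shape.\<close>

definition symbol_poly :: "nat \<Rightarrow> (('n::finite \<Rightarrow> nat) \<Rightarrow> real) \<Rightarrow> real^'n \<Rightarrow> real^'n \<Rightarrow> real poly" where
  "symbol_poly m a \<xi> \<nu> = (\<Sum>\<alpha>\<in>multi_indices (2 * m). smult (a \<alpha>) (\<Prod>i\<leftarrow>index_list \<alpha>. [:\<xi> $ i, \<nu> $ i:]))"

lemma poly_symbol_poly: "poly (symbol_poly m a \<xi> \<nu>) t = hom_symbol m a (\<xi> + t *\<^sub>R \<nu>)"
proof -
  have "poly (\<Prod>i\<leftarrow>L. [:\<xi> $ i, \<nu> $ i:]) t = (\<Prod>i\<leftarrow>L. (\<xi> + t *\<^sub>R \<nu>) $ i)" for L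
    by (induction L) (auto simp: algebra_simps)
  then show ?thesis by (simp add: symbol_poly_def hom_symbol_index_list poly_sum)
qed

lemma linear_factors_coeff:
  fixes x y :: "'n \<Rightarrow> 'a::comm_semiring_1"
  shows "degree (\<Prod>i\<leftarrow>L. [:x i, y i:]) \<le> length L \<and> coeff (\<Prod>i\<leftarrow>L. [:x i, y i:]) (length L) = (\<Prod>i\<leftarrow>L. y i)"
proof (induction L)
  case (Cons i L)
  let ?q = "\<Prod>i\<leftarrow>L. [:x i, y i:]"
  have "coeff ?q (Suc (length L)) = 0" using Cons by (intro coeff_eq_0) auto
  moreover have "degree ([:x i, y i:] * ?q) \<le> Suc (length L)"
    using Cons degree_mult_le[of "[:x i, y i:]" ?q] by (auto simp: le_Suc_eq split: if_splits)
  ultimately show ?case using Cons by auto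
qed simp

text \<open>Each linear factor \<xi>_i + \<nu>_i t contributes \<nu>_i to the power t^(2m). The top
  coefficient H(\<nu>) is thus the same for all \<xi>, and so is the constant in the one-dimensional
  estimate.\<close>

lemma
  shows degree_symbol_poly: "degree (symbol_poly m a \<xi> \<nu>) \<le> 2 * m"
    and coeff_symbol_poly: "coeff (symbol_poly m a \<xi> \<nu>) (2 * m) = hom_symbol m a \<nu>"
proof -
  have L: "degree (\<Prod>i\<leftarrow>index_list \<alpha>. [:\<xi> $ i, \<nu> $ i:]) \<le> 2 * m"
    "coeff (\<Prod>i\<leftarrow>index_list \<alpha>. [:\<xi> $ i, \<nu> $ i:]) (2 * m) = (\<Prod>i\<leftarrow>index_list \<alpha>. \<nu> $ i)"
    if "\<alpha> \<in> multi_indices (2 * m)" for \<alpha>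
    using linear_factors_coeff[of "\<lambda>i. \<xi> $ i" "\<lambda>i. \<nu> $ i" "index_list \<alpha>"] length_index_list[OF that] by auto
  show "degree (symbol_poly m a \<xi> \<nu>) \<le> 2 * m"
    unfolding symbol_poly_def
    by (intro degree_sum_le finite_multi_indices order_trans[OF degree_smult_le] L)
  show "coeff (symbol_poly m a \<xi> \<nu>) (2 * m) = hom_symbol m a \<nu>"
    by (simp add: symbol_poly_def hom_symbol_index_list coeff_sum L)
qed

lemma cpoly_symbol_poly:
  "cpoly (symbol_poly m a \<xi> \<nu>) = (\<Sum>\<alpha>\<in>multi_indices (2 * m). smult (of_real (a \<alpha>))
     (\<Prod>i\<leftarrow>index_list \<alpha>. [:of_real (\<xi> $ i), of_real (\<nu> $ i):]))"
proof -
  have sum: "cpoly (\<Sum>\<alpha>\<in>A. f \<alpha>) = (\<Sum>\<alpha>\<in>A. cpoly (f \<alpha>))" for f and A :: "('n \<Rightarrow> nat) set"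
    by (induction A rule: infinite_finite_induct) (auto simp: cpoly_add)
  have smult: "cpoly (smult c p) = smult (of_real c) (cpoly p)" for c p
    by (intro poly_eqI) (simp add: coeff_map_poly)
  have prod: "cpoly (\<Prod>i\<leftarrow>L. [:\<xi> $ i, \<nu> $ i:]) = (\<Prod>i\<leftarrow>L. [:of_real (\<xi> $ i), of_real (\<nu> $ i):])" for L
    by (induction L) (simp_all add: cpoly_mult map_poly_pCons del: mult_pCons_left)
  show ?thesis by (simp add: symbol_poly_def sum smult prod)
qed

lemma continuous_hom_op: "smooth_fun u \<Longrightarrow> continuous_on S (hom_op m a u)"
  unfolding hom_op_def[abs_def] Dalpha_index_list
  by (intro continuous_intros smooth_fun_continuous smooth_fun_iter_pderiv)

lemma hom_op_outside:
  assumes "closed S" "\<And>y. y \<notin> S \<Longrightarrow> u y = 0" "x \<notin> S"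
  shows "hom_op m a u x = 0"
  by (simp add: hom_op_def Dalpha_index_list iter_pderiv_outside[OF assms])

lemma strip_transform_hom_op:
  fixes u :: "real^'n::finite \<Rightarrow> real"
  assumes u: "smooth_fun u" "\<And>x. x \<notin> cbox c d \<Longrightarrow> u x = 0" and "smooth1 \<phi>"
  shows "strip_transform \<phi> \<nu> \<xi> c d (hom_op m a u) s =
    pact (cpoly (symbol_poly m a \<xi> \<nu>)) (\<lambda>k. (- \<i>) ^ k * strip_transform ((deriv ^^ k) \<phi>) \<nu> \<xi> c d u s) 0"
proof -
  let ?e = "\<lambda>k. (- \<i>) ^ k * strip_transform ((deriv ^^ k) \<phi>) \<nu> \<xi> c d u s"
  note cont = continuous_on_compose2[OF smooth_fun_continuous[OF smooth_fun_iter_pderiv[OF u(1)], of UNIV] _ subset_UNIV]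
    continuous_on_compose2[OF smooth1_continuous[OF assms(3), of UNIV] _ subset_UNIV]
  have "strip_transform \<phi> \<nu> \<xi> c d (hom_op m a u) s =
      integral (cbox c d) (\<lambda>x. \<Sum>\<alpha>\<in>multi_indices (2 * m). of_real ((-1) ^ m * a \<alpha>) *
        (of_real (iter_pderiv (index_list \<alpha>) u x * \<phi> (s - \<nu> \<bullet> x)) * cis (- (\<xi> \<bullet> x))))"
    unfolding strip_transform_def hom_op_def Dalpha_index_list
    by (intro integral_cong) (simp add: sum_distrib_left sum_distrib_right mult_ac)
  also have "\<dots> = (\<Sum>\<alpha>\<in>multi_indices (2 * m). of_real ((-1) ^ m * a \<alpha>) *
      strip_transform \<phi> \<nu> \<xi> c d (iter_pderiv (index_list \<alpha>) u) s)"
    unfolding strip_transform_def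
    by (subst integral_sum)
       (auto intro!: finite_multi_indices integrable_continuous continuous_intros cont)
  also have "\<dots> = (\<Sum>\<alpha>\<in>multi_indices (2 * m). of_real (a \<alpha>) *
      pact (\<Prod>i\<leftarrow>index_list \<alpha>. [:of_real (\<xi> $ i), of_real (\<nu> $ i):]) ?e 0)"
  proof (rule sum.cong[OF refl])
    fix \<alpha> :: "'n \<Rightarrow> nat" assume \<alpha>: "\<alpha> \<in> multi_indices (2 * m)"
    \<comment> \<open>The sign (-1)^m in \<open>hom_op\<close> cancels the \<i>^(2m) collected from
      the 2m derivatives.\<close>
    have "(-1) ^ m * \<i> ^ (2 * m) = (1::complex)" by (simp add: power_mult flip: power_mult_distrib)
    then show "of_real ((-1) ^ m * a \<alpha>) * strip_transform \<phi> \<nu> \<xi> c d (iter_pderiv (index_list \<alpha>) u) s =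
        of_real (a \<alpha>) * pact (\<Prod>i\<leftarrow>index_list \<alpha>. [:of_real (\<xi> $ i), of_real (\<nu> $ i):]) ?e 0"
      using strip_transform_iter_pderiv[OF u assms(3), where k = 0 and \<nu> = \<nu> and \<xi> = \<xi> and L = "index_list \<alpha>" and s = s]
      by (simp add: length_index_list[OF \<alpha>] mult_ac)
  qed
  also have "\<dots> = pact (cpoly (symbol_poly m a \<xi> \<nu>)) ?e 0"
    by (simp add: cpoly_symbol_poly pact_sum pact_smult)
  finally show ?thesis .
qed

text \<open>Since f, g and \<phi> are real, the real part of the phase cis(-\<xi> \<bullet> (x - y))
  is what survives. This is the kernel form that \<open>diagonal_nonneg\<close> takes as
  input.\<close>

lemma strip_transform_inner:
  fixes f g :: "real^'n::finite \<Rightarrow> real"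
  assumes "continuous_on UNIV f" "continuous_on UNIV g" "continuous_on UNIV \<phi>"
  shows "Re (strip_transform \<phi> \<nu> \<xi> c d f s * cnj (strip_transform \<phi> \<nu> \<xi> c d g s)) =
    integral (cbox (c, c) (d, d)) (\<lambda>z. f (fst z) * \<phi> (s - \<nu> \<bullet> fst z) * (g (snd z) * \<phi> (s - \<nu> \<bullet> snd z))
       * cos (\<xi> \<bullet> (fst z - snd z)))"
proof -
  note cont = assms[THEN continuous_on_compose2, OF _ subset_UNIV]
  let ?F = "\<lambda>x. complex_of_real (f x * \<phi> (s - \<nu> \<bullet> x)) * cis (- (\<xi> \<bullet> x))"
  let ?G = "\<lambda>x. complex_of_real (g x * \<phi> (s - \<nu> \<bullet> x)) * cis (- (\<xi> \<bullet> x))"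
  have FG: "continuous_on S ?F" "continuous_on S ?G" for S by (intro continuous_intros cont)+
  have cFG: "continuous_on S (\<lambda>z. ?F (fst z) * cnj (?G (snd z)))" for S by (intro continuous_intros cont)
  have "strip_transform \<phi> \<nu> \<xi> c d f s * cnj (strip_transform \<phi> \<nu> \<xi> c d g s) =
     integral (cbox c d) ?F * integral (cbox c d) (\<lambda>y. cnj (?G y))"
    using integral_linear[OF integrable_continuous[OF FG(2)] bounded_linear_cnj]
    by (simp add: strip_transform_def o_def)
  also have "\<dots> = integral (cbox c d) (\<lambda>x. integral (cbox c d) (\<lambda>y. ?F x * cnj (?G y)))"
    by (simp only: integral_mult_right integral_mult_left)
  also have "\<dots> = integral (cbox (c, c) (d, d)) (\<lambda>z. ?F (fst z) * cnj (?G (snd z)))"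
    by (subst integral_prod_continuous[OF cFG]) simp
  finally have "Re (strip_transform \<phi> \<nu> \<xi> c d f s * cnj (strip_transform \<phi> \<nu> \<xi> c d g s)) =
     integral (cbox (c, c) (d, d)) (\<lambda>z. Re (?F (fst z) * cnj (?G (snd z))))"
    using integral_linear[OF integrable_continuous[OF cFG] bounded_linear_Re, of "(c, c)" "(d, d)"]
    by (simp only: o_def)
  also have "(\<lambda>z. Re (?F (fst z) * cnj (?G (snd z)))) = (\<lambda>z. f (fst z) * \<phi> (s - \<nu> \<bullet> fst z) *
      (g (snd z) * \<phi> (s - \<nu> \<bullet> snd z)) * cos (\<xi> \<bullet> (fst z - snd z)))"
    by (auto simp: fun_eq_iff inner_diff_right cos_diff algebra_simps)
  finally show ?thesis .
qed

text \<open>A nonzero integrand needs s \<le> \<nu> \<bullet> x \<le> s + \<delta>, as \<phi> lives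
  on [-\<delta>, 0]; with \<nu> \<bullet> x strictly between lo + \<delta> and hi this puts s
  strictly between lo and hi.\<close>

lemma dseq_strip_transform:
  fixes u :: "real^'n::finite \<Rightarrow> real"
  assumes "continuous_on UNIV u" "smooth1 \<phi>" "\<And>t. t \<notin> {- \<delta>..0} \<Longrightarrow> \<phi> t = 0"
    and "\<And>x. u x \<noteq> 0 \<Longrightarrow> lo + \<delta> < \<nu> \<bullet> x \<and> \<nu> \<bullet> x < hi"
  shows "dseq lo hi (\<lambda>k s. (- \<i>) ^ k * strip_transform ((deriv ^^ k) \<phi>) \<nu> \<xi> c d u s)"
  unfolding dseq_def
proof (intro conjI allI impI)
  fix k s
  have "((\<lambda>s. (- \<i>) ^ k * strip_transform ((deriv ^^ k) \<phi>) \<nu> \<xi> c d u s) has_vector_derivative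
      (- \<i>) ^ k * strip_transform (deriv ((deriv ^^ k) \<phi>)) \<nu> \<xi> c d u s) (at s)"
    by (intro has_vector_derivative_mult_right strip_transform_derivative[OF assms(1) smooth1_higher_deriv[OF assms(2)]])
  then show "((\<lambda>s. (- \<i>) ^ k * strip_transform ((deriv ^^ k) \<phi>) \<nu> \<xi> c d u s) has_vector_derivative
      \<i> * ((- \<i>) ^ Suc k * strip_transform ((deriv ^^ Suc k) \<phi>) \<nu> \<xi> c d u s)) (at s)"
    by (elim has_vector_derivative_eq_rhs) (simp add: mult.assoc[symmetric])
next
  fix k s assume s: "s \<notin> {lo<..<hi}"
  have "u x * (deriv ^^ k) \<phi> (s - \<nu> \<bullet> x) = 0" for x
  proof (cases "u x = 0")
    case False
    then have "s - \<nu> \<bullet> x \<notin> {- \<delta>..0}" using assms(4)[of x] s by auto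
    then show ?thesis using higher_deriv_outside[of "- \<delta>" 0 \<phi>] assms(3) by auto
  qed auto
  then show "(- \<i>) ^ k * strip_transform ((deriv ^^ k) \<phi>) \<nu> \<xi> c d u s = 0"
    by (simp add: strip_transform_outside)
qed

section \<open>Lower bound with the weight (\<nu> \<bullet> x)^(-2m)\<close>

lemma halfspace_support_bounds:
  fixes u :: "real^'n::finite \<Rightarrow> real"
  assumes "u \<in> Cc_inf (halfspace \<nu>)"
  shows "\<exists>\<delta> hi c d. \<delta> > 0 \<and> (\<forall>x\<in>tsupport u. 2 * \<delta> < \<nu> \<bullet> x \<and> \<nu> \<bullet> x < hi) \<and> tsupport u \<subseteq> cbox c d"
proof -
  have S: "compact (tsupport u)" "\<And>x. x \<in> tsupport u \<Longrightarrow> \<nu> \<bullet> x > 0"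
    using assms by (auto simp: Cc_inf_def halfspace_def)
  obtain c d where cd: "tsupport u \<subseteq> cbox c d"
    using compact_imp_bounded[OF S(1)] bounded_subset_cbox_symmetric by blast
  show ?thesis
  proof (cases "tsupport u = {}")
    case True
    then show ?thesis by (intro exI[of _ 1]) auto
  next
    case False
    have cont: "continuous_on (tsupport u) (\<lambda>x. \<nu> \<bullet> x)" by (intro continuous_intros)
    obtain p where p: "p \<in> tsupport u" "\<And>x. x \<in> tsupport u \<Longrightarrow> \<nu> \<bullet> p \<le> \<nu> \<bullet> x"
      using continuous_attains_inf[OF S(1) False cont] by blast
    obtain q where q: "q \<in> tsupport u" "\<And>x. x \<in> tsupport u \<Longrightarrow> \<nu> \<bullet> x \<le> \<nu> \<bullet> q"
      using continuous_attains_sup[OF S(1) False cont] by blast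
    \<comment> \<open>A quarter of the least value of \<nu> \<bullet> x on the support keeps the
      inequality with the factor 2 strict; that factor later leaves room for a window of width
      \<delta>.\<close>
    have "2 * (\<nu> \<bullet> p / 4) < \<nu> \<bullet> x \<and> \<nu> \<bullet> x < \<nu> \<bullet> q + 1" if "x \<in> tsupport u" for x
      using p(2)[OF that] q(2)[OF that] S(2)[OF p(1)] by simp
    then show ?thesis
      using cd S(2)[OF p(1)] by (intro exI[of _ "\<nu> \<bullet> p / 4"] exI[of _ "\<nu> \<bullet> q + 1"] exI[of _ c] exI[of _ d]) auto
  qed
qed

text \<open>The weight is singular only on the boundary hyperplane, away from the support of u; with
  max \<delta> (\<nu> \<bullet> x) in place of \<nu> \<bullet> x the same function is visibly
  continuous.\<close>

lemma hardy_weight_integrable: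
  fixes u :: "real^'n::finite \<Rightarrow> real"
  assumes "u \<in> Cc_inf (halfspace \<nu>)"
  shows "integrable lborel (\<lambda>x. (u x)\<^sup>2 / (\<nu> \<bullet> x) ^ k)"
proof -
  obtain \<delta> hi c d where \<delta>: "\<delta> > 0" and sb: "\<And>x. x \<in> tsupport u \<Longrightarrow> 2 * \<delta> < \<nu> \<bullet> x \<and> \<nu> \<bullet> x < hi"
    and cd: "tsupport u \<subseteq> cbox c d"
    using halfspace_support_bounds[OF assms] by blast
  have "(u x)\<^sup>2 / (\<nu> \<bullet> x) ^ k = (u x)\<^sup>2 / (max \<delta> (\<nu> \<bullet> x)) ^ k" for x
    using sb[of x] zero_outside_tsupport[of x u] \<delta> by (cases "x \<in> tsupport u") (auto simp: max_def)
  moreover have "integrable lborel (\<lambda>x. (u x)\<^sup>2 / (max \<delta> (\<nu> \<bullet> x)) ^ k)"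
  proof (rule continuous_compact_support_integrable)
    show "continuous_on UNIV (\<lambda>x. (u x)\<^sup>2 / (max \<delta> (\<nu> \<bullet> x)) ^ k)"
      using assms \<delta> by (intro continuous_intros smooth_fun_continuous) (auto simp: Cc_inf_def)
  qed (use cd zero_outside_tsupport[of _ u] in auto)
  ultimately show ?thesis by (simp only:)
qed

lemma integral_pos_continuous:
  fixes f :: "real \<Rightarrow> real"
  assumes "continuous_on {a..b} f" "\<And>x. x \<in> {a..b} \<Longrightarrow> f x \<ge> 0" "a < b" "t \<in> {a..b}" "f t > 0"
  shows "integral {a..b} f > 0"
proof -
  have "integral {a..b} f \<ge> 0"
    by (rule integral_nonneg[OF integrable_continuous_real[OF assms(1)]]) (use assms(2) in auto)
  moreover have "integral {a..b} f \<noteq> 0"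
    using integral_eq_0_iff[OF assms(1,3,2)] assms(4,5) by fastforce
  ultimately show ?thesis by simp
qed

text \<open>For every \<xi> the one-dimensional estimate for the windowed transform says that h
  pairs nonnegatively with cos(\<xi> \<bullet> (x - y)). So the integral of h(x, x) is nonnegative,
  while pointwise h(x, x) is at most the mass of \<phi>^2 times the difference of the two
  integrands; that positive mass is divided out at the end.\<close>

lemma hardy_halfspace:
  fixes a :: "('n::finite \<Rightarrow> nat) \<Rightarrow> real" and \<nu> :: "real^'n"
  assumes "m \<ge> 1" "elliptic m a" "norm \<nu> = 1" and u: "u \<in> Cc_inf (halfspace \<nu>)"
  shows "hom_symbol m a \<nu> * A_const m * (LBINT x. (u x)\<^sup>2 / (\<nu> \<bullet> x) ^ (2 * m)) \<le>
     (LBINT x. u x * hom_op m a u x)"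
proof -
  obtain \<delta> hi c d where \<delta>: "\<delta> > 0" and sb: "\<And>x. x \<in> tsupport u \<Longrightarrow> 2 * \<delta> < \<nu> \<bullet> x \<and> \<nu> \<bullet> x < hi"
    and cd: "tsupport u \<subseteq> cbox c d"
    using halfspace_support_bounds[OF u] by blast
  have us: "smooth_fun u" using u by (auto simp: Cc_inf_def)
  have ub: "2 * \<delta> < \<nu> \<bullet> x" "\<nu> \<bullet> x < hi" "x \<in> cbox c d" if "u x \<noteq> 0" for x
    using that zero_outside_tsupport[of x u] sb[of x] cd by auto
  have u0: "u x = 0" if "x \<notin> cbox c d" for x using ub that by blast
  have Hu0: "hom_op m a u x = 0" if "x \<notin> tsupport u" for x
    by (rule hom_op_outside[of "tsupport u"]) (use that zero_outside_tsupport in \<open>auto simp: tsupport_def\<close>)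
  have Hu0': "hom_op m a u x = 0" if "x \<notin> cbox c d" for x using Hu0 that cd by blast
  obtain \<phi> where \<phi>: "smooth1 \<phi>" "\<And>x. \<phi> x \<ge> 0" "\<And>x. x \<in> {- \<delta><..<0} \<Longrightarrow> \<phi> x > 0"
      "\<And>x. x \<notin> {- \<delta><..<0} \<Longrightarrow> \<phi> x = 0"
    using ex_bump[of "- \<delta>" 0] \<delta> by auto
  define K where "K = hom_symbol m a \<nu> * A_const m"
  define H where "H = hom_op m a u"
  \<comment> \<open>u vanishes where \<nu> \<bullet> x \<le> 2\<delta> and the window reaches back
    by \<delta>, so the transforms vanish for s \<le> \<delta>.\<close>
  define lo where "lo = \<delta>"
  have lo: "lo > 0" using \<delta> by (simp add: lo_def)
  \<comment> \<open>The maximum keeps the interval nonempty when u vanishes identically and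
    \<open>hi\<close> carries no information.\<close>
  define hi' where "hi' = max lo hi"
  note cont = continuous_on_compose2[OF smooth_fun_continuous[OF us, of UNIV] _ subset_UNIV]
    continuous_on_compose2[OF continuous_hom_op[OF us, of UNIV m a, folded H_def] _ subset_UNIV]
    continuous_on_compose2[OF smooth1_continuous[OF \<phi>(1), of UNIV] _ subset_UNIV]
  let ?\<Phi> = "\<lambda>z s. \<phi> (s - \<nu> \<bullet> fst z) * \<phi> (s - \<nu> \<bullet> snd z) *
      (H (fst z) * u (snd z) - K * (u (fst z) * u (snd z)) / s ^ (2 * m))"
  let ?r = "\<lambda>x. u x * H x - K * ((u x)\<^sup>2 / (\<nu> \<bullet> x) ^ (2 * m))"
  \<comment> \<open>The kernel in (x, y) whose pairing with the cosine is the excess in the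
    one-dimensional inequality, already integrated over s.\<close>
  define h where "h = (\<lambda>z. integral {lo..hi'} (?\<Phi> z))"
  have conth: "continuous_on UNIV h"
    unfolding h_def box_real(2)[symmetric]
    by (rule integral_continuous_on_param)
       (use lo in \<open>auto simp: case_prod_beta intro!: continuous_intros cont\<close>)
  have h0: "h z = 0" if "z \<notin> cbox (c, c) (d, d)" for z
  proof -
    have e: "H (fst z) * u (snd z) = 0" "u (fst z) * u (snd z) = 0"
      using that u0 Hu0' by (cases z; auto simp: cbox_Pair_eq H_def)+
    show ?thesis unfolding h_def e by simp
  qed
  define I where "I = integral {- \<delta>..0} (\<lambda>t. (\<phi> t)\<^sup>2)"
  have I: "I > 0"
    unfolding I_def using \<delta> \<phi>(3)[of "- \<delta> / 2"]
    by (intro integral_pos_continuous[where t = "- \<delta> / 2"] continuous_intros smooth1_continuous[OF \<phi>(1)]) auto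
  have K: "K \<ge> 0"
    unfolding K_def A_const_def by (intro mult_nonneg_nonneg hom_symbol_nonneg assms divide_nonneg_nonneg prod_nonneg) auto
  have int: "integrable lborel (\<lambda>x. u x * H x)" "integrable lborel (\<lambda>x. K * ((u x)\<^sup>2 / (\<nu> \<bullet> x) ^ (2 * m)))"
    by (intro continuous_compact_support_integrable[of _ c d] continuous_intros cont)
       (use u0 in \<open>auto intro: integrable_mult_right hardy_weight_integrable[OF u] simp del: times_divide_eq_right\<close>)
  have "0 \<le> (LBINT x. h (x, x))"
  proof (rule diagonal_nonneg[OF conth h0])
    fix \<xi> :: "real^'n"
    let ?c = "\<lambda>z. cos (\<xi> \<bullet> (fst z - snd z))"
    let ?W = "strip_transform \<phi> \<nu> \<xi> c d"
    let ?V = "\<lambda>k s. (- \<i>) ^ k * strip_transform ((deriv ^^ k) \<phi>) \<nu> \<xi> c d u s"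
    let ?P = "symbol_poly m a \<xi> \<nu>"
    have V: "dseq lo hi' ?V"
      by (rule dseq_strip_transform[where \<delta> = \<delta>, OF smooth_fun_continuous[OF us] \<phi>(1)])
         (use \<phi>(4) ub in \<open>auto simp: lo_def hi'_def less_max_iff_disj\<close>)
    note [continuous_intros] = dseq_continuous[OF V] dseq_continuous[OF dseq_pact[OF V]]
    have V': "continuous_on S (?W u)" for S
      using dseq_continuous[OF V, of S 0] by simp
    have VH: "?W H s = pact (cpoly ?P) (\<lambda>k. ?V k s) 0" for s
      unfolding H_def by (rule strip_transform_hom_op[OF us u0 \<phi>(1)])
    have VH': "continuous_on S (?W H)" for S
      unfolding VH[abs_def] using dseq_continuous[OF dseq_pact[OF V]] .
    have "\<nu> \<noteq> 0" using assms(3) by auto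
    then have "hom_symbol m a \<nu> > 0" using assms(2) by (simp add: elliptic_def)
    \<comment> \<open>The coefficient of t^(2m) is H(\<nu>) > 0, so the degree is exactly 2m for
      every \<xi>.\<close>
    then have deg: "degree ?P = 2 * m"
      using degree_symbol_poly[of m a \<xi> \<nu>] coeff_symbol_poly[of m a \<xi> \<nu>] le_degree[of ?P "2 * m"] by auto
    then have lc: "lead_coeff ?P = hom_symbol m a \<nu>" by (simp add: coeff_symbol_poly)
    have "K * integral {lo..hi'} (\<lambda>s. (cmod (?W u s))\<^sup>2 / s ^ (2 * m)) \<le>
      Re (integral {lo..hi'} (\<lambda>s. ?W H s * cnj (?W u s)))"
    proof -
      have "lo \<le> hi'" by (simp add: hi'_def)
      moreover have "poly ?P t \<ge> 0" for t
        unfolding poly_symbol_poly by (rule hom_symbol_nonneg[OF assms(2,1)])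
      moreover have "?P \<noteq> 0" using lc \<open>hom_symbol m a \<nu> > 0\<close> by auto
      ultimately show ?thesis
        using hardy_rellich_operator[OF V lo _ deg] by (simp add: lc VH K_def)
    qed
    also have "\<dots> = integral {lo..hi'} (\<lambda>s. Re (?W H s * cnj (?W u s)))"
    proof -
      have "(\<lambda>s. ?W H s * cnj (?W u s)) integrable_on {lo..hi'}"
        by (intro integrable_continuous_real continuous_intros V' VH')
      from integral_linear[OF this bounded_linear_Re] show ?thesis by (simp only: o_def)
    qed
    finally have "0 \<le> integral {lo..hi'} (\<lambda>s. Re (?W H s * cnj (?W u s)))
       - K * integral {lo..hi'} (\<lambda>s. (cmod (?W u s))\<^sup>2 / s ^ (2 * m))" by simp
    also have "\<dots> = integral {lo..hi'} (\<lambda>s. Re (?W H s * cnj (?W u s))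
       - K * ((cmod (?W u s))\<^sup>2 / s ^ (2 * m)))"
      unfolding integral_mult_right[symmetric] using lo
      by (intro integral_diff[symmetric] integrable_continuous_real continuous_intros V' VH') auto
    also have "\<dots> = integral {lo..hi'} (\<lambda>s. integral (cbox (c, c) (d, d)) (\<lambda>z. ?\<Phi> z s * ?c z))"
    proof (rule integral_cong)
      fix s assume "s \<in> {lo..hi'}"
      then have s: "s \<noteq> 0" using lo by auto
      have 1: "Re (?W H s * cnj (?W u s)) =
        integral (cbox (c, c) (d, d)) (\<lambda>z. H (fst z) * \<phi> (s - \<nu> \<bullet> fst z) * (u (snd z) * \<phi> (s - \<nu> \<bullet> snd z))
           * ?c z)"
        unfolding H_def
        by (rule strip_transform_inner[OF continuous_hom_op[OF us] smooth_fun_continuous[OF us] smooth1_continuous[OF \<phi>(1)]])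
      have "(cmod (?W u s))\<^sup>2 =
        Re (?W u s * cnj (?W u s))"
        by (simp only: complex_norm_square[symmetric] Re_complex_of_real)
      also have "\<dots> =
        integral (cbox (c, c) (d, d)) (\<lambda>z. u (fst z) * \<phi> (s - \<nu> \<bullet> fst z) * (u (snd z) * \<phi> (s - \<nu> \<bullet> snd z))
           * ?c z)"
        by (rule strip_transform_inner[OF smooth_fun_continuous[OF us] smooth_fun_continuous[OF us] smooth1_continuous[OF \<phi>(1)]])
      finally have 2: "K * ((cmod (?W u s))\<^sup>2 / s ^ (2 * m)) =
         integral (cbox (c, c) (d, d)) (\<lambda>z. K / s ^ (2 * m) * (u (fst z) * \<phi> (s - \<nu> \<bullet> fst z) *
           (u (snd z) * \<phi> (s - \<nu> \<bullet> snd z)) * ?c z))"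
        by (simp only: integral_mult_right) simp
      show "Re (?W H s * cnj (?W u s))
         - K * ((cmod (?W u s))\<^sup>2 / s ^ (2 * m)) =
        integral (cbox (c, c) (d, d)) (\<lambda>z. ?\<Phi> z s * ?c z)"
        unfolding 1 2
        by (subst integral_diff[symmetric])
           (use s in \<open>auto intro!: integrable_continuous continuous_intros cont integral_cong simp: algebra_simps\<close>)
    qed
    also have "\<dots> = integral (cbox (c, c) (d, d)) (\<lambda>z. integral {lo..hi'} (\<lambda>s. ?\<Phi> z s * ?c z))"
      unfolding box_real(2)[symmetric]
    proof (rule integral_swap_continuous)
      have "fst p ^ (2 * m) \<noteq> 0" if "p \<in> cbox (lo, c, c) (hi', d, d)" for p
        using that lo by (cases p) (auto simp: cbox_Pair_eq)
      then show "continuous_on (cbox (lo, c, c) (hi', d, d)) (\<lambda>(s, z). ?\<Phi> z s * ?c z)"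
        unfolding case_prod_beta by (intro continuous_intros cont) blast
    qed
    also have "\<dots> = integral (cbox (c, c) (d, d)) (\<lambda>z. h z * ?c z)"
      by (simp add: h_def)
    also have "\<dots> = integral UNIV (\<lambda>z. h z * ?c z)"
      by (rule integral_eq_UNIV) (simp add: h0)
    also have "\<dots> = (LBINT z. h z * ?c z)"
      by (intro integral_lborel continuous_compact_support_integrable[of _ "(c, c)" "(d, d)"]
          continuous_intros conth) (simp add: h0)
    finally show "0 \<le> (LBINT z. h z * ?c z)" .
  qed
  also have "\<dots> \<le> (LBINT x. I * ?r x)"
  proof (rule integral_mono)
    show "integrable lborel (\<lambda>x. h (x, x))"
      by (intro continuous_compact_support_integrable[of _ c d] continuous_on_compose2[OF conth]
          continuous_intros) (auto simp: h0 cbox_Pair_eq)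
    show "integrable lborel (\<lambda>x. I * ?r x)"
      by (intro integrable_mult_right Bochner_Integration.integrable_diff int)
    fix x
    show "h (x, x) \<le> I * ?r x"
    proof (cases "u x = 0")
      case True
      then show ?thesis by (simp add: h_def)
    next
      case False
      note x = ub[OF False]
      have contx: "continuous_on {lo..hi'} (\<lambda>s. ?\<Phi> (x, x) s)"
        using lo by (auto intro!: continuous_intros cont)
      have "h (x, x) \<le> integral {lo..hi'} (\<lambda>s. (\<phi> (s - \<nu> \<bullet> x))\<^sup>2 * ?r x)"
        unfolding h_def
      proof (rule integral_le)
        fix s assume s: "s \<in> {lo..hi'}"
        \<comment> \<open>The window is nonzero only for s < \<nu> \<bullet> x. There s^(-2m) \<ge>
          (\<nu> \<bullet> x)^(-2m), and since this weight enters with the factor -K \<le> 0,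
          passing to (\<nu> \<bullet> x)^(-2m) increases the integrand.\<close>
        show "?\<Phi> (x, x) s \<le> (\<phi> (s - \<nu> \<bullet> x))\<^sup>2 * ?r x"
        proof (cases "s < \<nu> \<bullet> x")
          case True
          have "s ^ (2 * m) \<le> (\<nu> \<bullet> x) ^ (2 * m)" using s lo True by (intro power_mono) auto
          moreover have "s > 0" using s lo by auto
          ultimately have "(u x)\<^sup>2 / (\<nu> \<bullet> x) ^ (2 * m) \<le> (u x)\<^sup>2 / s ^ (2 * m)"
            by (intro divide_left_mono mult_pos_pos zero_less_power) (use True in auto)
          then have "K * ((u x)\<^sup>2 / (\<nu> \<bullet> x) ^ (2 * m)) \<le> K * ((u x)\<^sup>2 / s ^ (2 * m))"
            using K by (rule mult_left_mono)
          then have "(\<phi> (s - \<nu> \<bullet> x))\<^sup>2 * (u x * H x - K * ((u x)\<^sup>2 / s ^ (2 * m))) \<le>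
              (\<phi> (s - \<nu> \<bullet> x))\<^sup>2 * ?r x"
            by (intro mult_left_mono) auto
          moreover have "?\<Phi> (x, x) s = (\<phi> (s - \<nu> \<bullet> x))\<^sup>2 * (u x * H x - K * ((u x)\<^sup>2 / s ^ (2 * m)))"
            by (simp add: power2_eq_square mult.commute)
          ultimately show ?thesis by (simp only:)
        next
          case False
          then show ?thesis using \<phi>(4)[of "s - \<nu> \<bullet> x"] by simp
        qed
      next
        show "(\<lambda>s. ?\<Phi> (x, x) s) integrable_on {lo..hi'}" by (rule integrable_continuous_real[OF contx])
        show "(\<lambda>s. (\<phi> (s - \<nu> \<bullet> x))\<^sup>2 * ?r x) integrable_on {lo..hi'}"
          by (intro integrable_continuous_real continuous_on_mult continuous_on_power continuous_on_const cont continuous_intros)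
      qed
      also have "\<dots> = integral {lo..hi'} (\<lambda>s. (\<phi> (s - \<nu> \<bullet> x))\<^sup>2) * ?r x"
        by (rule integral_mult_left)
      also have "integral {lo..hi'} (\<lambda>s. (\<phi> (s - \<nu> \<bullet> x))\<^sup>2) = integral {lo - \<nu> \<bullet> x..hi' - \<nu> \<bullet> x} (\<lambda>s. (\<phi> s)\<^sup>2)"
        using integral_shift_Icc_real[of lo hi' "\<lambda>s. (\<phi> s)\<^sup>2" "- (\<nu> \<bullet> x)"] by (simp add: o_def)
      \<comment> \<open>The shifted interval contains the support of the window because 2\<delta> <
        \<nu> \<bullet> x < hi.\<close>
      also have "\<dots> = I"
      proof -
        have "integral {lo - \<nu> \<bullet> x..hi' - \<nu> \<bullet> x} (\<lambda>s. (\<phi> s)\<^sup>2) = integral UNIV (\<lambda>s. (\<phi> s)\<^sup>2)"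
          by (rule integral_eq_UNIV) (use x in \<open>auto intro!: \<phi>(4) simp: lo_def hi'_def max_def split: if_splits\<close>)
        moreover have "I = integral UNIV (\<lambda>s. (\<phi> s)\<^sup>2)"
          unfolding I_def by (rule integral_eq_UNIV) (auto simp: \<phi>(4))
        ultimately show ?thesis by simp
      qed
      finally show ?thesis .
    qed
  qed
  also have "\<dots> = I * ((LBINT x. u x * H x) - K * (LBINT x. (u x)\<^sup>2 / (\<nu> \<bullet> x) ^ (2 * m)))"
    unfolding Bochner_Integration.integral_mult_right_zero Bochner_Integration.integral_diff[OF int] by (rule refl)
  finally have "0 \<le> I * ((LBINT x. u x * H x) - K * (LBINT x. (u x)\<^sup>2 / (\<nu> \<bullet> x) ^ (2 * m)))" .
  from nonneg_if_mult_pos[OF this I] show ?thesis unfolding K_def H_def by linarith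
qed

subsection \<open>Finsler distance to a hyperplane\<close>

context
  fixes m :: nat and a :: "('n::finite \<Rightarrow> nat) \<Rightarrow> real"
  assumes m: "m \<ge> 1" and ell: "elliptic m a"
begin

lemma F_H_pos: "\<xi> \<noteq> 0 \<Longrightarrow> F_H m a \<xi> > 0"
  using ell by (auto simp: F_H_def elliptic_def)

lemma F_H_power: "F_H m a \<xi> ^ (2 * m) = hom_symbol m a \<xi>"
proof -
  have "F_H m a \<xi> ^ (2 * m) = (hom_symbol m a \<xi> powr (1 / (2 * real m))) powr real (2 * m)" if "hom_symbol m a \<xi> > 0"
    using that by (subst powr_realpow) (auto simp: F_H_def)
  then show ?thesis
    using hom_symbol_nonneg[OF ell m, of \<xi>] m
    by (cases "hom_symbol m a \<xi> = 0") (auto simp: powr_powr F_H_def power_0_left)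
qed

lemma F_H_scaleR: "t \<ge> 0 \<Longrightarrow> F_H m a (t *\<^sub>R \<xi>) = t * F_H m a \<xi>"
proof -
  assume t: "t \<ge> 0"
  have "F_H m a (t *\<^sub>R \<xi>) ^ (2 * m) = (t * F_H m a \<xi>) ^ (2 * m)"
    by (simp add: F_H_power hom_symbol_scaleR power_mult_distrib)
  then show ?thesis
    by (rule power_eq_imp_eq_base) (use t m in \<open>auto simp: F_H_def\<close>)
qed

text \<open>F is continuous and positive on the unit sphere, hence has a positive minimum there, and
  homogeneity extends the bound. It is what makes the supremum in \<open>F_H_dual\<close>
  finite.\<close>

lemma F_H_lower_bound: "\<exists>c>0. \<forall>\<xi>. c * norm \<xi> \<le> F_H m a \<xi>"
proof -
  let ?S = "sphere (0::real^'n) 1"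
  have "continuous_on ?S (hom_symbol m a)"
    unfolding hom_symbol_def[abs_def] by (intro continuous_intros)
  moreover have "\<forall>\<xi>\<in>?S. hom_symbol m a \<xi> \<noteq> 0"
  proof
    fix \<xi> :: "real^'n" assume "\<xi> \<in> ?S"
    then have "\<xi> \<noteq> 0" by auto
    then have "hom_symbol m a \<xi> > 0" using ell unfolding elliptic_def by blast
    then show "hom_symbol m a \<xi> \<noteq> 0" by simp
  qed
  ultimately have cont: "continuous_on ?S (F_H m a)"
    unfolding F_H_def[abs_def] by (intro continuous_on_powr continuous_on_const) auto
  have "axis undefined 1 \<in> ?S" by simp
  then obtain p where p: "p \<in> ?S" "\<And>\<xi>. \<xi> \<in> ?S \<Longrightarrow> F_H m a p \<le> F_H m a \<xi>"
    using continuous_attains_inf[OF compact_sphere _ cont] by (metis empty_iff)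
  have "F_H m a p * norm \<xi> \<le> F_H m a \<xi>" for \<xi>
  proof (cases "\<xi> = 0")
    case True
    then show ?thesis by (simp add: F_H_def)
  next
    case False
    have "F_H m a p * norm \<xi> \<le> F_H m a ((1 / norm \<xi>) *\<^sub>R \<xi>) * norm \<xi>"
      using False by (intro mult_right_mono p) auto
    also have "\<dots> = F_H m a \<xi>" using False by (subst F_H_scaleR) auto
    finally show ?thesis .
  qed
  moreover have "F_H m a p > 0" using p(1) by (intro F_H_pos) auto
  ultimately show ?thesis by blast
qed

text \<open>A real supremum is meaningful only over a set bounded above; the quotients are bounded
  by norm \<omega> / c, with c from \<open>F_H_lower_bound\<close>.\<close>

lemma F_H_dual_upper:
  assumes "\<xi> \<noteq> 0"
  shows "(\<omega> \<bullet> \<xi>) / F_H m a \<xi> \<le> F_H_dual m a \<omega>"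
  unfolding F_H_dual_def
proof (rule cSUP_upper)
  obtain c where c: "c > 0" "\<And>\<xi>. c * norm \<xi> \<le> F_H m a \<xi>" using F_H_lower_bound by blast
  have "(\<omega> \<bullet> \<eta>) / F_H m a \<eta> \<le> norm \<omega> / c" if "\<eta> \<noteq> 0" for \<eta>
  proof -
    have "\<omega> \<bullet> \<eta> \<le> norm \<omega> / c * (c * norm \<eta>)" using c(1) norm_cauchy_schwarz[of \<omega> \<eta>] by simp
    also have "\<dots> \<le> norm \<omega> / c * F_H m a \<eta>" using c by (intro mult_left_mono) auto
    finally show ?thesis using F_H_pos[OF that] by (simp add: pos_divide_le_eq)
  qed
  then show "bdd_above ((\<lambda>\<xi>. (\<omega> \<bullet> \<xi>) / F_H m a \<xi>) ` {\<xi>. \<xi> \<noteq> 0})"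
    by (intro bdd_aboveI2[where M = "norm \<omega> / c"]) auto
qed (use assms in auto)

lemma frontier_halfspace_eq: "\<nu> \<noteq> 0 \<Longrightarrow> frontier (halfspace \<nu>) = {x. \<nu> \<bullet> x = 0}"
  unfolding halfspace_def by (rule frontier_halfspace_gt) auto

text \<open>The supremum is tested at \<xi> = \<nu>; as \<nu> \<bullet> y = 0 on the boundary, the
  quotient does not depend on y.\<close>

lemma F_H_dual_halfspace:
  assumes "\<nu> \<noteq> 0" "y \<in> frontier (halfspace \<nu>)"
  shows "(\<nu> \<bullet> x) / F_H m a \<nu> \<le> F_H_dual m a (x - y)"
  using F_H_dual_upper[OF assms(1), of "x - y"] assms
  by (simp add: frontier_halfspace_eq inner_diff_right inner_commute[of _ \<nu>])

lemma d_H_halfspace_lower: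
  assumes "\<nu> \<noteq> 0"
  shows "(\<nu> \<bullet> x) / F_H m a \<nu> \<le> d_H m a (halfspace \<nu>) x"
  unfolding d_H_def
proof (rule cINF_greatest)
  have "0 \<in> frontier (halfspace \<nu>)" using assms by (simp add: frontier_halfspace_eq)
  then show "frontier (halfspace \<nu>) \<noteq> {}" by blast
qed (rule F_H_dual_halfspace[OF assms])

text \<open>A hyperplane separating the sublevel set \<open>F < F(\<nu>)\<close> from \<open>\<nu>\<close> is normalised to a
  subgradient of \<open>F\<close> at \<open>\<nu>\<close>.\<close>
lemma F_H_subgradient:
  assumes "convex_on UNIV (F_H m a)" "\<nu> \<noteq> 0"
  shows "\<exists>\<eta>. (\<forall>\<xi>. \<eta> \<bullet> \<xi> \<le> F_H m a \<xi>) \<and> \<eta> \<bullet> \<nu> = F_H m a \<nu>"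
proof -
  let ?F = "F_H m a"
  have Fn: "?F \<nu> > 0" by (rule F_H_pos[OF assms(2)])
  have F0: "?F 0 = 0" using F_H_scaleR[of 0 0] by simp
  let ?S = "{\<xi>. ?F \<xi> < ?F \<nu>}"
  have "convex ?S"
    unfolding convex_def
  proof (clarify)
    fix x y and p q :: real
    assume x: "?F x < ?F \<nu>" and y: "?F y < ?F \<nu>" and pq: "0 \<le> p" "0 \<le> q" "p + q = 1"
    have "?F (p *\<^sub>R x + q *\<^sub>R y) \<le> p * ?F x + q * ?F y"
      using assms(1) pq by (auto simp: convex_on_def)
    also have "\<dots> < ?F \<nu>" by (rule convex_bound_lt[OF x y pq])
    finally show "?F (p *\<^sub>R x + q *\<^sub>R y) < ?F \<nu>" .
  qed
  moreover have "0 \<in> ?S" using F0 Fn by simp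
  ultimately obtain w b where wb: "w \<noteq> 0" "\<And>\<xi>. \<xi> \<in> ?S \<Longrightarrow> w \<bullet> \<xi> \<le> b" "b \<le> w \<bullet> \<nu>"
    using separating_hyperplane_sets[of ?S "{\<nu>}"] by auto
  \<comment> \<open>\<xi> is rescaled to the level t F(\<nu>) with t < 1, which puts it in the
    strict sublevel set; letting t tend to 1 gives the homogeneous form of the separation.\<close>
  have step: "w \<bullet> \<xi> * ?F \<nu> \<le> b * ?F \<xi>" if "\<xi> \<noteq> 0" for \<xi>
  proof (rule field_le_mult_one_interval)
    fix t :: real assume t: "0 < t" "t < 1"
    have F: "?F \<xi> > 0" by (rule F_H_pos[OF that])
    have "?F ((t * ?F \<nu> / ?F \<xi>) *\<^sub>R \<xi>) = t * ?F \<nu>" using t F Fn by (subst F_H_scaleR) auto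
    also have "\<dots> < ?F \<nu>" using t Fn by simp
    finally have "w \<bullet> ((t * ?F \<nu> / ?F \<xi>) *\<^sub>R \<xi>) \<le> b" by (intro wb(2) CollectI)
    then show "t * (w \<bullet> \<xi> * ?F \<nu>) \<le> b * ?F \<xi>" using F by (simp add: field_simps)
  qed
  \<comment> \<open>Taking \<xi> = w shows b > 0, hence w \<bullet> \<nu> \<ge> b > 0, and w can be
    rescaled to take the value F(\<nu>) at \<nu>.\<close>
  have "0 < w \<bullet> w * ?F \<nu>" using wb(1) Fn by simp
  also have "\<dots> \<le> b * ?F w" by (rule step[OF wb(1)])
  finally have b: "b > 0" using F_H_pos[OF wb(1)] by (simp add: zero_less_mult_iff)
  then have wn: "w \<bullet> \<nu> > 0" using wb(3) by simp
  let ?\<eta> = "(?F \<nu> / (w \<bullet> \<nu>)) *\<^sub>R w"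
  have "?\<eta> \<bullet> \<xi> \<le> ?F \<xi>" for \<xi>
  proof (cases "\<xi> = 0")
    case False
    have "w \<bullet> \<xi> * ?F \<nu> \<le> (w \<bullet> \<nu>) * ?F \<xi>"
      using step[OF False] mult_right_mono[OF wb(3), of "?F \<xi>"] F_H_pos[OF False] by linarith
    then show ?thesis using wn by (simp add: pos_divide_le_eq mult.commute)
  qed (simp add: F0)
  moreover have "?\<eta> \<bullet> \<nu> = ?F \<nu>" using wn by simp
  ultimately show ?thesis by blast
qed

text \<open>The subgradient \<eta> points to a nearest boundary point: with t = (\<nu> \<bullet> x)
  / F(\<nu>), the point x - t\<eta> lies on the hyperplane since \<eta> \<bullet> \<nu> = F(\<nu>),
  and \<eta> \<bullet> \<xi> \<le> F(\<xi>) bounds its distance from x by t.\<close>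

lemma d_H_halfspace_convex:
  assumes "convex_on UNIV (F_H m a)" "norm \<nu> = 1" "x \<in> halfspace \<nu>"
  shows "d_H m a (halfspace \<nu>) x = (\<nu> \<bullet> x) / F_H m a \<nu>"
proof (rule antisym)
  have nz: "\<nu> \<noteq> 0" using assms(2) by auto
  obtain \<eta> where \<eta>: "\<And>\<xi>. \<eta> \<bullet> \<xi> \<le> F_H m a \<xi>" "\<eta> \<bullet> \<nu> = F_H m a \<nu>"
    using F_H_subgradient[OF assms(1) nz] by blast
  let ?t = "(\<nu> \<bullet> x) / F_H m a \<nu>"
  have t: "?t > 0" using assms(3) F_H_pos[OF nz] by (simp add: halfspace_def)
  have fr: "x - ?t *\<^sub>R \<eta> \<in> frontier (halfspace \<nu>)"
    using F_H_pos[OF nz] \<eta>(2) by (simp add: frontier_halfspace_eq[OF nz] inner_diff_right inner_commute)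
  have "d_H m a (halfspace \<nu>) x \<le> F_H_dual m a (x - (x - ?t *\<^sub>R \<eta>))"
    unfolding d_H_def
    by (rule cINF_lower[OF _ fr]) (rule bdd_belowI2[OF F_H_dual_halfspace[OF nz]])
  also have "\<dots> \<le> ?t"
    unfolding F_H_dual_def
  proof (rule cSUP_least)
    show "{\<xi>::real^'n. \<xi> \<noteq> 0} \<noteq> {}" using nz by blast
    fix \<xi> :: "real^'n" assume "\<xi> \<in> {\<xi>. \<xi> \<noteq> 0}"
    then have F: "F_H m a \<xi> > 0" by (simp add: F_H_pos)
    have "?t * (\<eta> \<bullet> \<xi>) \<le> ?t * F_H m a \<xi>" using t \<eta>(1) by (intro mult_left_mono) auto
    moreover have "(x - (x - ?t *\<^sub>R \<eta>)) \<bullet> \<xi> = ?t * (\<eta> \<bullet> \<xi>)" by simp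
    ultimately show "(x - (x - ?t *\<^sub>R \<eta>)) \<bullet> \<xi> / F_H m a \<xi> \<le> ?t"
      using F by (simp only: pos_divide_le_eq)
  qed
  finally show "d_H m a (halfspace \<nu>) x \<le> ?t" .
  show "?t \<le> d_H m a (halfspace \<nu>) x" by (rule d_H_halfspace_lower[OF nz])
qed

end

subsection \<open>Slicing\<close>

lemma integral_swap_compact_support:
  fixes f :: "'a::euclidean_space \<times> 'b::euclidean_space \<Rightarrow> real"
  assumes "continuous_on UNIV f" "\<And>z. z \<notin> cbox c d \<Longrightarrow> f z = 0"
  shows "(LBINT x. LBINT y. f (x, y)) = (LBINT y. LBINT x. f (x, y))"
  using lborel_pair.Fubini_integral[of "\<lambda>x y. f (x, y)"] continuous_compact_support_integrable[OF assms]
  by (simp add: lborel_prod)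

text \<open>For a unit vector \<nu>, x - (\<nu> \<bullet> x)\<nu> is the orthogonal projection along
  \<nu>. The predicate thus describes functions of bounded support on the orthogonal complement of
  \<nu> without choosing coordinates there.\<close>

definition cylindrical :: "real^'n::finite \<Rightarrow> (real^'n \<Rightarrow> real) \<Rightarrow> bool" where
  "cylindrical \<nu> G \<longleftrightarrow> (\<forall>x t. G (x + t *\<^sub>R \<nu>) = G x) \<and>
     (\<exists>M. \<forall>x. G x \<noteq> 0 \<longrightarrow> norm (x - (\<nu> \<bullet> x) *\<^sub>R \<nu>) \<le> M)"

lemma cylindrical_support:
  assumes "cylindrical \<nu> G" "norm \<nu> = 1"
  shows "\<exists>R. \<forall>x. G x \<noteq> 0 \<and> \<nu> \<bullet> x \<in> {a..b} \<longrightarrow> norm x \<le> R"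
proof -
  obtain M where M: "\<And>x. G x \<noteq> 0 \<Longrightarrow> norm (x - (\<nu> \<bullet> x) *\<^sub>R \<nu>) \<le> M"
    using assms(1) by (auto simp: cylindrical_def)
  have "norm x \<le> M + max \<bar>a\<bar> \<bar>b\<bar>" if "G x \<noteq> 0" "\<nu> \<bullet> x \<in> {a..b}" for x
  proof -
    have "norm x \<le> norm (x - (\<nu> \<bullet> x) *\<^sub>R \<nu>) + norm ((\<nu> \<bullet> x) *\<^sub>R \<nu>)"
      using norm_triangle_sub by (metis add.commute)
    also have "norm ((\<nu> \<bullet> x) *\<^sub>R \<nu>) = \<bar>\<nu> \<bullet> x\<bar>" using assms(2) by simp
    also have "norm (x - (\<nu> \<bullet> x) *\<^sub>R \<nu>) + \<bar>\<nu> \<bullet> x\<bar> \<le> M + max \<bar>a\<bar> \<bar>b\<bar>"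
      using M[OF that(1)] that(2) by (auto simp: max_def)
    finally show ?thesis .
  qed
  then show ?thesis by blast
qed

text \<open>Fubini and translations replace a rotation of \<open>\<nu>\<close> to a coordinate axis.\<close>
lemma slice_integral:
  fixes G :: "real^'n::finite \<Rightarrow> real" and k \<eta> :: "real \<Rightarrow> real"
  assumes \<nu>: "norm \<nu> = 1" and G: "cylindrical \<nu> G" "continuous_on UNIV G"
    and k: "continuous_on UNIV k" "\<And>s. s \<notin> {a..b} \<Longrightarrow> k s = 0"
    and \<eta>: "continuous_on UNIV \<eta>" "\<And>s. s \<notin> {a'..b'} \<Longrightarrow> \<eta> s = 0"
  shows "(LBINT x. k (\<nu> \<bullet> x) * G x) * (LBINT s. \<eta> s) = (LBINT s. k s) * (LBINT x. \<eta> (\<nu> \<bullet> x) * G x)"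
proof -
  note cont = G(2)[THEN continuous_on_compose2, OF _ subset_UNIV] k(1)[THEN continuous_on_compose2, OF _ subset_UNIV]
    \<eta>(1)[THEN continuous_on_compose2, OF _ subset_UNIV]
  have bm: "k \<in> borel_measurable borel" "\<eta> \<in> borel_measurable borel" "G \<in> borel_measurable borel"
    using k \<eta> G by (auto intro: borel_measurable_continuous_onI)
  have \<nu>1: "\<nu> \<bullet> \<nu> = 1" using \<nu> by (simp add: dot_square_norm)
  obtain R1 where R1: "\<And>x. G x \<noteq> 0 \<Longrightarrow> \<nu> \<bullet> x \<in> {a..b} \<Longrightarrow> norm x \<le> R1"
    using cylindrical_support[OF G(1) \<nu>] by blast
  obtain R2 where R2: "\<And>x. G x \<noteq> 0 \<Longrightarrow> \<nu> \<bullet> x \<in> {a'..b'} \<Longrightarrow> norm x \<le> R2"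
    using cylindrical_support[OF G(1) \<nu>] by blast
  have box: "\<exists>c d. \<forall>z. z \<notin> cbox c d \<longrightarrow> f z = 0"
    if "\<And>x s. f (x, s) \<noteq> 0 \<Longrightarrow> norm x \<le> R \<and> \<bar>s\<bar> \<le> R'" for f :: "(real^'n) \<times> real \<Rightarrow> real" and R R'
  proof -
    have "bounded {z. f z \<noteq> 0}"
      unfolding bounded_iff
    proof (intro exI ballI)
      fix z assume "z \<in> {z. f z \<noteq> 0}"
      then show "norm z \<le> R + R'" using that[of "fst z" "snd z"] norm_Pair_le[of "fst z" "snd z"] by force
    qed
    then obtain c where "{z. f z \<noteq> 0} \<subseteq> cbox (- c) c" using bounded_subset_cbox_symmetric by blast
    then show ?thesis by blast
  qed
  have "(LBINT x. k (\<nu> \<bullet> x) * G x) * (LBINT s. \<eta> s) = (LBINT x. LBINT s. k (\<nu> \<bullet> x) * G x * \<eta> s)"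
    by simp
  \<comment> \<open>Shifting s by \<nu> \<bullet> x couples the two variables; after the swap the
    coupling can be moved from \<eta> to k.\<close>
  also have "\<dots> = (LBINT x. LBINT s. k (\<nu> \<bullet> x) * G x * \<eta> (\<nu> \<bullet> x + s))"
  proof (rule Bochner_Integration.integral_cong[OF refl])
    fix x
    show "(LBINT s. k (\<nu> \<bullet> x) * G x * \<eta> s) = (LBINT s. k (\<nu> \<bullet> x) * G x * \<eta> (\<nu> \<bullet> x + s))"
      using integral_lborel_affine[of \<eta> 1 "\<nu> \<bullet> x"] bm by simp
  qed
  also have "\<dots> = (LBINT s. LBINT x. k (\<nu> \<bullet> x) * G x * \<eta> (\<nu> \<bullet> x + s))"
  proof -
    let ?f = "\<lambda>(x, s). k (\<nu> \<bullet> x) * G x * \<eta> (\<nu> \<bullet> x + s)"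
    have "\<exists>c d. \<forall>z. z \<notin> cbox c d \<longrightarrow> ?f z = 0"
    proof (rule box)
      fix x s assume "?f (x, s) \<noteq> 0"
      then have "\<nu> \<bullet> x \<in> {a..b}" "\<nu> \<bullet> x + s \<in> {a'..b'}" "G x \<noteq> 0" using k(2) \<eta>(2) by force+
      then show "norm x \<le> R1 \<and> \<bar>s\<bar> \<le> \<bar>a\<bar> + \<bar>b\<bar> + \<bar>a'\<bar> + \<bar>b'\<bar>" using R1 by auto
    qed
    then obtain c d where cd: "\<And>z. z \<notin> cbox c d \<Longrightarrow> ?f z = 0" by blast
    show ?thesis
      using integral_swap_compact_support[of ?f c d, OF _ cd]
      by (simp add: case_prod_beta continuous_intros cont)
  qed
  \<comment> \<open>Translating x by -s\<nu> changes \<nu> \<bullet> x by -s and leaves G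
    alone.\<close>
  also have "\<dots> = (LBINT s. LBINT x. k (\<nu> \<bullet> x - s) * G x * \<eta> (\<nu> \<bullet> x))"
  proof (rule Bochner_Integration.integral_cong[OF refl])
    fix s
    have "G (- (s *\<^sub>R \<nu>) + x) = G x" for x
      using G(1) unfolding cylindrical_def by (metis add.commute scaleR_minus_left)
    then show "(LBINT x. k (\<nu> \<bullet> x) * G x * \<eta> (\<nu> \<bullet> x + s)) = (LBINT x. k (\<nu> \<bullet> x - s) * G x * \<eta> (\<nu> \<bullet> x))"
      using bm by (subst integral_lborel_affine[where c = 1 and t = "- (s *\<^sub>R \<nu>)"])
        (auto simp: inner_add_right inner_diff_right \<nu>1 algebra_simps)
  qed
  also have "\<dots> = (LBINT x. LBINT s. k (\<nu> \<bullet> x - s) * G x * \<eta> (\<nu> \<bullet> x))"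
  proof -
    let ?f = "\<lambda>(x, s). k (\<nu> \<bullet> x - s) * G x * \<eta> (\<nu> \<bullet> x)"
    have "\<exists>c d. \<forall>z. z \<notin> cbox c d \<longrightarrow> ?f z = 0"
    proof (rule box)
      fix x s assume "?f (x, s) \<noteq> 0"
      then have "\<nu> \<bullet> x - s \<in> {a..b}" "\<nu> \<bullet> x \<in> {a'..b'}" "G x \<noteq> 0" using k(2) \<eta>(2) by force+
      then show "norm x \<le> R2 \<and> \<bar>s\<bar> \<le> \<bar>a\<bar> + \<bar>b\<bar> + \<bar>a'\<bar> + \<bar>b'\<bar>" using R2 by auto
    qed
    then obtain c d where cd: "\<And>z. z \<notin> cbox c d \<Longrightarrow> ?f z = 0" by blast
    show ?thesis
      using integral_swap_compact_support[of ?f c d, OF _ cd]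
      by (simp add: case_prod_beta continuous_intros cont)
  qed
  also have "\<dots> = (LBINT x. (LBINT s. k s) * (\<eta> (\<nu> \<bullet> x) * G x))"
  proof (rule Bochner_Integration.integral_cong[OF refl])
    fix x
    have "(LBINT s. k s) = (LBINT s. k (\<nu> \<bullet> x - s))"
      using integral_lborel_affine[of k "- 1" "\<nu> \<bullet> x"] bm by simp
    then show "(LBINT s. k (\<nu> \<bullet> x - s) * G x * \<eta> (\<nu> \<bullet> x)) = (LBINT s. k s) * (\<eta> (\<nu> \<bullet> x) * G x)"
      by (simp add: mult.assoc mult.commute[of "G x"])
  qed
  finally show ?thesis by simp
qed

lemma integral_pos_compact_support:
  fixes f :: "'a::euclidean_space \<Rightarrow> real"
  assumes "continuous_on UNIV f" "\<And>x. x \<notin> cbox c d \<Longrightarrow> f x = 0" "\<And>x. f x \<ge> 0" "f p > 0"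
  shows "0 < (LBINT x. f x)"
proof -
  have int: "integrable lborel f" by (rule continuous_compact_support_integrable[OF assms(1,2)])
  have "bounded (insert p (cbox c d))" by simp
  then obtain e where e: "insert p (cbox c d) \<subseteq> box (- e) e"
    using bounded_subset_box_symmetric by blast
  then have e': "insert p (cbox c d) \<subseteq> cbox (- e) e" using box_subset_cbox by blast
  have "(LBINT x. f x) = integral UNIV f" by (rule integral_lborel[OF int, symmetric])
  also have "\<dots> = integral (cbox (- e) e) f"
    by (rule integral_eq_UNIV[symmetric]) (use assms(2) e' in auto)
  finally have eq: "(LBINT x. f x) = integral (cbox (- e) e) f" .
  have "integral (cbox (- e) e) f \<noteq> 0"
    using integral_cbox_eq_0_iff[of "- e" e f] assms e e' by (metis continuous_on_subset empty_iff insert_subset less_irrefl subset_UNIV)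
  moreover have "(LBINT x. f x) \<ge> 0" using assms(3) by simp
  ultimately show ?thesis using eq by simp
qed

text \<open>T G plays the role of the integral of G over the hyperplane through 0, without a measure
  on it. By \<open>slice_integral\<close> the ratio of the integral of k(\<nu> \<bullet> x) G(x) to
  that of k is the same for all profiles k of nonzero integral, so one fixed bump serves to define
  it.\<close>

lemma ex_slice_functional:
  assumes \<nu>: "norm (\<nu>::real^'n::finite) = 1"
  shows "\<exists>T. (\<forall>G k a b e. cylindrical \<nu> G \<longrightarrow> continuous_on UNIV G \<longrightarrow> continuous_on UNIV k \<longrightarrow>
        (\<forall>s. s \<notin> {a..b} \<longrightarrow> k s = 0) \<longrightarrow> e > 0 \<longrightarrow>
        (LBINT x. k (\<nu> \<bullet> x / e) * G x) = e * (LBINT s. k s) * T G) \<and>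
      (\<forall>G p. cylindrical \<nu> G \<longrightarrow> continuous_on UNIV G \<longrightarrow> (\<forall>x. G x \<ge> 0) \<longrightarrow> G p > 0 \<longrightarrow> T G > 0)"
proof -
  obtain \<eta> where \<eta>: "smooth1 \<eta>" "\<And>x. \<eta> x \<ge> 0" "\<And>x. x \<in> {-1<..<1} \<Longrightarrow> \<eta> x > 0"
      "\<And>x. x \<notin> {-1<..<1} \<Longrightarrow> \<eta> x = 0"
    using ex_bump[of "- 1" 1] by auto
  have \<eta>c: "continuous_on UNIV \<eta>" by (rule smooth1_continuous[OF \<eta>(1)])
  have \<eta>0: "\<eta> s = 0" if "s \<notin> {-1..1}" for s using \<eta>(4)[of s] that by auto
  have E: "0 < (LBINT s. \<eta> s)"
    by (rule integral_pos_compact_support[of _ "-1" 1 0]) (use \<eta> \<eta>0 \<eta>c in auto)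
  define T where "T = (\<lambda>G. (LBINT x. \<eta> (\<nu> \<bullet> x) * G x) / (LBINT s. \<eta> s))"
  show ?thesis
  proof (intro exI[of _ T] conjI allI impI)
    fix G and k :: "real \<Rightarrow> real" and a b e :: real
    assume G: "cylindrical \<nu> G" "continuous_on UNIV G" and k: "continuous_on UNIV k" "\<forall>s. s \<notin> {a..b} \<longrightarrow> k s = 0"
      and e: "e > 0"
    have bm: "k \<in> borel_measurable borel" using k(1) by (rule borel_measurable_continuous_onI)
    have kc: "continuous_on UNIV (\<lambda>s. k (s / e))"
      by (rule continuous_on_compose2[OF k(1)]) (use e in \<open>auto intro!: continuous_intros\<close>)
    have "(LBINT x. k (\<nu> \<bullet> x / e) * G x) * (LBINT s. \<eta> s) = (LBINT s. k (s / e)) * (LBINT x. \<eta> (\<nu> \<bullet> x) * G x)"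
      by (rule slice_integral[OF \<nu> G kc _ \<eta>c, of "e * a" "e * b" "-1" 1])
         (use k(2) e \<eta>0 in \<open>auto simp: field_simps\<close>)
    also have "(LBINT s. k (s / e)) = e * (LBINT s. k s)"
      using integral_lborel_affine[of "\<lambda>s. k (s / e)" e 0] e bm by simp
    finally show "(LBINT x. k (\<nu> \<bullet> x / e) * G x) = e * (LBINT s. k s) * T G"
      using E by (simp add: T_def field_simps)
  next
    fix G p assume G: "cylindrical \<nu> G" "continuous_on UNIV G" "\<forall>x. G x \<ge> 0" "G p > 0"
    obtain R where R: "\<And>x. G x \<noteq> 0 \<Longrightarrow> \<nu> \<bullet> x \<in> {-1..1} \<Longrightarrow> norm x \<le> R"
      using cylindrical_support[OF G(1) \<nu>] by blast
    have "bounded {x. \<eta> (\<nu> \<bullet> x) * G x \<noteq> 0}"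
      unfolding bounded_iff using R \<eta>0 by (intro exI[of _ R]) force
    then obtain c where c: "{x. \<eta> (\<nu> \<bullet> x) * G x \<noteq> 0} \<subseteq> cbox (- c) c" using bounded_subset_cbox_symmetric by blast
    \<comment> \<open>G is constant along \<nu>, so p may be moved to the hyperplane, where the
      fixed bump is positive.\<close>
    let ?q = "p + (- (\<nu> \<bullet> p)) *\<^sub>R \<nu>"
    have "\<nu> \<bullet> ?q = 0" using \<nu> by (simp add: inner_add_right inner_diff_right dot_square_norm)
    moreover have "G ?q > 0" using G(1,4) unfolding cylindrical_def by metis
    ultimately have "\<eta> (\<nu> \<bullet> ?q) * G ?q > 0" using \<eta>(3)[of 0] by simp
    then have "0 < (LBINT x. \<eta> (\<nu> \<bullet> x) * G x)"
      using c G(3) \<eta>(2)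
      by (intro integral_pos_compact_support[of _ "- c" c ?q] continuous_intros G(2)
          continuous_on_compose2[OF \<eta>c]) auto
    then show "T G > 0" using E by (simp add: T_def)
  qed
qed

text \<open>The power s^\<alpha> modulated in the logarithmic variable. For g of compact support it
  vanishes near s = 0, so a smooth g gives a function that is smooth on the whole line.\<close>

definition mellin :: "real \<Rightarrow> (real \<Rightarrow> real) \<Rightarrow> real \<Rightarrow> real" where
  "mellin \<alpha> g s = (if s > 0 then s powr \<alpha> * g (ln s) else 0)"

subsection \<open>Sharpness in dimension one\<close>

lemma mem_exp_interval_iff:
  assumes "\<delta> > 0"
  shows "s \<in> {exp (- R / \<delta>)..exp (R / \<delta>)} \<longleftrightarrow> s > 0 \<and> \<delta> * ln s \<in> {- R..R::real}"
proof (cases "s > 0")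
  case True
  have "exp (- R / \<delta>) \<le> s \<longleftrightarrow> - R / \<delta> \<le> ln s" using ln_ge_iff[OF True] by blast
  moreover have "s \<le> exp (R / \<delta>) \<longleftrightarrow> ln s \<le> R / \<delta>"
    using ln_le_cancel_iff[OF True exp_gt_zero, of "R / \<delta>"] by simp
  moreover have "- R / \<delta> \<le> ln s \<longleftrightarrow> - R \<le> \<delta> * ln s" "ln s \<le> R / \<delta> \<longleftrightarrow> \<delta> * ln s \<le> R"
    using assms by (simp_all only: pos_divide_le_eq pos_le_divide_eq mult.commute)
  ultimately show ?thesis using True by (simp only: atLeastAtMost_iff simp_thms)
next
  case False
  then show ?thesis using exp_gt_zero[of "- R / \<delta>"] by (auto simp: not_less dest: order_trans)
qed

lemma mellin_outside:
  assumes "\<And>t. t \<notin> {- R..R} \<Longrightarrow> g t = 0" "s \<notin> {exp (- R)..exp R}"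
  shows "mellin \<alpha> g s = 0"
proof (cases "s > 0")
  case True
  have "ln s \<notin> {- R..R}"
    using assms(2) True mem_exp_interval_iff[of 1 s R] by auto
  then show ?thesis by (simp add: mellin_def assms(1))
qed (simp add: mellin_def)

text \<open>On s > 0 a derivative lowers the power by one and acts on g as \<alpha> + d/dt, so the
  shape is preserved. For s \<le> 0 the function is zero in a neighbourhood, because g vanishes
  below -R.\<close>

lemma mellin_DERIV:
  assumes "smooth1 g" "\<And>t. t \<notin> {- R..R} \<Longrightarrow> g t = 0"
  shows "(mellin \<alpha> g has_real_derivative mellin (\<alpha> - 1) (\<lambda>t. \<alpha> * g t + deriv g t) s) (at s)"
proof (cases "s > 0")
  case True
  have 1: "((\<lambda>s. s powr \<alpha>) has_real_derivative \<alpha> * s powr (\<alpha> - 1)) (at s)"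
    by (rule has_real_derivative_powr[OF True])
  have "(ln has_real_derivative 1 / s) (at s)" using DERIV_ln_divide[OF True] .
  from DERIV_mult[OF 1 DERIV_chain2[OF smooth1_DERIV[OF assms(1)] this]]
  have "((\<lambda>s. s powr \<alpha> * g (ln s)) has_real_derivative
      \<alpha> * s powr (\<alpha> - 1) * g (ln s) + deriv g (ln s) * (1 / s) * s powr \<alpha>) (at s)" .
  moreover have "\<alpha> * s powr (\<alpha> - 1) * g (ln s) + deriv g (ln s) * (1 / s) * s powr \<alpha> =
      mellin (\<alpha> - 1) (\<lambda>t. \<alpha> * g t + deriv g t) s"
    using True by (simp add: mellin_def powr_diff field_simps)
  ultimately have "((\<lambda>s. s powr \<alpha> * g (ln s)) has_real_derivative mellin (\<alpha> - 1) (\<lambda>t. \<alpha> * g t + deriv g t) s) (at s)"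
    by (simp only:)
  then show ?thesis
    by (rule has_field_derivative_transform_within_open[of _ _ _ "{0<..}"]) (use True in \<open>auto simp: mellin_def\<close>)
next
  case False
  have "(mellin \<alpha> g has_real_derivative 0) (at s)"
  proof (rule has_field_derivative_transform_within_open[of "\<lambda>_. 0" 0 _ "{..<exp (- R)}"])
    show "s \<in> {..<exp (- R)}" using False less_le_trans[OF exp_gt_zero, of "- R"] by (auto simp: not_less intro: le_less_trans[OF _ exp_gt_zero])
  next
    fix t assume "t \<in> {..<exp (- R)}"
    then show "0 = mellin \<alpha> g t" using mellin_outside[where R = R and g = g and s = t, OF assms(2)] by simp
  qed auto
  then show ?thesis using False by (simp add: mellin_def)
qed

definition bumps :: "real \<Rightarrow> (real \<Rightarrow> real) set" where
  "bumps R = {g. smooth1 g \<and> (\<forall>t. t \<notin> {- R..R} \<longrightarrow> g t = 0)}"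

lemma bumps_deriv: "g \<in> bumps R \<Longrightarrow> deriv g \<in> bumps R"
  using higher_deriv_outside[of "- R" R g _ 1] by (auto simp: bumps_def intro: smooth1_deriv)

lemma bumps_add: "g \<in> bumps R \<Longrightarrow> h \<in> bumps R \<Longrightarrow> (\<lambda>t. g t + h t) \<in> bumps R"
  by (auto simp: bumps_def intro: smooth1_add)

lemma bumps_cmult: "g \<in> bumps R \<Longrightarrow> (\<lambda>t. c * g t) \<in> bumps R"
  by (auto simp: bumps_def intro: smooth1_mult smooth1_const)

lemma bumps_sum: "(\<And>j. f j \<in> bumps R) \<Longrightarrow> (\<lambda>t. \<Sum>j\<le>(k::nat). f j t) \<in> bumps R"
  by (induction k) (auto intro: bumps_add)

lemma deriv_mellin: "g \<in> bumps R \<Longrightarrow> deriv (mellin \<alpha> g) = mellin (\<alpha> - 1) (\<lambda>t. \<alpha> * g t + deriv g t)"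
  by (intro ext DERIV_imp_deriv mellin_DERIV[where R = R]) (auto simp: bumps_def)

lemma smooth1_mellin:
  assumes "g \<in> bumps R" shows "smooth1 (mellin \<alpha> g)"
proof (rule smooth1_family[where C = "{mellin \<alpha> g | \<alpha> g. g \<in> bumps R}"])
  fix h assume "h \<in> {mellin \<alpha> g | \<alpha> g. g \<in> bumps R}"
  then obtain \<alpha> g where h: "h = mellin \<alpha> g" and g: "g \<in> bumps R" by blast
  have "(h has_real_derivative mellin (\<alpha> - 1) (\<lambda>t. \<alpha> * g t + deriv g t) x) (at x)" for x
    unfolding h using g by (intro mellin_DERIV[where R = R]) (auto simp: bumps_def)
  moreover have "mellin (\<alpha> - 1) (\<lambda>t. \<alpha> * g t + deriv g t) \<in> {mellin \<alpha> g | \<alpha> g. g \<in> bumps R}"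
    using bumps_add[OF bumps_cmult[OF g] bumps_deriv[OF g]] by blast
  ultimately show "\<exists>h'\<in>{mellin \<alpha> g | \<alpha> g. g \<in> bumps R}. \<forall>x. (h has_real_derivative h' x) (at x)" by blast
qed (use assms in blast)

text \<open>Iterating \<open>mellin_DERIV\<close> applies the product of the operators \<alpha> - i
  + d/dt to G(\<delta> t), and each d/dt brings out a factor \<delta>. The coefficients are fixed
  before \<delta>, which later permits \<delta> -> 0; \<open>c 0\<close> collects the term without
  derivatives.\<close>

lemma higher_deriv_mellin:
  assumes "smooth1 G"
  shows "\<exists>c::nat \<Rightarrow> real. c 0 = (\<Prod>i<k. \<alpha> - real i) \<and>
    (\<forall>\<delta> R. (\<lambda>t. G (\<delta> * t)) \<in> bumps R \<longrightarrow> (deriv ^^ k) (mellin \<alpha> (\<lambda>t. G (\<delta> * t))) =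
       mellin (\<alpha> - real k) (\<lambda>t. \<Sum>j\<le>k. c j * \<delta> ^ j * (deriv ^^ j) G (\<delta> * t)))"
proof (induction k)
  case 0
  then show ?case by (intro exI[of _ "\<lambda>_. 1"]) simp
next
  case (Suc k)
  then obtain c where c0: "c 0 = (\<Prod>i<k. \<alpha> - real i)" and
    c: "\<And>\<delta> R. (\<lambda>t. G (\<delta> * t)) \<in> bumps R \<Longrightarrow> (deriv ^^ k) (mellin \<alpha> (\<lambda>t. G (\<delta> * t))) =
       mellin (\<alpha> - real k) (\<lambda>t. \<Sum>j\<le>k. c j * \<delta> ^ j * (deriv ^^ j) G (\<delta> * t))" by blast
  \<comment> \<open>The coefficients of the polynomial with coefficients c after multiplication by
    (\<alpha> - k) + X.\<close>
  define c' where "c' = (\<lambda>j. (\<alpha> - real k) * (if j \<le> k then c j else 0) + (if j = 0 then 0 else c (j - 1)))"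
  have "(deriv ^^ Suc k) (mellin \<alpha> (\<lambda>t. G (\<delta> * t))) =
       mellin (\<alpha> - real (Suc k)) (\<lambda>t. \<Sum>j\<le>Suc k. c' j * \<delta> ^ j * (deriv ^^ j) G (\<delta> * t))"
    if B: "(\<lambda>t. G (\<delta> * t)) \<in> bumps R" for \<delta> R
  proof -
    let ?S = "\<lambda>t. \<Sum>j\<le>k. c j * \<delta> ^ j * (deriv ^^ j) G (\<delta> * t)"
    let ?S' = "\<lambda>t. \<Sum>j\<le>k. c j * \<delta> ^ Suc j * (deriv ^^ Suc j) G (\<delta> * t)"
    have DG: "((\<lambda>t. (deriv ^^ j) G (\<delta> * t)) has_real_derivative (deriv ^^ Suc j) G (\<delta> * t) * \<delta>) (at t)" for j t
    proof -
      have "((\<lambda>t. \<delta> * t) has_real_derivative \<delta>) (at t)" by (auto intro!: derivative_eq_intros)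
      from DERIV_chain2[OF smooth1_DERIV'[OF assms] this] show ?thesis by simp
    qed
    have scaled: "(\<lambda>t. \<delta> ^ j * (deriv ^^ j) G (\<delta> * t)) = (deriv ^^ j) (\<lambda>t. G (\<delta> * t))" for j
    proof (induction j)
      case (Suc j)
      have "deriv (\<lambda>t. \<delta> ^ j * (deriv ^^ j) G (\<delta> * t)) t = \<delta> ^ Suc j * (deriv ^^ Suc j) G (\<delta> * t)" for t
        by (rule DERIV_imp_deriv) (use DERIV_cmult[OF DG, of "\<delta> ^ j" j t] in \<open>simp add: mult_ac\<close>)
      then show ?case using Suc by (simp add: fun_eq_iff)
    qed simp
    have "(deriv ^^ j) (\<lambda>t. G (\<delta> * t)) \<in> bumps R" for j
      by (induction j) (use B bumps_deriv in auto)
    then have "(\<lambda>t. c j * (\<delta> ^ j * (deriv ^^ j) G (\<delta> * t))) \<in> bumps R" for j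
      by (rule bumps_cmult[of "\<lambda>t. \<delta> ^ j * (deriv ^^ j) G (\<delta> * t)", unfolded scaled[of j]]) 
    from bumps_sum[OF this] have SB: "?S \<in> bumps R" by (simp only: mult.assoc)
    have dS: "deriv ?S t = ?S' t" for t
    proof (intro DERIV_imp_deriv DERIV_sum)
      fix j
      show "((\<lambda>t. c j * \<delta> ^ j * (deriv ^^ j) G (\<delta> * t)) has_real_derivative
          c j * \<delta> ^ Suc j * (deriv ^^ Suc j) G (\<delta> * t)) (at t)"
        by (rule DERIV_cong[OF DERIV_cmult[OF DG]]) (simp add: mult_ac)
    qed
    have "(deriv ^^ Suc k) (mellin \<alpha> (\<lambda>t. G (\<delta> * t))) =
        mellin (\<alpha> - real k - 1) (\<lambda>t. (\<alpha> - real k) * ?S t + ?S' t)"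
      using c[OF B] deriv_mellin[OF SB, of "\<alpha> - real k"] by (simp add: dS)
    also have "(\<lambda>t. (\<alpha> - real k) * ?S t + ?S' t) = (\<lambda>t. \<Sum>j\<le>Suc k. c' j * \<delta> ^ j * (deriv ^^ j) G (\<delta> * t))"
    proof
      fix t
      have 1: "(\<Sum>j\<le>Suc k. (if j = 0 then 0 else c (j - 1)) * \<delta> ^ j * (deriv ^^ j) G (\<delta> * t)) = ?S' t"
        by (subst sum.atMost_Suc_shift) simp
      have 2: "(\<Sum>j\<le>Suc k. (\<alpha> - real k) * (if j \<le> k then c j else 0) * \<delta> ^ j * (deriv ^^ j) G (\<delta> * t)) = (\<alpha> - real k) * ?S t"
        by (simp add: sum_distrib_left mult.assoc)
      show "(\<alpha> - real k) * ?S t + ?S' t = (\<Sum>j\<le>Suc k. c' j * \<delta> ^ j * (deriv ^^ j) G (\<delta> * t))"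
        unfolding 1[symmetric] 2[symmetric] c'_def sum.distrib[symmetric] by (simp only: distrib_right)
    qed
    finally show ?thesis by (simp add: algebra_simps)
  qed
  moreover have "c' 0 = (\<Prod>i<Suc k. \<alpha> - real i)" by (simp add: c'_def c0)
  ultimately show ?case by (intro exI[of _ c'] conjI allI impI)
qed

text \<open>Under t = \<delta> ln s the measure ds / s becomes dt / \<delta>, and the support of f
  confines s to a compact interval away from 0.\<close>

lemma log_substitution:
  fixes f :: "real \<Rightarrow> real"
  assumes f: "continuous_on UNIV f" "\<And>t. t \<notin> {- R..R} \<Longrightarrow> f t = 0" and \<delta>: "\<delta> > 0" and R: "R > 0"
  shows "(LBINT s. if s > 0 then f (\<delta> * ln s) / s else 0) = (1 / \<delta>) * (LBINT t. f t)"
proof -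
  define a b where "a = exp (- R / \<delta>)" and "b = exp (R / \<delta>)"
  have ab: "0 < a" "a < b" unfolding a_def b_def using divide_strict_right_mono[of "- R" R \<delta>] R \<delta> by auto
  let ?h = "\<lambda>s. if s > 0 then f (\<delta> * ln s) / s else 0"
  have h0: "?h s = 0" if "s \<notin> {a..b}" for s
  proof (cases "s > 0")
    case True
    have "\<delta> * ln s \<notin> {- R..R}"
      using that True mem_exp_interval_iff[OF \<delta>] unfolding a_def b_def by blast
    then show ?thesis using f(2) by simp
  qed simp
  have "((\<lambda>s. (\<delta> / s) *\<^sub>R f (\<delta> * ln s)) has_integral (integral {\<delta> * ln a..\<delta> * ln b} f)) {a..b}"
  proof (rule has_integral_substitution[where c = "- R" and d = R])
    show "(\<lambda>s. \<delta> * ln s) ` {a..b} \<subseteq> {- R..R}"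
      using mem_exp_interval_iff[OF \<delta>] unfolding a_def b_def by blast
    show "continuous_on {- R..R} f" using f(1) continuous_on_subset by blast
    show "((\<lambda>s. \<delta> * ln s) has_real_derivative \<delta> / s) (at s within {a..b})" if "s \<in> {a..b}" for s
      using DERIV_cmult[OF DERIV_ln_divide[of s], of \<delta>] that ab
      by (auto intro: has_field_derivative_at_within)
  qed (use ab \<delta> in auto)
  then have 1: "integral {a..b} (\<lambda>s. (\<delta> / s) *\<^sub>R f (\<delta> * ln s)) = integral {- R..R} f"
    using \<delta> by (simp add: a_def b_def integral_unique)
  have h: "integrable lborel ?h"
  proof -
    have "integrable lborel (\<lambda>s. indicator {a..b} s *\<^sub>R (f (\<delta> * ln s) / s))"
      by (rule borel_integrable_compact)
         (use ab in \<open>auto intro!: continuous_intros continuous_on_compose2[OF f(1)]\<close>)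
    moreover have "(\<lambda>s. indicator {a..b} s *\<^sub>R (f (\<delta> * ln s) / s)) = ?h"
    proof
      show "indicator {a..b} s *\<^sub>R (f (\<delta> * ln s) / s) = ?h s" for s
        using h0[of s] ab by (cases "s \<in> {a..b}") auto
    qed
    ultimately show ?thesis by simp
  qed
  have "(LBINT s. ?h s) = integral UNIV ?h" by (rule integral_lborel[OF h, symmetric])
  also have "\<dots> = integral {a..b} (\<lambda>s. (1 / \<delta>) * ((\<delta> / s) *\<^sub>R f (\<delta> * ln s)))"
    unfolding integral_restrict_UNIV[symmetric, of "{a..b}"]
    using h0 ab \<delta> by (intro arg_cong[where f = "integral UNIV"] ext) auto
  also have "\<dots> = (1 / \<delta>) * integral {- R..R} f" by (simp only: integral_mult_right 1)
  also have "integral {- R..R} f = integral UNIV f" by (rule integral_eq_UNIV[OF f(2)])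
  also have "\<dots> = (LBINT t. f t)"
    by (intro integral_lborel continuous_compact_support_integrable[OF f(1), of "- R" R]) (use f(2) in auto)
  finally show ?thesis .
qed


text \<open>The factors run through m - 1/2, ..., 1/2 and then -1/2, ..., -(m - 1/2): the second
  half repeats the first with opposite signs, in reverse order.\<close>

lemma prod_shifted_half: "(\<Prod>i<2 * m. real m - 1 / 2 - real i) = (- 1) ^ m * A_const m"
proof -
  have "(\<Prod>i<2 * m. real m - 1 / 2 - real i) =
      (\<Prod>i<m. real m - 1 / 2 - real i) * (\<Prod>i=m..<2 * m. real m - 1 / 2 - real i)"
    by (metis lessThan_atLeast0 prod.atLeastLessThan_concat le0 mult_2 le_add1)
  also have "(\<Prod>i<m. real m - 1 / 2 - real i) = (\<Prod>j<m. real j + 1 / 2)"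
    by (subst prod.nat_diff_reindex[symmetric]) (auto intro!: prod.cong simp: of_nat_diff)
  also have "(\<Prod>i=m..<2 * m. real m - 1 / 2 - real i) = (\<Prod>j<m. - (real j + 1 / 2))"
    using prod.shift_bounds_nat_ivl[of "\<lambda>i. real m - 1 / 2 - real i" 0 m m]
    by (auto simp: mult_2 lessThan_atLeast0 intro!: prod.cong)
  also have "\<dots> = (- 1) ^ m * (\<Prod>j<m. real j + 1 / 2)"
    unfolding mult_minus1[symmetric, of "real _ + 1 / 2"] prod.distrib by simp
  also have "(\<Prod>j<m. real j + 1 / 2) * ((- 1) ^ m * (\<Prod>j<m. real j + 1 / 2)) =
      (- 1) ^ m * (\<Prod>j<m. (real j + 1 / 2)\<^sup>2)"
    by (simp add: power2_eq_square prod.distrib)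
  also have "(\<Prod>j<m. (real j + 1 / 2)\<^sup>2) = A_const m"
    unfolding A_const_eq by (intro prod.cong) (auto simp: field_simps)
  finally show ?thesis .
qed

text \<open>For the trial function \<open>mellin \<alpha> (\<lambda>t. G (\<delta> * t))\<close> the
  difference of the two sides is p(\<delta>) / \<delta> with a polynomial p. Its value p(0) = (A(m)
  - C) \<open>J 0\<close> is negative, so every small \<delta> > 0 will do.\<close>

lemma hardy_rellich_sharp_1:
  assumes "C > A_const m"
  shows "\<exists>\<psi> a b. 0 < a \<and> smooth1 \<psi> \<and> (\<forall>s. s \<notin> {a..b} \<longrightarrow> \<psi> s = 0) \<and> 
    (- 1) ^ m * (LBINT s. (deriv ^^ (2 * m)) \<psi> s * \<psi> s) < C * (LBINT s. (\<psi> s)\<^sup>2 / s ^ (2 * m))"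
proof -
  obtain G where G: "smooth1 G" "\<And>x. x \<in> {-1<..<1} \<Longrightarrow> G x > 0" "\<And>x. x \<notin> {-1<..<1} \<Longrightarrow> G x = 0"
    using ex_bump[of "- 1" 1] by auto
  have G0: "G x = 0" if "x \<notin> {-1..1}" for x using G(3)[of x] that by auto
  note Gc = smooth1_continuous[OF smooth1_higher_deriv[OF G(1)], of UNIV]
  have Gc0: "continuous_on UNIV G" using Gc[of 0] by simp
  \<comment> \<open>Chosen so that 2\<alpha> - 2m = -1: both integrands then become functions of
    \<delta> ln s times 1/s.\<close>
  define \<alpha> where "\<alpha> = real m - 1 / 2"
  obtain c where c0: "c 0 = (\<Prod>i<2 * m. \<alpha> - real i)" and
    c: "\<And>\<delta> R. (\<lambda>t. G (\<delta> * t)) \<in> bumps R \<Longrightarrow> (deriv ^^ (2 * m)) (mellin \<alpha> (\<lambda>t. G (\<delta> * t))) =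
       mellin (\<alpha> - real (2 * m)) (\<lambda>t. \<Sum>j\<le>2 * m. c j * \<delta> ^ j * (deriv ^^ j) G (\<delta> * t))"
    using higher_deriv_mellin[OF G(1), where k = "2 * m" and \<alpha> = \<alpha>] by blast
  define J where "J = (\<lambda>j. LBINT t. (deriv ^^ j) G t * G t)"
  define p where "p = (\<lambda>\<delta>. (- 1) ^ m * (\<Sum>j\<le>2 * m. c j * \<delta> ^ j * J j) - C * J 0)"
  have J0: "J 0 > 0" unfolding J_def
    by (rule integral_pos_compact_support[of _ "-1" 1 0]) (use G0 G(2)[of 0] Gc0 in \<open>auto intro!: continuous_intros\<close>)
  have "p 0 = (A_const m - C) * J 0"
  proof -
    have "(\<Sum>j\<le>2 * m. c j * 0 ^ j * J j) = c 0 * J 0"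
      by (subst sum.atMost_shift) (simp add: power_0_left)
    moreover have "(- 1) ^ m * c 0 = A_const m"
      unfolding c0 \<alpha>_def prod_shifted_half by (simp add: mult.assoc[symmetric] power_mult_distrib[symmetric])
    ultimately show ?thesis by (simp add: p_def algebra_simps)
  qed
  then have "p 0 < 0" using assms J0 by (simp add: mult_neg_pos)
  moreover have "isCont p 0" unfolding p_def by (intro continuous_intros)
  ultimately have "eventually (\<lambda>\<delta>. p \<delta> < 0) (at 0)"
    unfolding isCont_def by (rule order_tendstoD(2)[rotated])
  then have "eventually (\<lambda>\<delta>. p \<delta> < 0) (at_right 0)"
    by (rule eventually_at_split[THEN iffD1, THEN conjunct2])
  then obtain b' where b': "b' > 0" "\<And>\<delta>. 0 < \<delta> \<Longrightarrow> \<delta> < b' \<Longrightarrow> p \<delta> < 0"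
    unfolding eventually_at_right_field by blast
  define \<delta> where "\<delta> = b' / 2"
  have \<delta>: "\<delta> > 0" "p \<delta> < 0" using b' by (auto simp: \<delta>_def)
  let ?g = "\<lambda>t. G (\<delta> * t)"
  define \<psi> where "\<psi> = mellin \<alpha> ?g"
  have B: "?g \<in> bumps (1 / \<delta>)"
    using smooth1_affine[OF G(1), of \<delta> 0] G0 \<delta> by (auto simp: bumps_def field_simps)
  have pw: "s powr \<alpha> * s powr \<alpha> = s ^ (2 * m) / s" "s powr (\<alpha> - real (2 * m)) * s powr \<alpha> = 1 / s" if "s > 0" for s
  proof -
    have "s powr \<alpha> * s powr \<alpha> = s powr (real (2 * m) - 1)" by (simp add: \<alpha>_def powr_add[symmetric])
    then show 1: "s powr \<alpha> * s powr \<alpha> = s ^ (2 * m) / s" using that by (simp only: powr_diff powr_realpow powr_one)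
    show "s powr (\<alpha> - real (2 * m)) * s powr \<alpha> = 1 / s"
      using that 1 by (simp only: powr_diff powr_realpow) (simp add: field_simps)
  qed
  have "(LBINT s. (\<psi> s)\<^sup>2 / s ^ (2 * m)) = (LBINT s. if s > 0 then (G (\<delta> * ln s) * G (\<delta> * ln s)) / s else 0)"
  proof (rule Bochner_Integration.integral_cong[OF refl])
    fix s
    show "(\<psi> s)\<^sup>2 / s ^ (2 * m) = (if s > 0 then (G (\<delta> * ln s) * G (\<delta> * ln s)) / s else 0)"
    proof (cases "s > 0")
      case True
      have "(\<psi> s)\<^sup>2 = (s powr \<alpha> * s powr \<alpha>) * (G (\<delta> * ln s) * G (\<delta> * ln s))"
        using True by (simp add: \<psi>_def mellin_def power2_eq_square mult_ac)
      then show ?thesis using True by (simp add: pw(1)[OF True])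
    qed (simp add: \<psi>_def mellin_def)
  qed
  also have "\<dots> = (1 / \<delta>) * (LBINT t. G t * G t)"
    by (rule log_substitution[where R = 1]) (use G0 Gc0 \<delta> in \<open>auto intro!: continuous_intros\<close>)
  finally have 1: "(LBINT s. (\<psi> s)\<^sup>2 / s ^ (2 * m)) = (1 / \<delta>) * J 0" by (simp add: J_def)
  have "(LBINT s. (deriv ^^ (2 * m)) \<psi> s * \<psi> s) =
      (LBINT s. if s > 0 then ((\<Sum>j\<le>2 * m. c j * \<delta> ^ j * (deriv ^^ j) G (\<delta> * ln s)) * G (\<delta> * ln s)) / s else 0)"
  proof (rule Bochner_Integration.integral_cong[OF refl])
    fix s
    let ?S = "\<Sum>j\<le>2 * m. c j * \<delta> ^ j * (deriv ^^ j) G (\<delta> * ln s)"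
    show "(deriv ^^ (2 * m)) \<psi> s * \<psi> s = (if s > 0 then (?S * G (\<delta> * ln s)) / s else 0)"
    proof (cases "s > 0")
      case True
      have "(deriv ^^ (2 * m)) \<psi> s * \<psi> s = (s powr (\<alpha> - real (2 * m)) * s powr \<alpha>) * (?S * G (\<delta> * ln s))"
        using True unfolding \<psi>_def c[OF B] by (simp add: mellin_def mult_ac)
      then show ?thesis using True unfolding pw(2)[OF True] by simp
    next
      case False
      then show ?thesis by (simp add: \<psi>_def mellin_def)
    qed
  qed
  also have "\<dots> = (1 / \<delta>) * (LBINT t. (\<Sum>j\<le>2 * m. c j * \<delta> ^ j * (deriv ^^ j) G t) * G t)"
    by (rule log_substitution[where R = 1 and f = "\<lambda>t. (\<Sum>j\<le>2 * m. c j * \<delta> ^ j * (deriv ^^ j) G t) * G t"])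
       (use G0 \<delta> in \<open>auto intro!: continuous_intros Gc Gc0\<close>)
  also have "(LBINT t. (\<Sum>j\<le>2 * m. c j * \<delta> ^ j * (deriv ^^ j) G t) * G t) =
      (LBINT t. \<Sum>j\<le>2 * m. c j * \<delta> ^ j * ((deriv ^^ j) G t * G t))"
    by (simp add: sum_distrib_right mult.assoc)
  also have "\<dots> = (\<Sum>j\<le>2 * m. c j * \<delta> ^ j * J j)"
  proof -
    have "integrable lborel (\<lambda>t. (deriv ^^ j) G t * G t)" for j
      by (rule continuous_compact_support_integrable[of _ "-1" 1])
         (use G0 in \<open>auto intro!: continuous_intros Gc Gc0\<close>)
    then show ?thesis
      by (subst Bochner_Integration.integral_sum) (auto simp: J_def)
  qed
  finally have 2: "(LBINT s. (deriv ^^ (2 * m)) \<psi> s * \<psi> s) = (1 / \<delta>) * (\<Sum>j\<le>2 * m. c j * \<delta> ^ j * J j)" .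
  have "(1 / \<delta>) * p \<delta> < 0" using \<delta> by (simp add: mult_pos_neg divide_neg_pos)
  then have "(- 1) ^ m * (LBINT s. (deriv ^^ (2 * m)) \<psi> s * \<psi> s) < C * (LBINT s. (\<psi> s)\<^sup>2 / s ^ (2 * m))"
    unfolding 1 2 p_def by (simp add: algebra_simps)
  moreover have "smooth1 \<psi>" unfolding \<psi>_def by (rule smooth1_mellin[OF B])
  moreover have "\<forall>s. s \<notin> {exp (- (1 / \<delta>))..exp (1 / \<delta>)} \<longrightarrow> \<psi> s = 0"
    unfolding \<psi>_def using mellin_outside[where R = "1 / \<delta>" and g = ?g] B by (auto simp: bumps_def)
  ultimately show ?thesis
    by (intro exI[of _ \<psi>] exI[of _ "exp (- (1 / \<delta>))"] exI[of _ "exp (1 / \<delta>)"]) auto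
qed

subsection \<open>Sharpness in the half-space\<close>

lemma smooth_fun_family:
  fixes f :: "real^'n::finite \<Rightarrow> real"
  assumes "f \<in> C" and "\<And>g. g \<in> C \<Longrightarrow> \<exists>g'. (\<forall>i. g' i \<in> C) \<and>
      (\<forall>x. (g has_derivative (\<lambda>h. \<Sum>i\<in>UNIV. h $ i * g' i x)) (at x))"
  shows "smooth_fun f"
proof (rule smooth_fun_coinduct[OF assms(1)])
  fix g assume "g \<in> C"
  then obtain g' where g': "\<And>i. g' i \<in> C" "\<And>x. (g has_derivative (\<lambda>h. \<Sum>i\<in>UNIV. h $ i * g' i x)) (at x)"
    using assms(2) by blast
  then show "g differentiable (at x)" for x by (auto simp: differentiable_def)
  have "pderiv_coord i g x = g' i x" for i x
  proof -
    have "pderiv_coord i g x = (\<Sum>j\<in>UNIV. if j = i then g' j x else 0)"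
      unfolding pderiv_coord_eq[OF g'(2)] by (intro sum.cong) (auto simp: axis_def)
    then show ?thesis by simp
  qed
  then have "pderiv_coord i g = g' i" for i by (simp add: fun_eq_iff)
  with g'(1) show "pderiv_coord i g \<in> C" for i by simp
qed

text \<open>The counterpart of \<open>prod1_span\<close> in several variables: sums of products are
  preserved by the Leibniz rule.\<close>

inductive_set product_span :: "(real^'n::finite \<Rightarrow> real) set" where
  product_base: "smooth_fun f \<Longrightarrow> smooth_fun g \<Longrightarrow> (\<lambda>x. f x * g x) \<in> product_span"
| product_add: "f \<in> product_span \<Longrightarrow> g \<in> product_span \<Longrightarrow> (\<lambda>x. f x + g x) \<in> product_span"

lemma smooth_fun_product_span: "h \<in> product_span \<Longrightarrow> smooth_fun h"
proof (rule smooth_fun_family[where C = product_span])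
  fix g :: "real^'n \<Rightarrow> real" assume "g \<in> product_span"
  then show "\<exists>g'. (\<forall>i. g' i \<in> product_span) \<and>
      (\<forall>x. (g has_derivative (\<lambda>h. \<Sum>i\<in>UNIV. h $ i * g' i x)) (at x))"
  proof induction
    case (product_base f g)
    show ?case
    proof (intro exI conjI allI)
      show "(\<lambda>x. f x * pderiv_coord i g x + pderiv_coord i f x * g x) \<in> product_span" for i
        using product_base by (intro product_span.product_add product_span.product_base smooth_fun_pderiv)
      show "((\<lambda>x. f x * g x) has_derivative
          (\<lambda>h. \<Sum>i\<in>UNIV. h $ i * (f x * pderiv_coord i g x + pderiv_coord i f x * g x))) (at x)" for x
        using has_derivative_mult[OF product_base[THEN smooth_fun_has_derivative]]
        by (rule has_derivative_eq_rhs)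
           (simp add: fun_eq_iff sum_distrib_left sum_distrib_right sum.distrib[symmetric] algebra_simps)
    qed
  next
    case (product_add f g)
    then obtain f' g' where "\<And>i. f' i \<in> product_span" "\<And>i. g' i \<in> product_span"
      and D: "\<And>x. (f has_derivative (\<lambda>h. \<Sum>i\<in>UNIV. h $ i * f' i x)) (at x)"
        "\<And>x. (g has_derivative (\<lambda>h. \<Sum>i\<in>UNIV. h $ i * g' i x)) (at x)" by blast
    then show ?case
      by (intro exI[of _ "\<lambda>i x. f' i x + g' i x"] conjI allI product_span.product_add
            has_derivative_eq_rhs[OF has_derivative_add[OF D]])
         (auto simp: fun_eq_iff sum.distrib[symmetric] algebra_simps)
  qed
qed

lemma smooth_fun_mult: "smooth_fun f \<Longrightarrow> smooth_fun g \<Longrightarrow> smooth_fun (\<lambda>x. f x * g x)"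
  by (rule smooth_fun_product_span[OF product_base])

lemma smooth_fun_const: "smooth_fun (\<lambda>_. c)"
proof (rule smooth_fun_family[where C = "range (\<lambda>c _. c)"])
  fix g :: "real^'n \<Rightarrow> real" assume "g \<in> range (\<lambda>c _. c)"
  then show "\<exists>g'. (\<forall>i. g' i \<in> range (\<lambda>c _. c)) \<and>
      (\<forall>x. (g has_derivative (\<lambda>h. \<Sum>i\<in>UNIV. h $ i * g' i x)) (at x))"
    by (intro exI[of _ "\<lambda>_ _. 0"]) auto
qed auto

lemma smooth_fun_add:
  assumes "smooth_fun f" "smooth_fun g" shows "smooth_fun (\<lambda>x. f x + g x)"
proof -
  have "(\<lambda>x. f x * 1 + g x * 1) \<in> product_span"
    by (intro product_add product_base assms smooth_fun_const)
  then show ?thesis by (simp add: smooth_fun_product_span)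
qed

lemma smooth_fun_prod: "finite A \<Longrightarrow> (\<And>i. i \<in> A \<Longrightarrow> smooth_fun (f i)) \<Longrightarrow> smooth_fun (\<lambda>x. \<Prod>i\<in>A. f i x)"
  by (induction A rule: finite_induct) (auto intro: smooth_fun_mult smooth_fun_const)

lemma ridge_has_derivative:
  assumes "smooth1 g"
  shows "((\<lambda>x. g (l \<bullet> x)) has_derivative (\<lambda>h. \<Sum>i\<in>UNIV. h $ i * (l $ i * deriv g (l \<bullet> x)))) (at x)"
proof -
  have "((\<lambda>x. l \<bullet> x) has_derivative (\<lambda>h. l \<bullet> h)) (at x)" by (auto intro!: derivative_eq_intros)
  moreover have "(g has_derivative (\<lambda>t. deriv g (l \<bullet> x) * t)) (at (l \<bullet> x))"
    using smooth1_DERIV[OF assms] by (simp add: has_field_derivative_def)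
  ultimately have "(g \<circ> (\<lambda>x. l \<bullet> x) has_derivative (\<lambda>t. deriv g (l \<bullet> x) * t) \<circ> (\<lambda>h. l \<bullet> h)) (at x)"
    by (rule diff_chain_at)
  then show ?thesis
    unfolding o_def
    by (rule has_derivative_eq_rhs)
       (simp add: fun_eq_iff inner_vec_def[of l] inner_real_def sum_distrib_left sum_distrib_right mult_ac)
qed

lemma smooth_fun_ridge:
  fixes l :: "real^'n::finite"
  assumes "smooth1 g" shows "smooth_fun (\<lambda>x. g (l \<bullet> x))"
proof (rule smooth_fun_family[where C = "{\<lambda>x. c * g (l \<bullet> x) | c g. smooth1 g}"])
  show "(\<lambda>x. g (l \<bullet> x)) \<in> {\<lambda>x. c * g (l \<bullet> x) | c g. smooth1 g}"
    using assms by (intro CollectI exI[of _ 1] exI[of _ g]) auto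
  fix h assume "h \<in> {\<lambda>x. c * g (l \<bullet> x) | c g. smooth1 g}"
  then obtain c g where h: "h = (\<lambda>x. c * g (l \<bullet> x))" and g: "smooth1 g" by blast
  have "((\<lambda>x. c * g (l \<bullet> x)) has_derivative (\<lambda>k. \<Sum>i\<in>UNIV. k $ i * ((c * l $ i) * deriv g (l \<bullet> x)))) (at x)" for x
    by (rule has_derivative_eq_rhs[OF has_derivative_mult_right[OF ridge_has_derivative[OF g]]])
       (simp add: fun_eq_iff sum_distrib_left mult_ac)
  moreover have "(\<lambda>x. (c * l $ i) * deriv g (l \<bullet> x)) \<in> {\<lambda>x. c * g (l \<bullet> x) | c g. smooth1 g}" for i
    using smooth1_deriv[OF g] by blast
  ultimately show "\<exists>h'. (\<forall>i. h' i \<in> {\<lambda>x. c * g (l \<bullet> x) | c g. smooth1 g}) \<and>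
      (\<forall>x. (h has_derivative (\<lambda>k. \<Sum>i\<in>UNIV. k $ i * h' i x)) (at x))"
    unfolding h by (intro exI[of _ "\<lambda>i x. (c * l $ i) * deriv g (l \<bullet> x)"]) blast
qed

lemma pderiv_coord_add:
  assumes "smooth_fun f" "smooth_fun g"
  shows "pderiv_coord i (\<lambda>x. f x + g x) x = pderiv_coord i f x + pderiv_coord i g x"
  unfolding pderiv_coord_def[of i "\<lambda>x. f x + g x"]
  by (rule DERIV_imp_deriv[OF DERIV_add[OF assms[THEN smooth_fun_line_derivative]]])

lemma pderiv_coord_mult:
  assumes "smooth_fun f" "smooth_fun g"
  shows "pderiv_coord i (\<lambda>x. f x * g x) x = pderiv_coord i f x * g x + f x * pderiv_coord i g x"
  using DERIV_imp_deriv[OF DERIV_mult[OF smooth_fun_line_derivative[OF assms(1)] smooth_fun_line_derivative[OF assms(2)]], of x i]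
  unfolding pderiv_coord_def[of i "\<lambda>x. f x * g x"] by (simp add: mult.commute)

lemma pderiv_coord_cmult:
  assumes "smooth_fun f"
  shows "pderiv_coord i (\<lambda>x. c * f x) x = c * pderiv_coord i f x"
  unfolding pderiv_coord_def[of i "\<lambda>x. c * f x"]
  by (rule DERIV_imp_deriv[OF DERIV_cmult[OF smooth_fun_line_derivative[OF assms]]])

lemma pderiv_coord_ridge:
  assumes "smooth1 g"
  shows "pderiv_coord i (\<lambda>x. g (l \<bullet> x)) x = l $ i * deriv g (l \<bullet> x)"
proof -
  have "pderiv_coord i (\<lambda>x. g (l \<bullet> x)) x = (\<Sum>j\<in>UNIV. if j = i then l $ j * deriv g (l \<bullet> x) else 0)"
    unfolding pderiv_coord_eq[OF ridge_has_derivative[OF assms]] by (intro sum.cong) (auto simp: axis_def)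
  then show ?thesis by simp
qed

text \<open>The set where the projection along \<nu> has norm at most M is closed, so G vanishes on
  an open complement and its derivatives do too; invariance along \<nu> passes to difference
  quotients.\<close>

lemma cylindrical_pderiv:
  fixes G :: "real^'n::finite \<Rightarrow> real"
  assumes "cylindrical \<nu> G" shows "cylindrical \<nu> (pderiv_coord i G)"
proof -
  obtain M where M: "\<And>x. G x \<noteq> 0 \<Longrightarrow> norm (x - (\<nu> \<bullet> x) *\<^sub>R \<nu>) \<le> M"
    and inv: "\<And>x t. G (x + t *\<^sub>R \<nu>) = G x"
    using assms by (auto simp: cylindrical_def)
  let ?S = "{x. norm (x - (\<nu> \<bullet> x) *\<^sub>R \<nu>) \<le> M}"
  have "closed ?S" by (intro closed_Collect_le continuous_intros)
  then have "norm (x - (\<nu> \<bullet> x) *\<^sub>R \<nu>) \<le> M" if "pderiv_coord i G x \<noteq> 0" for x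
    using pderiv_coord_outside[of ?S G x i] M that by blast
  moreover have "pderiv_coord i G (x + t *\<^sub>R \<nu>) = pderiv_coord i G x" for x t
  proof -
    have "G (x + t *\<^sub>R \<nu> + s *\<^sub>R axis i 1) = G (x + s *\<^sub>R axis i 1)" for s
      using inv[of "x + s *\<^sub>R axis i 1" t] by (simp add: algebra_simps)
    then show ?thesis unfolding pderiv_coord_def by simp
  qed
  ultimately show ?thesis unfolding cylindrical_def by blast
qed

lemma cylindrical_mult: "cylindrical \<nu> F \<Longrightarrow> cylindrical \<nu> G \<Longrightarrow> cylindrical \<nu> (\<lambda>x. F x * G x)"
  by (auto simp: cylindrical_def)

section \<open>Boundary-layer test functions\<close>

text \<open>The error terms in the derivatives of \<open>\<psi>(\<nu> \<bullet> x / e) \<Psi>(x)\<close>, as functions of \<open>e\<close> and \<open>x\<close>.\<close>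
inductive_set layer_span :: "real \<Rightarrow> real \<Rightarrow> real^'n::finite \<Rightarrow> (real \<Rightarrow> real^'n \<Rightarrow> real) set" for a b \<nu> where
  layer_base: "smooth1 \<psi> \<Longrightarrow> (\<And>s. s \<notin> {a..b} \<Longrightarrow> \<psi> s = 0) \<Longrightarrow> smooth_fun \<Psi> \<Longrightarrow> cylindrical \<nu> \<Psi> \<Longrightarrow>
    (\<lambda>e x. \<psi> (\<nu> \<bullet> x / e) * \<Psi> x) \<in> layer_span a b \<nu>"
| layer_add: "r \<in> layer_span a b \<nu> \<Longrightarrow> r' \<in> layer_span a b \<nu> \<Longrightarrow> (\<lambda>e x. r e x + r' e x) \<in> layer_span a b \<nu>"
| layer_cmult: "r \<in> layer_span a b \<nu> \<Longrightarrow> (\<lambda>e x. c * r e x) \<in> layer_span a b \<nu>"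
| layer_eps: "r \<in> layer_span a b \<nu> \<Longrightarrow> (\<lambda>e x. e * r e x) \<in> layer_span a b \<nu>"

lemma smooth_fun_scaled_ridge:
  assumes "smooth1 g" shows "smooth_fun (\<lambda>x. g (\<nu> \<bullet> x / e))"
  using smooth_fun_ridge[OF assms, of "(1 / e) *\<^sub>R \<nu>"] by simp

lemma pderiv_coord_scaled_ridge:
  assumes "smooth1 g"
  shows "pderiv_coord i (\<lambda>x. g (\<nu> \<bullet> x / e)) x = \<nu> $ i / e * deriv g (\<nu> \<bullet> x / e)"
  using pderiv_coord_ridge[OF assms, of i "(1 / e) *\<^sub>R \<nu>" x] by simp

lemma smooth_fun_layer: "r \<in> layer_span a b \<nu> \<Longrightarrow> smooth_fun (r e)"
  by (induction rule: layer_span.induct)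
     (auto intro: smooth_fun_mult smooth_fun_add smooth_fun_const smooth_fun_scaled_ridge)

lemma layer_pderiv_base:
  assumes "smooth1 \<psi>" "smooth_fun \<Psi>" "e > 0"
  shows "e * pderiv_coord i (\<lambda>x. \<psi> (\<nu> \<bullet> x / e) * \<Psi> x) x =
    \<nu> $ i * (deriv \<psi> (\<nu> \<bullet> x / e) * \<Psi> x) + e * (\<psi> (\<nu> \<bullet> x / e) * pderiv_coord i \<Psi> x)"
  using assms(3)
  unfolding pderiv_coord_mult[OF smooth_fun_scaled_ridge[OF assms(1)] assms(2)]
    pderiv_coord_scaled_ridge[OF assms(1)] by (simp add: field_simps)

text \<open>Differentiating \<psi>(\<nu> \<bullet> x / e) costs 1/e, which the factor e compensates;
  a derivative that falls on \<Psi> keeps an extra e and is covered by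
  \<open>layer_eps\<close>.\<close>

lemma layer_pderiv:
  assumes "r \<in> layer_span a b \<nu>"
  shows "\<exists>r'\<in>layer_span a b \<nu>. \<forall>e>0. \<forall>x. e * pderiv_coord i (r e) x = r' e x"
  using assms
proof induction
  case (layer_base \<psi> \<Psi>)
  have d0: "deriv \<psi> s = 0" if "s \<notin> {a..b}" for s
    using higher_deriv_outside[of a b \<psi> s 1] layer_base(2) that by simp
  show ?case
  proof (intro bexI allI impI)
    show "(\<lambda>e x. \<nu> $ i * (deriv \<psi> (\<nu> \<bullet> x / e) * \<Psi> x) + e * (\<psi> (\<nu> \<bullet> x / e) * pderiv_coord i \<Psi> x)) \<in> layer_span a b \<nu>"
      by (intro layer_span.intros smooth1_deriv smooth_fun_pderiv cylindrical_pderiv layer_base d0)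
  qed (use layer_pderiv_base layer_base in blast)
next
  case (layer_add r r')
  then obtain q q' where "q \<in> layer_span a b \<nu>" "q' \<in> layer_span a b \<nu>"
    "\<forall>e>0. \<forall>x. e * pderiv_coord i (r e) x = q e x" "\<forall>e>0. \<forall>x. e * pderiv_coord i (r' e) x = q' e x" by blast
  then show ?case
    using layer_add(1,2)
    by (intro bexI[of _ "\<lambda>e x. q e x + q' e x"] layer_span.layer_add)
       (auto simp: pderiv_coord_add smooth_fun_layer distrib_left)
next
  case (layer_cmult r c)
  then obtain q where "q \<in> layer_span a b \<nu>" "\<forall>e>0. \<forall>x. e * pderiv_coord i (r e) x = q e x" by blast
  then show ?case
    using layer_cmult(1)
    by (intro bexI[of _ "\<lambda>e x. c * q e x"] layer_span.layer_cmult)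
       (auto simp: pderiv_coord_cmult[OF smooth_fun_layer] mult.left_commute)
next
  case (layer_eps r)
  then obtain q where "q \<in> layer_span a b \<nu>" "\<forall>e>0. \<forall>x. e * pderiv_coord i (r e) x = q e x" by blast
  then show ?case
    using layer_eps(1)
    by (intro bexI[of _ "\<lambda>e x. e * q e x"] layer_span.layer_eps)
       (auto simp: pderiv_coord_cmult[OF smooth_fun_layer] mult.left_commute)
qed

text \<open>A scaled derivative that falls on \<psi> contributes \<nu>_i and stays of order zero in
  e, whereas one that falls on \<Psi> leaves a factor e. The leading term therefore differentiates
  \<psi> alone, and everything else is e times an element of the span.\<close>

lemma layer_expansion:
  fixes \<nu> :: "real^'n::finite"
  assumes \<psi>: "smooth1 \<psi>" "\<And>s. s \<notin> {a..b} \<Longrightarrow> \<psi> s = 0" and \<Psi>: "smooth_fun \<Psi>" "cylindrical \<nu> \<Psi>"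
  shows "\<exists>r\<in>layer_span a b \<nu>. \<forall>e>0. \<forall>x. e ^ length L * iter_pderiv L (\<lambda>x. \<psi> (\<nu> \<bullet> x / e) * \<Psi> x) x =
    (\<Prod>i\<leftarrow>L. \<nu> $ i) * ((deriv ^^ length L) \<psi> (\<nu> \<bullet> x / e) * \<Psi> x) + e * r e x"
proof (induction L)
  case Nil
  show ?case
    by (intro bexI[of _ "\<lambda>e x. 0 * (\<psi> (\<nu> \<bullet> x / e) * \<Psi> x)"] layer_cmult layer_base assms) auto
next
  case (Cons i L)
  let ?u = "\<lambda>e x. \<psi> (\<nu> \<bullet> x / e) * \<Psi> x"
  let ?p = "\<Prod>i\<leftarrow>L. \<nu> $ i" and ?d = "(deriv ^^ length L) \<psi>"
  from Cons obtain r where r: "r \<in> layer_span a b \<nu>"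
    and eq: "\<And>e x. e > 0 \<Longrightarrow> e ^ length L * iter_pderiv L (?u e) x = ?p * (?d (\<nu> \<bullet> x / e) * \<Psi> x) + e * r e x" by blast
  obtain q where q: "q \<in> layer_span a b \<nu>" "\<And>e x. e > 0 \<Longrightarrow> e * pderiv_coord i (r e) x = q e x"
    using layer_pderiv[OF r, of i] by blast
  have d: "smooth1 ?d" by (rule smooth1_higher_deriv[OF \<psi>(1)])
  have d0: "?d s = 0" if "s \<notin> {a..b}" for s using higher_deriv_outside[OF \<psi>(2) that] .
  have us: "smooth_fun (?u e)" for e by (intro smooth_fun_mult smooth_fun_scaled_ridge assms)
  show ?case
  proof (intro bexI allI impI)
    \<comment> \<open>With one e factored out, the first summand is the derivative of the leading
      term that falls on \<Psi>, the second the scaled derivative of the previous error.\<close>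
    show "(\<lambda>e x. ?p * (?d (\<nu> \<bullet> x / e) * pderiv_coord i \<Psi> x) + q e x) \<in> layer_span a b \<nu>"
      by (intro layer_add layer_cmult layer_base q d d0 smooth_fun_pderiv cylindrical_pderiv \<Psi>)
    fix e :: real and x assume e: "e > 0"
    have f: "(\<lambda>x. e ^ length L * iter_pderiv L (?u e) x) = (\<lambda>x. ?p * (?d (\<nu> \<bullet> x / e) * \<Psi> x) + e * r e x)"
      using eq[OF e] by (rule ext)
    have sm: "smooth_fun (\<lambda>x. ?d (\<nu> \<bullet> x / e) * \<Psi> x)" by (intro smooth_fun_mult smooth_fun_scaled_ridge d \<Psi>)
    have sr: "smooth_fun (r e)" by (rule smooth_fun_layer[OF r])
    have "e ^ length (i # L) * iter_pderiv (i # L) (?u e) x = e * (e ^ length L * pderiv_coord i (iter_pderiv L (?u e)) x)"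
      by (simp add: mult.assoc)
    also have "\<dots> = e * pderiv_coord i (\<lambda>x. e ^ length L * iter_pderiv L (?u e) x) x"
      by (simp only: pderiv_coord_cmult[OF smooth_fun_iter_pderiv[OF us]])
    also have "\<dots> = ?p * (e * pderiv_coord i (\<lambda>x. ?d (\<nu> \<bullet> x / e) * \<Psi> x) x) + e * (e * pderiv_coord i (r e) x)"
      unfolding f pderiv_coord_add[OF smooth_fun_mult[OF smooth_fun_const sm] smooth_fun_mult[OF smooth_fun_const sr]]
        pderiv_coord_cmult[OF sm] pderiv_coord_cmult[OF sr] by (simp only: distrib_left mult.left_commute)
    also have "\<dots> = (\<Prod>i\<leftarrow>i # L. \<nu> $ i) * ((deriv ^^ length (i # L)) \<psi> (\<nu> \<bullet> x / e) * \<Psi> x) +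
        e * (?p * (?d (\<nu> \<bullet> x / e) * pderiv_coord i \<Psi> x) + q e x)"
      unfolding layer_pderiv_base[OF d \<Psi>(1) e] q(2)[OF e] by (simp add: algebra_simps)
    finally show "e ^ length (i # L) * iter_pderiv (i # L) (?u e) x = (\<Prod>i\<leftarrow>i # L. \<nu> $ i) *
        ((deriv ^^ length (i # L)) \<psi> (\<nu> \<bullet> x / e) * \<Psi> x) +
        e * (?p * (?d (\<nu> \<bullet> x / e) * pderiv_coord i \<Psi> x) + q e x)" .
  qed
qed

lemma layer_sum:
  assumes "finite A" "r0 \<in> layer_span a b \<nu>" "\<And>i. i \<in> A \<Longrightarrow> r i \<in> layer_span a b \<nu>"
  shows "(\<lambda>e x. \<Sum>i\<in>A. c i * r i e x) \<in> layer_span a b \<nu>"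
  using assms(1,3)
proof (induction A rule: finite_induct)
  case empty
  show ?case using layer_cmult[OF assms(2), of 0] by simp
next
  case (insert i A)
  then show ?case by (simp add: layer_add layer_cmult)
qed

lemma layer_support:
  fixes \<nu> :: "real^'n::finite"
  assumes "\<And>s. s \<notin> {a..b} \<Longrightarrow> \<psi> s = 0" "cylindrical \<nu> \<Psi>" "norm \<nu> = 1" "e > 0"
  shows "\<exists>c d. \<forall>x. \<psi> (\<nu> \<bullet> x / e) * \<Psi> x \<noteq> 0 \<longrightarrow> x \<in> cbox c d \<and> \<nu> \<bullet> x \<in> {e * a..e * b}"
proof -
  obtain R where R: "\<And>x. \<Psi> x \<noteq> 0 \<Longrightarrow> \<nu> \<bullet> x \<in> {e * a..e * b} \<Longrightarrow> norm x \<le> R"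
    using cylindrical_support[OF assms(2,3)] by blast
  have in': "\<nu> \<bullet> x \<in> {e * a..e * b} \<and> norm x \<le> R" if "\<psi> (\<nu> \<bullet> x / e) * \<Psi> x \<noteq> 0" for x
  proof -
    have "(\<nu> \<bullet> x) / e \<in> {a..b}" using assms(1)[of "(\<nu> \<bullet> x) / e"] that by auto
    then have "\<nu> \<bullet> x \<in> {e * a..e * b}" using assms(4) by (simp add: field_simps)
    then show ?thesis using R that by auto
  qed
  obtain c where "cball (0::real^'n) R \<subseteq> cbox (- c) c" using bounded_subset_cbox_symmetric[OF bounded_cball] by blast
  then show ?thesis using in' by (intro exI[of _ "- c"] exI[of _ c]) auto
qed

lemma layer_integrable:
  assumes "smooth1 \<psi>" "\<And>s. s \<notin> {a..b} \<Longrightarrow> \<psi> s = 0" "smooth_fun \<Psi>" "cylindrical \<nu> \<Psi>" "norm \<nu> = 1" "e > 0"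
    and f: "continuous_on UNIV f"
  shows "integrable lborel (\<lambda>x. f x * (\<psi> (\<nu> \<bullet> x / e) * \<Psi> x))"
proof -
  obtain c d where "\<And>x. \<psi> (\<nu> \<bullet> x / e) * \<Psi> x \<noteq> 0 \<Longrightarrow> x \<in> cbox c d"
    using layer_support[where a = a and b = b and \<psi> = \<psi>, OF assms(2,4-6)] by blast
  then show ?thesis
    by (intro continuous_compact_support_integrable[of _ c d] continuous_on_mult f smooth_fun_continuous
        smooth_fun_mult smooth_fun_scaled_ridge assms) (metis mult_zero_right)
qed

text \<open>Test function and error live in a layer of thickness proportional to e, so their pairing
  is O(e): for the generators this is the slice formula, and the other clauses only change the
  constant. The bound e \<le> 1 absorbs the extra factor from \<open>layer_eps\<close>.\<close>

lemma layer_error: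
  assumes T: "\<And>G k a b e. cylindrical \<nu> G \<Longrightarrow> continuous_on UNIV G \<Longrightarrow> continuous_on UNIV k \<Longrightarrow>
        (\<And>s. s \<notin> {a..b} \<Longrightarrow> k s = 0) \<Longrightarrow> e > 0 \<Longrightarrow>
        (LBINT x. k (\<nu> \<bullet> x / e) * G x) = e * (LBINT s. k s) * T G"
    and \<psi>: "smooth1 \<psi>" "\<And>s. s \<notin> {a..b} \<Longrightarrow> \<psi> s = 0" and \<Psi>: "smooth_fun \<Psi>" "cylindrical \<nu> \<Psi>" and \<nu>: "norm \<nu> = 1"
    and "r \<in> layer_span a b \<nu>"
  shows "\<exists>K\<ge>0. \<forall>e. 0 < e \<longrightarrow> e \<le> 1 \<longrightarrow> \<bar>LBINT x. r e x * (\<psi> (\<nu> \<bullet> x / e) * \<Psi> x)\<bar> \<le> K * e"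
  using assms(7)
proof induction
  let ?u = "\<lambda>e x. \<psi> (\<nu> \<bullet> x / e) * \<Psi> x"
  case (layer_base \<phi> \<Phi>)
  show ?case
  proof (intro exI[of _ "\<bar>(LBINT s. \<phi> s * \<psi> s) * T (\<lambda>x. \<Phi> x * \<Psi> x)\<bar>"] conjI allI impI)
    fix e :: real assume e: "e > 0"
    have "(LBINT x. \<phi> (\<nu> \<bullet> x / e) * \<Phi> x * ?u e x) =
       (LBINT x. (\<phi> (\<nu> \<bullet> x / e) * \<psi> (\<nu> \<bullet> x / e)) * (\<Phi> x * \<Psi> x))"
      by (simp only: mult_ac)
    also have "\<dots> = e * (LBINT s. \<phi> s * \<psi> s) * T (\<lambda>x. \<Phi> x * \<Psi> x)"
      by (rule T[where k = "\<lambda>s. \<phi> s * \<psi> s" and a = a and b = b])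
         (use e layer_base \<psi> \<Psi> in \<open>auto intro!: cylindrical_mult smooth_fun_continuous smooth1_continuous smooth1_mult smooth_fun_mult\<close>)
    finally show "\<bar>LBINT x. \<phi> (\<nu> \<bullet> x / e) * \<Phi> x * ?u e x\<bar> \<le>
        \<bar>(LBINT s. \<phi> s * \<psi> s) * T (\<lambda>x. \<Phi> x * \<Psi> x)\<bar> * e"
      using e by (simp add: abs_mult)
  qed simp
next
  let ?u = "\<lambda>e x. \<psi> (\<nu> \<bullet> x / e) * \<Psi> x"
  case (layer_add r r')
  then obtain K K' where K: "K \<ge> 0" "\<And>e. 0 < e \<Longrightarrow> e \<le> 1 \<Longrightarrow> \<bar>LBINT x. r e x * ?u e x\<bar> \<le> K * e"
    and K': "K' \<ge> 0" "\<And>e. 0 < e \<Longrightarrow> e \<le> 1 \<Longrightarrow> \<bar>LBINT x. r' e x * ?u e x\<bar> \<le> K' * e" by blast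
  show ?case
  proof (intro exI[of _ "K + K'"] conjI allI impI)
    fix e :: real assume e: "e > 0" "e \<le> 1"
    have int: "integrable lborel (\<lambda>x. q e x * ?u e x)" if "q \<in> layer_span a b \<nu>" for q
      by (rule layer_integrable[OF \<psi> \<Psi> \<nu> e(1) smooth_fun_continuous[OF smooth_fun_layer[OF that]]])
    have "(LBINT x. (r e x + r' e x) * ?u e x) =
      (LBINT x. r e x * ?u e x) + (LBINT x. r' e x * ?u e x)"
      unfolding distrib_right by (rule Bochner_Integration.integral_add[OF int int]) (use layer_add in auto)
    then show "\<bar>LBINT x. (r e x + r' e x) * ?u e x\<bar> \<le> (K + K') * e"
      using K(2)[OF e] K'(2)[OF e] unfolding distrib_right by linarith
  qed (use K K' in auto)
next
  let ?u = "\<lambda>e x. \<psi> (\<nu> \<bullet> x / e) * \<Psi> x"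
  case (layer_cmult r c)
  then obtain K where K: "K \<ge> 0" "\<And>e. 0 < e \<Longrightarrow> e \<le> 1 \<Longrightarrow> \<bar>LBINT x. r e x * ?u e x\<bar> \<le> K * e"
    by blast
  show ?case
  proof (intro exI[of _ "\<bar>c\<bar> * K"] conjI allI impI)
    fix e :: real assume e: "e > 0" "e \<le> 1"
    show "\<bar>LBINT x. c * r e x * ?u e x\<bar> \<le> \<bar>c\<bar> * K * e"
      using mult_left_mono[OF K(2)[OF e] abs_ge_zero[of c]]
      by (simp only: mult.assoc integral_mult_right_zero abs_mult)
  qed (use K in auto)
next
  let ?u = "\<lambda>e x. \<psi> (\<nu> \<bullet> x / e) * \<Psi> x"
  case (layer_eps r)
  then obtain K where K: "K \<ge> 0" "\<And>e. 0 < e \<Longrightarrow> e \<le> 1 \<Longrightarrow> \<bar>LBINT x. r e x * ?u e x\<bar> \<le> K * e"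
    by blast
  show ?case
  proof (intro exI[of _ K] conjI allI impI)
    fix e :: real assume e: "e > 0" "e \<le> 1"
    have "\<bar>LBINT x. e * r e x * ?u e x\<bar> = e * \<bar>LBINT x. r e x * ?u e x\<bar>"
      using e by (simp only: mult.assoc integral_mult_right_zero abs_mult abs_of_pos)
    also have "\<dots> \<le> 1 * (K * e)" using e K by (intro mult_mono) auto
    finally show "\<bar>LBINT x. e * r e x * ?u e x\<bar> \<le> K * e" by simp
  qed (use K in auto)
qed

text \<open>The coordinates of the projection along \<nu> are linear forms, with directions
  \<open>?l i\<close>. A product of one-dimensional bumps in these forms is smooth, constant along
  \<nu>, and zero unless all coordinates of the projection are at most 1 in modulus.\<close>

lemma ex_cylindrical_bump:
  fixes \<nu> :: "real^'n::finite"
  assumes "norm \<nu> = 1"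
  shows "\<exists>\<Psi>. smooth_fun \<Psi> \<and> cylindrical \<nu> \<Psi> \<and> \<Psi> 0 > 0"
proof -
  obtain g where g: "smooth1 g" "\<And>x. x \<in> {-1<..<1} \<Longrightarrow> g x > 0" "\<And>x. x \<notin> {-1<..<1} \<Longrightarrow> g x = 0"
    using ex_bump[of "- 1" 1] by auto
  let ?l = "\<lambda>i::'n. axis i 1 - (\<nu> $ i) *\<^sub>R \<nu>"
  define \<Psi> where "\<Psi> = (\<lambda>x. \<Prod>i\<in>UNIV. g (?l i \<bullet> x))"
  have coord: "?l i \<bullet> x = (x - (\<nu> \<bullet> x) *\<^sub>R \<nu>) $ i" for i x
    by (simp add: inner_diff_left inner_axis' mult.commute)
  have "smooth_fun \<Psi>" unfolding \<Psi>_def by (intro smooth_fun_prod smooth_fun_ridge g) simp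
  moreover have "cylindrical \<nu> \<Psi>"
    unfolding cylindrical_def
  proof (intro conjI allI exI impI)
    fix x and t :: real
    have "\<nu> \<bullet> (x + t *\<^sub>R \<nu>) = \<nu> \<bullet> x + t" using assms by (simp add: inner_add_right dot_square_norm)
    then have "?l i \<bullet> (x + t *\<^sub>R \<nu>) = ?l i \<bullet> x" for i
      unfolding coord by (auto simp: algebra_simps)
    then show "\<Psi> (x + t *\<^sub>R \<nu>) = \<Psi> x" by (simp add: \<Psi>_def)
  next
    fix x assume "\<Psi> x \<noteq> 0"
    then have "g (?l i \<bullet> x) \<noteq> 0" for i by (simp add: \<Psi>_def)
    then have "\<bar>(x - (\<nu> \<bullet> x) *\<^sub>R \<nu>) $ i\<bar> \<le> 1" for i unfolding coord[symmetric] using g(3)[of "?l i \<bullet> x"] by force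
    then have "(\<Sum>i\<in>UNIV. \<bar>(x - (\<nu> \<bullet> x) *\<^sub>R \<nu>) $ i\<bar>) \<le> real CARD('n)"
      using sum_bounded_above[of "UNIV :: 'n set" "\<lambda>i. \<bar>(x - (\<nu> \<bullet> x) *\<^sub>R \<nu>) $ i\<bar>" 1] by simp
    then show "norm (x - (\<nu> \<bullet> x) *\<^sub>R \<nu>) \<le> real CARD('n)"
      using norm_le_l1_cart order_trans by blast
  qed
  moreover have "\<Psi> 0 > 0" unfolding \<Psi>_def by (intro prod_pos) (simp add: g)
  ultimately show ?thesis by blast
qed

lemma layer_Cc_inf:
  assumes "smooth1 \<psi>" "\<And>s. s \<notin> {a..b} \<Longrightarrow> \<psi> s = 0" "smooth_fun \<Psi>" "cylindrical \<nu> \<Psi>" "norm \<nu> = 1" "e > 0" "a > 0"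
  shows "(\<lambda>x. \<psi> (\<nu> \<bullet> x / e) * \<Psi> x) \<in> Cc_inf (halfspace \<nu>)"
proof -
  let ?u = "\<lambda>x. \<psi> (\<nu> \<bullet> x / e) * \<Psi> x"
  obtain c d where cd: "\<And>x. ?u x \<noteq> 0 \<Longrightarrow> x \<in> cbox c d \<and> \<nu> \<bullet> x \<in> {e * a..e * b}"
    using layer_support[where a = a and b = b and \<psi> = \<psi>, OF assms(2,4-6)] by blast
  let ?S = "cbox c d \<inter> {x. \<nu> \<bullet> x \<ge> e * a}"
  have S: "compact ?S" by (intro compact_Int_closed compact_cbox closed_halfspace_ge)
  have sub: "tsupport ?u \<subseteq> ?S"
    unfolding tsupport_def using cd by (intro closure_minimal compact_imp_closed[OF S]) auto
  moreover have "compact (tsupport ?u)"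
    using compact_Int_closed[OF S, of "tsupport ?u"] sub by (simp add: inf.absorb2 tsupport_def)
  moreover have "?S \<subseteq> halfspace \<nu>"
    using mult_pos_pos[OF assms(6,7)] by (auto simp: halfspace_def)
  moreover have "smooth_fun ?u" by (intro smooth_fun_mult smooth_fun_scaled_ridge assms)
  ultimately show ?thesis by (auto simp: Cc_inf_def)
qed

text \<open>After multiplication by e^(2m) the weighted integral is e T(\<Psi>^2) times its
  one-dimensional counterpart, and the energy is H(\<nu>) times the analogous expression up to an
  error of order e^2. The strict one-dimensional inequality therefore survives for small e.\<close>

lemma hardy_halfspace_sharp:
  fixes a :: "('n::finite \<Rightarrow> nat) \<Rightarrow> real" and \<nu> :: "real^'n"
  assumes ell: "elliptic m a" and \<nu>: "norm \<nu> = 1" and C: "C > A_const m"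
  shows "\<exists>u\<in>Cc_inf (halfspace \<nu>).
    (LBINT x. u x * hom_op m a u x) < C * hom_symbol m a \<nu> * (LBINT x. (u x)\<^sup>2 / (\<nu> \<bullet> x) ^ (2 * m))"
proof -
  obtain \<psi> lo hi where lo: "0 < lo" and \<psi>: "smooth1 \<psi>" "\<And>s. s \<notin> {lo..hi} \<Longrightarrow> \<psi> s = 0"
    and sharp: "(- 1) ^ m * (LBINT s. (deriv ^^ (2 * m)) \<psi> s * \<psi> s) < C * (LBINT s. (\<psi> s)\<^sup>2 / s ^ (2 * m))"
    using hardy_rellich_sharp_1[OF C] by blast
  obtain \<Psi> where \<Psi>: "smooth_fun \<Psi>" "cylindrical \<nu> \<Psi>" and \<Psi>0: "\<Psi> 0 > 0"
    using ex_cylindrical_bump[OF \<nu>] by blast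
  obtain T where T': "\<forall>G k a b e. cylindrical \<nu> G \<longrightarrow> continuous_on UNIV G \<longrightarrow> continuous_on UNIV k \<longrightarrow>
        (\<forall>s. s \<notin> {a..b} \<longrightarrow> k s = 0) \<longrightarrow> e > 0 \<longrightarrow>
        (LBINT x. k (\<nu> \<bullet> x / e) * G x) = e * (LBINT s. k s) * T G"
    and Tpos': "\<forall>G p. cylindrical \<nu> G \<longrightarrow> continuous_on UNIV G \<longrightarrow> (\<forall>x. G x \<ge> 0) \<longrightarrow> G p > 0 \<longrightarrow> T G > 0"
    using ex_slice_functional[OF \<nu>] by (elim exE conjE)
  note T = T'[rule_format] and Tpos = Tpos'[rule_format]
  let ?G = "\<lambda>x. \<Psi> x * \<Psi> x"
  have G: "cylindrical \<nu> ?G" "continuous_on UNIV ?G"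
    using \<Psi> by (auto intro: cylindrical_mult smooth_fun_continuous continuous_on_mult)
  have TG: "T ?G > 0" by (rule Tpos[OF G, of 0]) (use \<Psi>0 in auto)
  let ?u = "\<lambda>e x. \<psi> (\<nu> \<bullet> x / e) * \<Psi> x"
  let ?d = "(deriv ^^ (2 * m)) \<psi>"
  have d: "smooth1 ?d" "\<And>s. s \<notin> {lo..hi} \<Longrightarrow> ?d s = 0"
    by (rule smooth1_higher_deriv[OF \<psi>(1)]) (rule higher_deriv_outside[OF \<psi>(2)])
  have "\<forall>\<alpha>\<in>multi_indices (2 * m). \<exists>r\<in>layer_span lo hi \<nu>. \<forall>e>0. \<forall>x.
      e ^ (2 * m) * Dalpha \<alpha> (?u e) x = (\<Prod>i\<leftarrow>index_list \<alpha>. \<nu> $ i) * (?d (\<nu> \<bullet> x / e) * \<Psi> x) + e * r e x"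
  proof
    fix \<alpha> :: "'n \<Rightarrow> nat" assume \<alpha>: "\<alpha> \<in> multi_indices (2 * m)"
    show "\<exists>r\<in>layer_span lo hi \<nu>. \<forall>e>0. \<forall>x. e ^ (2 * m) * Dalpha \<alpha> (?u e) x =
        (\<Prod>i\<leftarrow>index_list \<alpha>. \<nu> $ i) * (?d (\<nu> \<bullet> x / e) * \<Psi> x) + e * r e x"
      using layer_expansion[OF \<psi> \<Psi>, where L = "index_list \<alpha>"]
      unfolding length_index_list[OF \<alpha>] Dalpha_index_list .
  qed
  from bchoice[OF this[unfolded Bex_def]] obtain r where r: "\<And>\<alpha>. \<alpha> \<in> multi_indices (2 * m) \<Longrightarrow> r \<alpha> \<in> layer_span lo hi \<nu>"
    and exp: "\<And>\<alpha> e x. \<alpha> \<in> multi_indices (2 * m) \<Longrightarrow> e > 0 \<Longrightarrow> e ^ (2 * m) * Dalpha \<alpha> (?u e) x =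
      (\<Prod>i\<leftarrow>index_list \<alpha>. \<nu> $ i) * (?d (\<nu> \<bullet> x / e) * \<Psi> x) + e * r \<alpha> e x"
    by (elim exE) fast
  define R where "R = (\<lambda>e x. \<Sum>\<alpha>\<in>multi_indices (2 * m). ((- 1) ^ m * a \<alpha>) * r \<alpha> e x)"
  have R: "R \<in> layer_span lo hi \<nu>"
    unfolding R_def by (rule layer_sum[OF finite_multi_indices layer_base[OF \<psi> \<Psi>] r])
  have Hu: "e ^ (2 * m) * hom_op m a (?u e) x =
      (- 1) ^ m * hom_symbol m a \<nu> * (?d (\<nu> \<bullet> x / e) * \<Psi> x) + e * R e x" if "e > 0" for e x
  proof -
    have "e ^ (2 * m) * hom_op m a (?u e) x =
        (\<Sum>\<alpha>\<in>multi_indices (2 * m). ((- 1) ^ m * a \<alpha>) * (e ^ (2 * m) * Dalpha \<alpha> (?u e) x))"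
      by (simp add: hom_op_def sum_distrib_left mult_ac)
    also have "\<dots> = (\<Sum>\<alpha>\<in>multi_indices (2 * m). ((- 1) ^ m * a \<alpha>) *
        ((\<Prod>i\<leftarrow>index_list \<alpha>. \<nu> $ i) * (?d (\<nu> \<bullet> x / e) * \<Psi> x) + e * r \<alpha> e x))"
      using exp that by (intro sum.cong) auto
    also have "\<dots> = (- 1) ^ m * hom_symbol m a \<nu> * (?d (\<nu> \<bullet> x / e) * \<Psi> x) + e * R e x"
      by (simp add: hom_symbol_index_list R_def sum_distrib_left sum_distrib_right sum.distrib[symmetric] algebra_simps)
    finally show ?thesis .
  qed
  have "\<exists>K\<ge>0. \<forall>e. 0 < e \<longrightarrow> e \<le> 1 \<longrightarrow> \<bar>LBINT x. R e x * ?u e x\<bar> \<le> K * e"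
    by (rule layer_error[OF T \<psi> \<Psi> \<nu> R])
  then obtain K where K0: "K \<ge> 0" and K': "\<forall>e. 0 < e \<longrightarrow> e \<le> 1 \<longrightarrow> \<bar>LBINT x. R e x * ?u e x\<bar> \<le> K * e"
    by (elim exE conjE)
  note K = K0 K'[rule_format]
  define J1 J2 h where "J1 = (LBINT s. ?d s * \<psi> s)" and "J2 = (LBINT s. (\<psi> s)\<^sup>2 / s ^ (2 * m))" and "h = hom_symbol m a \<nu>"
  have "\<nu> \<noteq> 0" using \<nu> by auto
  then have h: "h > 0" using ell by (simp add: elliptic_def h_def)
  \<comment> \<open>The gap between the two leading terms after division by e.\<close>
  define D where "D = h * T ?G * (C * J2 - (- 1) ^ m * J1)"
  have D: "D > 0" using sharp h TG unfolding D_def J1_def J2_def by simp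
  \<comment> \<open>Small enough for K e < D; K + 1 keeps the denominator positive when K =
    0.\<close>
  define e where "e = min 1 (D / (2 * (K + 1)))"
  have e: "0 < e" "e \<le> 1" using D K(1) by (auto simp: e_def)
  have Ke: "K * e < D"
  proof -
    have "K * e \<le> K * (D / (2 * (K + 1)))" using K(1) by (intro mult_left_mono) (auto simp: e_def)
    also have "\<dots> = D * (K / (2 * (K + 1)))" by simp
    also have "\<dots> < D * 1" using K(1) by (intro mult_strict_left_mono D) (simp add: field_simps)
    finally show ?thesis by simp
  qed
  have cu: "continuous_on UNIV (\<lambda>x. ?d (\<nu> \<bullet> x / e) * \<Psi> x)"
    by (intro smooth_fun_continuous smooth_fun_mult smooth_fun_scaled_ridge d \<Psi>)
  have int1: "integrable lborel (\<lambda>x. (?d (\<nu> \<bullet> x / e) * \<Psi> x) * ?u e x)"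
    by (rule layer_integrable[OF \<psi> \<Psi> \<nu> e(1) cu])
  have int2: "integrable lborel (\<lambda>x. R e x * ?u e x)"
    by (rule layer_integrable[OF \<psi> \<Psi> \<nu> e(1) smooth_fun_continuous[OF smooth_fun_layer[OF R]]])
  have "e ^ (2 * m) * (LBINT x. ?u e x * hom_op m a (?u e) x) =
      (LBINT x. (- 1) ^ m * h * ((?d (\<nu> \<bullet> x / e) * \<Psi> x) * ?u e x) + e * (R e x * ?u e x))"
  proof -
    have eq: "e ^ (2 * m) * (?u e x * hom_op m a (?u e) x) =
        (- 1) ^ m * h * ((?d (\<nu> \<bullet> x / e) * \<Psi> x) * ?u e x) + e * (R e x * ?u e x)" for x
      unfolding mult.left_commute[of "e ^ (2 * m)"] Hu[OF e(1)] h_def by (simp add: algebra_simps)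
    show ?thesis unfolding integral_mult_right_zero[symmetric]
      by (rule Bochner_Integration.integral_cong[OF refl eq])
  qed
  also have "\<dots> = (- 1) ^ m * h * (LBINT x. (?d (\<nu> \<bullet> x / e) * \<Psi> x) * ?u e x) + e * (LBINT x. R e x * ?u e x)"
    using int1 int2 by (subst Bochner_Integration.integral_add) (auto intro: integrable_mult_right)
  also have "(LBINT x. (?d (\<nu> \<bullet> x / e) * \<Psi> x) * ?u e x) = (LBINT x. (?d (\<nu> \<bullet> x / e) * \<psi> (\<nu> \<bullet> x / e)) * ?G x)"
    by (simp only: mult_ac)
  also have "\<dots> = e * J1 * T ?G"
    unfolding J1_def
    by (rule T[OF G, where k = "\<lambda>s. ?d s * \<psi> s" and a = lo and b = hi])
       (use e \<psi> d in \<open>auto intro!: smooth1_continuous smooth1_mult\<close>)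
  finally have L: "e ^ (2 * m) * (LBINT x. ?u e x * hom_op m a (?u e) x) =
      (- 1) ^ m * h * (e * J1 * T ?G) + e * (LBINT x. R e x * ?u e x)" .
  have "e ^ (2 * m) * (LBINT x. (?u e x)\<^sup>2 / (\<nu> \<bullet> x) ^ (2 * m)) =
      (LBINT x. ((\<psi> (\<nu> \<bullet> x / e))\<^sup>2 / (\<nu> \<bullet> x / e) ^ (2 * m)) * ?G x)"
  proof -
    have eq: "e ^ (2 * m) * ((?u e x)\<^sup>2 / (\<nu> \<bullet> x) ^ (2 * m)) =
        ((\<psi> (\<nu> \<bullet> x / e))\<^sup>2 / (\<nu> \<bullet> x / e) ^ (2 * m)) * ?G x" for x
      by (simp add: power_divide power_mult_distrib power2_eq_square mult_ac)
    show ?thesis unfolding integral_mult_right_zero[symmetric]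
      by (rule Bochner_Integration.integral_cong[OF refl eq])
  qed
  also have "\<dots> = e * J2 * T ?G"
    unfolding J2_def
  proof (rule T[OF G, where k = "\<lambda>s. (\<psi> s)\<^sup>2 / s ^ (2 * m)" and a = lo and b = hi])
    \<comment> \<open>\<psi> vanishes below lo > 0, so max lo s may replace s in the denominator,
      which makes continuity at s = 0 visible.\<close>
    have "(\<psi> s)\<^sup>2 / s ^ (2 * m) = (\<psi> s)\<^sup>2 / (max lo s) ^ (2 * m)" for s
      using \<psi>(2)[of s] by (cases "s \<in> {lo..hi}") (auto simp: max_def)
    moreover have "continuous_on UNIV (\<lambda>s. (\<psi> s)\<^sup>2 / (max lo s) ^ (2 * m))"
      using lo by (intro continuous_intros smooth1_continuous[OF \<psi>(1)]) auto
    ultimately show "continuous_on UNIV (\<lambda>s. (\<psi> s)\<^sup>2 / s ^ (2 * m))" by (simp only:)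
  qed (use e \<psi> in auto)
  finally have M: "e ^ (2 * m) * (LBINT x. (?u e x)\<^sup>2 / (\<nu> \<bullet> x) ^ (2 * m)) = e * J2 * T ?G" .
  have "(LBINT x. R e x * ?u e x) < D" using K(2)[OF e] Ke by linarith
  then have "e * (LBINT x. R e x * ?u e x) < e * D" using e(1) by simp
  then have "e ^ (2 * m) * (LBINT x. ?u e x * hom_op m a (?u e) x) < C * h * (e * J2 * T ?G)"
    unfolding L D_def by (simp add: algebra_simps)
  also have "\<dots> = e ^ (2 * m) * (C * h * (LBINT x. (?u e x)\<^sup>2 / (\<nu> \<bullet> x) ^ (2 * m)))"
    unfolding M[symmetric] by (simp only: mult_ac)
  finally have "(LBINT x. ?u e x * hom_op m a (?u e) x) < C * h * (LBINT x. (?u e x)\<^sup>2 / (\<nu> \<bullet> x) ^ (2 * m))"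
    using e(1) by (simp only: mult_less_cancel_left_pos zero_less_power)
  moreover have "?u e \<in> Cc_inf (halfspace \<nu>)" by (rule layer_Cc_inf[OF \<psi> \<Psi> \<nu> e(1) lo])
  ultimately show ?thesis unfolding h_def by (rule bexI)
qed

section \<open>Return to integrals over the half-space\<close>

lemma integral_halfspace:
  fixes f :: "real^'n::finite \<Rightarrow> real"
  assumes "integrable lborel f" "\<And>x. x \<notin> halfspace \<nu> \<Longrightarrow> f x = 0"
  shows "integral (halfspace \<nu>) f = (LBINT x. f x)" "f integrable_on halfspace \<nu>"
proof -
  have f: "(\<lambda>x. if x \<in> halfspace \<nu> then f x else 0) = f" using assms(2) by auto
  show "integral (halfspace \<nu>) f = (LBINT x. f x)"
    unfolding integral_restrict_UNIV[symmetric, of "halfspace \<nu>"] f by (rule integral_lborel[OF assms(1)])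
  have "f integrable_on UNIV" by (rule integrable_on_lborel[OF assms(1)])
  then show "f integrable_on halfspace \<nu>"
    unfolding integrable_restrict_UNIV[symmetric, of _ "halfspace \<nu>"] f .
qed

lemma A_const_nonneg: "A_const m \<ge> 0"
  by (simp add: A_const_def prod_nonneg)

text \<open>The inequality follows from the lower bound for d_H, since H(\<nu>) (\<nu> \<bullet>
  x)^(-2m) then dominates the Finsler weight. Convexity enters where the two weights have to agree;
  optimality is expressed by a violating u for each C > A(m).\<close>

theorem theorem2:
  fixes m :: nat and a :: "('n::finite \<Rightarrow> nat) \<Rightarrow> real" and \<nu> :: "real^'n"
  assumes "m \<ge> 1"
    and "elliptic m a"
    and "norm \<nu> = 1"
  shows "(\<forall>u\<in>Cc_inf (halfspace \<nu>).
            integral (halfspace \<nu>) (\<lambda>x. u x * hom_op m a u x)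
            \<ge> A_const m * integral (halfspace \<nu>)
                 (\<lambda>x. (u x)^2 / (d_H m a (halfspace \<nu>) x) ^ (2*m)))
       \<and> (convex_on UNIV (F_H m a) \<longrightarrow>
            (\<forall>C > A_const m. \<exists>u\<in>Cc_inf (halfspace \<nu>).
               integral (halfspace \<nu>) (\<lambda>x. u x * hom_op m a u x)
               < C * integral (halfspace \<nu>)
                   (\<lambda>x. (u x)^2 / (d_H m a (halfspace \<nu>) x) ^ (2*m))))"
proof -
  have nz: "\<nu> \<noteq> 0" using assms(3) by auto
  let ?h = "hom_symbol m a \<nu>" and ?S = "halfspace \<nu>"
  have h: "?h > 0" using assms(2) nz by (simp add: elliptic_def)
  have F: "F_H m a \<nu> > 0" "F_H m a \<nu> ^ (2 * m) = ?h"
    using F_H_pos[OF assms(1,2) nz] F_H_power[OF assms(1,2)] by auto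
  have w: "((\<nu> \<bullet> x) / F_H m a \<nu>) ^ (2 * m) = (\<nu> \<bullet> x) ^ (2 * m) / ?h" for x
    by (simp add: power_divide F(2))
  have zero: "u x = 0" if "u \<in> Cc_inf ?S" "x \<notin> ?S" for u x
    using that zero_outside_tsupport[of x u] by (auto simp: Cc_inf_def)
  have lhs: "integral ?S (\<lambda>x. u x * hom_op m a u x) = (LBINT x. u x * hom_op m a u x)" if u: "u \<in> Cc_inf ?S" for u
  proof (rule integral_halfspace(1))
    obtain c d where cd: "tsupport u \<subseteq> cbox c d" using halfspace_support_bounds[OF u] by blast
    have us: "smooth_fun u" using u by (simp add: Cc_inf_def)
    show "integrable lborel (\<lambda>x. u x * hom_op m a u x)"
      by (intro continuous_compact_support_integrable[of _ c d] continuous_on_mult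
          smooth_fun_continuous[OF us] continuous_hom_op[OF us]) (use cd zero_outside_tsupport[of _ u] in auto)
  qed (simp add: zero[OF u])
  have rhs: "integral ?S (\<lambda>x. ?h * ((u x)\<^sup>2 / (\<nu> \<bullet> x) ^ (2 * m))) = ?h * (LBINT x. (u x)\<^sup>2 / (\<nu> \<bullet> x) ^ (2 * m))"
    "(\<lambda>x. ?h * ((u x)\<^sup>2 / (\<nu> \<bullet> x) ^ (2 * m))) integrable_on ?S" if u: "u \<in> Cc_inf ?S" for u
    using integral_halfspace[OF hardy_weight_integrable[OF u, of "2 * m"]] zero[OF u]
    by (auto simp del: times_divide_eq_right simp: integral_mult_right intro: integrable_on_mult_right)
  have "A_const m * integral ?S (\<lambda>x. (u x)\<^sup>2 / (d_H m a ?S x) ^ (2 * m)) \<le> integral ?S (\<lambda>x. u x * hom_op m a u x)"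
    if u: "u \<in> Cc_inf ?S" for u
  proof -
    have "integral ?S (\<lambda>x. (u x)\<^sup>2 / (d_H m a ?S x) ^ (2 * m)) \<le> ?h * (LBINT x. (u x)\<^sup>2 / (\<nu> \<bullet> x) ^ (2 * m))"
    \<comment> \<open>The lower bound for \<open>d_H\<close> dominates this weight but does not give
      its measurability, hence the case split: a non-integrable function has integral 0 by
      convention, and the right-hand side is nonnegative.\<close>
    proof (cases "(\<lambda>x. (u x)\<^sup>2 / (d_H m a ?S x) ^ (2 * m)) integrable_on ?S")
      case True
      have "(u x)\<^sup>2 / (d_H m a ?S x) ^ (2 * m) \<le> ?h * ((u x)\<^sup>2 / (\<nu> \<bullet> x) ^ (2 * m))" if "x \<in> ?S" for x
      proof -
        have x: "\<nu> \<bullet> x > 0" using that by (simp add: halfspace_def)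
        have "(\<nu> \<bullet> x) ^ (2 * m) / ?h \<le> (d_H m a ?S x) ^ (2 * m)"
          unfolding w[symmetric] using d_H_halfspace_lower[OF assms(1,2) nz, of x] x F(1) by (intro power_mono) auto
        moreover have "0 < (\<nu> \<bullet> x) ^ (2 * m) / ?h" using x h by simp
        ultimately have "(u x)\<^sup>2 / (d_H m a ?S x) ^ (2 * m) \<le> (u x)\<^sup>2 / ((\<nu> \<bullet> x) ^ (2 * m) / ?h)"
          by (intro divide_left_mono mult_pos_pos) auto
        then show ?thesis by (simp add: mult.commute)
      qed
      then show ?thesis unfolding rhs(1)[OF u, symmetric] by (intro integral_le True rhs(2)[OF u])
    next
      case False
      have "(u x)\<^sup>2 / (\<nu> \<bullet> x) ^ (2 * m) \<ge> 0" for x by (simp add: power_mult)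
      then show ?thesis using False h by (simp add: not_integrable_integral)
    qed
    then have "A_const m * integral ?S (\<lambda>x. (u x)\<^sup>2 / (d_H m a ?S x) ^ (2 * m)) \<le>
        A_const m * (?h * (LBINT x. (u x)\<^sup>2 / (\<nu> \<bullet> x) ^ (2 * m)))"
      by (intro mult_left_mono A_const_nonneg)
    also have "\<dots> \<le> (LBINT x. u x * hom_op m a u x)"
      using hardy_halfspace[OF assms u] by (simp only: mult.assoc mult.left_commute)
    finally show ?thesis unfolding lhs[OF u] .
  qed
  moreover have "\<exists>u\<in>Cc_inf ?S. integral ?S (\<lambda>x. u x * hom_op m a u x) <
      C * integral ?S (\<lambda>x. (u x)\<^sup>2 / (d_H m a ?S x) ^ (2 * m))"
    if convex: "convex_on UNIV (F_H m a)" and C: "C > A_const m" for C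
  proof -
    obtain u where u: "u \<in> Cc_inf ?S" and
      less: "(LBINT x. u x * hom_op m a u x) < C * ?h * (LBINT x. (u x)\<^sup>2 / (\<nu> \<bullet> x) ^ (2 * m))"
      using hardy_halfspace_sharp[OF assms(2,3) C] by blast
    have "integral ?S (\<lambda>x. (u x)\<^sup>2 / (d_H m a ?S x) ^ (2 * m)) = integral ?S (\<lambda>x. ?h * ((u x)\<^sup>2 / (\<nu> \<bullet> x) ^ (2 * m)))"
    proof (rule integral_cong)
      fix x assume "x \<in> ?S"
      then show "(u x)\<^sup>2 / (d_H m a ?S x) ^ (2 * m) = ?h * ((u x)\<^sup>2 / (\<nu> \<bullet> x) ^ (2 * m))"
        unfolding d_H_halfspace_convex[OF assms(1,2) convex assms(3) \<open>x \<in> ?S\<close>] w by (simp add: mult.commute)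
    qed
    then show ?thesis
      using less unfolding rhs(1)[OF u] lhs[OF u, symmetric] by (intro bexI[OF _ u]) (simp only: mult.assoc)
  qed
  ultimately show ?thesis by blast
qed

end
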